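(* Let $\alpha>0$ and suppose $S$ is a linear operator defined on $\mathcal{D}$. If there are some $0<\sigma<p<\infty$ such that $$M= \sup_{z\in \mathbb{C}^n} \int_{\mathbb{C}^n} |S_z1(u)|^{p} e^{-\frac{\alpha\sigma}{2} |u|^2}\, dV(u)<\infty, \qquad ( * )$$ then, with a constant $C$ independent of $S$, $z$ and $w$, $$\left| \langle Sk_{z}, k_{w}\rangle_{F^2_\alpha} \right| \le C M^{\frac{1}{p}} e^{- \frac{\alpha(p-\sigma)}{2p} |z-w|^2}\quad\text{for all } z,w\in\mathbb{C}^n,$$ so $S$ is bounded on $F^s_\alpha$ for all $0<s< \infty$. Furthermore, if both $( * )$ and $$\lim_{z\to \infty} \int_{\mathbb{C}^n} |S_z1(u)|^{p} e^{-\frac{\alpha\sigma}{2} |u|^2}\, dV(u) =0$$ hold, then $S$ is compact on $F^s_\alpha$ for all $0<s<\infty$.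
   Context: Let $n\ge1$ and let $dV$ be Lebesgue measure on $\mathbb{C}^n$. For $\alpha>0$ and $0<s<\infty$, the classical Fock space $F^s_\alpha$ is the space of entire functions $f$ on $\mathbb{C}^n$ with $\|f\|_{s,\alpha}=\left(\int_{\mathbb{C}^n}|f(z)e^{-\frac{\alpha}{2}|z|^2}|^s\,dV(z)\right)^{1/s}<\infty$ (a metric space with metric $\|f-g\|_{s,\alpha}^s$ when $s<1$), and $F^\infty_\alpha$ is the space of entire $f$ with $\sup_z|f(z)|e^{-\frac{\alpha}{2}|z|^2}<\infty$. In this result the reproducing kernel of $F^2_\alpha$ is normalized as $K(w,z)=e^{\alpha\langle w,z\rangle}$, where $\langle w,z\rangle=\sum_j w_j\overline{z_j}$; that is, $\langle f,g\rangle_{F^2_\alpha}=(\alpha/\pi)^n\int_{\mathbb{C}^n}f\overline{g}\,e^{-\alpha|z|^2}\,dV$. Write $K_z=K(\cdot,z)$ and let $k_z(w)=e^{\alpha\langle w,z\rangle-\frac{\alpha}{2}|z|^2}$ be the normalized reproducing kernel. $\mathcal{D}$ is the linear span of $\{k_z:z\in\mathbb{C}^n\}$. As a standing assumption, $S$ maps $\mathcal{D}$ into $F^\infty_\alpha$ and $z\mapsto SK_z$ is conjugate holomorphic. For $z\in\mathbb{C}^n$ let $\phi_z(u)=z-u$ and $U_zf=(f\circ\phi_z)k_z$ (a self-adjoint unitary operator on $F^2_\alpha$), and define $S_z=U_zSU_z^*$; thus $S_z1(u)=k_z(u)\,(Sk_z)(z-u)$. "$S$ is bounded (compact) on $F^s_\alpha$"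 means that $S$ extends from the dense subspace $\mathcal{D}$ to a bounded (compact) linear operator on $F^s_\alpha$, compact meaning that the unit ball is mapped to a relatively compact set. *)

theory Defs
  imports "HOL-Analysis.Analysis"
begin

(* Differentiability on C^n is real Frechet differentiability with a complex-linear derivative. *)
definition entire :: "(complex^'n \<Rightarrow> complex) \<Rightarrow> bool" where
  "entire f \<longleftrightarrow>
    (\<forall>z. \<exists>D. (f has_derivative D) (at z) \<and> (\<forall>c v. D (c *s v) = c * D v))"

definition hprod :: "complex^'n \<Rightarrow> complex^'n \<Rightarrow> complex" where
  "hprod w z = (\<Sum>j\<in>UNIV. w $ j * cnj (z $ j))"

definition rep_kernel :: "real \<Rightarrow> complex^'n \<Rightarrow> complex^'n \<Rightarrow> complex" where
  "rep_kernel \<alpha> z = (\<lambda>w. exp (of_real \<alpha> * hprod w z))"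

definition norm_kernel :: "real \<Rightarrow> complex^'n \<Rightarrow> complex^'n \<Rightarrow> complex" where
  "norm_kernel \<alpha> z = (\<lambda>w. exp (of_real \<alpha> * hprod w z - of_real (\<alpha> / 2 * (norm z)\<^sup>2)))"

definition fock :: "real \<Rightarrow> real \<Rightarrow> (complex^'n \<Rightarrow> complex) set" where
  "fock \<alpha> s = {f. entire f \<and>
    integrable lborel (\<lambda>z. norm (f z * of_real (exp (- (\<alpha> / 2) * (norm z)\<^sup>2))) powr s)}"

definition fock_norm :: "real \<Rightarrow> real \<Rightarrow> (complex^'n \<Rightarrow> complex) \<Rightarrow> real" where
  "fock_norm \<alpha> s f =
    (LINT z|lborel. norm (f z * of_real (exp (- (\<alpha> / 2) * (norm z)\<^sup>2))) powr s) powr (1 / s)"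

definition fock_dist ::
    "real \<Rightarrow> real \<Rightarrow> (complex^'n \<Rightarrow> complex) \<Rightarrow> (complex^'n \<Rightarrow> complex) \<Rightarrow> real" where
  "fock_dist \<alpha> s f g =
    (if s < 1 then fock_norm \<alpha> s (\<lambda>z. f z - g z) powr s else fock_norm \<alpha> s (\<lambda>z. f z - g z))"

definition fock_infty :: "real \<Rightarrow> (complex^'n \<Rightarrow> complex) set" where
  "fock_infty \<alpha> = {f. entire f \<and>
    bdd_above (range (\<lambda>z. norm (f z) * exp (- (\<alpha> / 2) * (norm z)\<^sup>2)))}"

definition fock_inner ::
    "real \<Rightarrow> (complex^'n \<Rightarrow> complex) \<Rightarrow> (complex^'n \<Rightarrow> complex) \<Rightarrow> complex" where
  "fock_inner \<alpha> f g = of_real ((\<alpha> / pi) ^ CARD('n)) *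
    (LINT z|lborel. f z * cnj (g z) * of_real (exp (- \<alpha> * (norm z)\<^sup>2)))"

definition kernel_span :: "real \<Rightarrow> (complex^'n \<Rightarrow> complex) set" where
  "kernel_span \<alpha> = {f. \<exists>A c. finite A \<and> f = (\<lambda>w. \<Sum>z\<in>A. c z * norm_kernel \<alpha> z w)}"

type_synonym 'n operator = "(complex^'n \<Rightarrow> complex) \<Rightarrow> complex^'n \<Rightarrow> complex"

(* Operators are total functions in HOL; only their values on the given subspace are constrained. *)
definition clinear_on :: "(complex^'n \<Rightarrow> complex) set \<Rightarrow> 'n operator \<Rightarrow> bool" where
  "clinear_on V T \<longleftrightarrow>
    (\<forall>f\<in>V. \<forall>g\<in>V. T (\<lambda>z. f z + g z) = (\<lambda>z. T f z + T g z)) \<and>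
    (\<forall>c. \<forall>f\<in>V. T (\<lambda>z. c * f z) = (\<lambda>z. c * T f z))"

(* The last conjunct: z |-> S K_z is conjugate holomorphic, in the sense that each of the scalar
   functions z |-> (S K_z)(w) is. *)
definition admissible :: "real \<Rightarrow> 'n::finite operator \<Rightarrow> bool" where
  "admissible \<alpha> S \<longleftrightarrow>
    clinear_on (kernel_span \<alpha>) S \<and>
    S ` kernel_span \<alpha> \<subseteq> fock_infty \<alpha> \<and>
    (\<forall>w. entire (\<lambda>z. cnj (S (rep_kernel \<alpha> z) w)))"

definition weyl :: "real \<Rightarrow> complex^'n \<Rightarrow> 'n::finite operator" where
  "weyl \<alpha> z f = (\<lambda>u. f (z - u) * norm_kernel \<alpha> z u)"

(* The conjugate U_z S U_z^*; the operator U_z = weyl \<alpha> z is its own adjoint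
   (see weyl_self_adjoint and weyl_involution below), so U_z^* is written as U_z. *)
definition conj_op :: "real \<Rightarrow> complex^'n \<Rightarrow> 'n::finite operator \<Rightarrow> 'n operator" where
  "conj_op \<alpha> z S = weyl \<alpha> z \<circ> S \<circ> weyl \<alpha> z"

definition local_integral ::
    "real \<Rightarrow> real \<Rightarrow> real \<Rightarrow> 'n::finite operator \<Rightarrow> complex^'n \<Rightarrow> ennreal" where
  "local_integral \<alpha> p \<sigma> S z =
    (\<integral>\<^sup>+ u. ennreal (norm (conj_op \<alpha> z S (\<lambda>_. 1) u) powr p
       * exp (- (\<alpha> * \<sigma> / 2) * (norm u)\<^sup>2)) \<partial>lborel)"

definition extends_to :: "real \<Rightarrow> real \<Rightarrow> 'n::finite operator \<Rightarrow> 'n operator \<Rightarrow> bool" where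
  "extends_to \<alpha> s S T \<longleftrightarrow>
    T ` fock \<alpha> s \<subseteq> fock \<alpha> s \<and> clinear_on (fock \<alpha> s) T \<and> (\<forall>f\<in>kernel_span \<alpha>. T f = S f)"

definition bounded_on_fock :: "real \<Rightarrow> real \<Rightarrow> 'n::finite operator \<Rightarrow> bool" where
  "bounded_on_fock \<alpha> s S \<longleftrightarrow> (\<exists>T. extends_to \<alpha> s S T \<and>
    (\<exists>B. \<forall>f\<in>fock \<alpha> s. fock_norm \<alpha> s (T f) \<le> B * fock_norm \<alpha> s f))"

definition fock_topology :: "real \<Rightarrow> real \<Rightarrow> (complex^'n \<Rightarrow> complex) topology" where
  "fock_topology \<alpha> s = Metric_space.mtopology (fock \<alpha> s) (fock_dist \<alpha> s)"

definition compact_on_fock :: "real \<Rightarrow> real \<Rightarrow> 'n::finite operator \<Rightarrow> bool" where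
  "compact_on_fock \<alpha> s S \<longleftrightarrow> (\<exists>T. extends_to \<alpha> s S T \<and>
    compactin (fock_topology \<alpha> s)
      (fock_topology \<alpha> s closure_of (T ` {f \<in> fock \<alpha> s. fock_norm \<alpha> s f \<le> 1})))"

lemma weyl_one: "weyl \<alpha> z (\<lambda>_. 1) = norm_kernel \<alpha> z"
  by (simp add: weyl_def)

lemma conj_op_one:
  "conj_op \<alpha> z S (\<lambda>_. 1) u = norm_kernel \<alpha> z u * S (norm_kernel \<alpha> z) (z - u)"
  by (simp add: conj_op_def weyl_one) (simp add: weyl_def)

lemma hprod_diff_left: "hprod (u - v) w = hprod u w - hprod v w"
  by (simp add: hprod_def left_diff_distrib sum_subtractf)

lemma hprod_diff_right: "hprod u (v - w) = hprod u v - hprod u w"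
  by (simp add: hprod_def right_diff_distrib sum_subtractf)

lemma cnj_hprod: "cnj (hprod w z) = hprod z w"
  by (simp add: hprod_def mult.commute)

lemma hprod_self: "hprod z z = of_real ((norm z)\<^sup>2)"
  by (simp add: hprod_def norm_vec_def L2_set_def sum_nonneg complex_norm_square
      del: of_real_power)

lemma norm_diff_hprod:
  "(of_real ((norm (z - v))\<^sup>2) :: complex)
     = of_real ((norm z)\<^sup>2) - hprod z v - hprod v z + of_real ((norm v)\<^sup>2)"
  by (simp only: hprod_self[symmetric] hprod_diff_left hprod_diff_right) simp

lemma weyl_involution: "weyl \<alpha> z (weyl \<alpha> z f) = f"
proof
  fix u
  have "norm_kernel \<alpha> z (z - u) * norm_kernel \<alpha> z u = 1"
    unfolding norm_kernel_def mult_exp_exp hprod_diff_left hprod_self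
    by (simp add: right_diff_distrib)
  then show "weyl \<alpha> z (weyl \<alpha> z f) u = f u"
    by (simp add: weyl_def mult.assoc)
qed

lemma lborel_integral_reflect:
  fixes g :: "'a::euclidean_space \<Rightarrow> complex"
  shows "(LINT v|lborel. g (z - v)) = (LINT v|lborel. g v)"
proof (cases "g \<in> borel_measurable borel")
  case True
  have "(lborel :: 'a measure) = distr lborel borel (\<lambda>x. z - x)"
    using lborel_affine[of "-1" z] by (simp add: density_1)
  then have "(LINT v|lborel. g v) = (LINT v|distr lborel borel (\<lambda>x. z - x). g v)"
    by simp
  also have "\<dots> = (LINT v|lborel. g (z - v))"
    using True by (intro integral_distr) auto
  finally show ?thesis by simp
next
  case False
  have "(\<lambda>v. g (z - v)) \<notin> borel_measurable borel"
  proof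
    assume "(\<lambda>v. g (z - v)) \<in> borel_measurable borel"
    then have "(\<lambda>v. g (z - (z - v))) \<in> borel_measurable borel"
      by (rule measurable_compose[rotated]) simp
    with False show False by simp
  qed
  then have "\<not> integrable lborel (\<lambda>v. g (z - v))" and "\<not> integrable lborel g"
    using False borel_measurable_integrable by fastforce+
  then show ?thesis
    by (simp add: not_integrable_integral_eq)
qed

lemma weyl_self_adjoint: "fock_inner \<alpha> (weyl \<alpha> z f) g = fock_inner \<alpha> f (weyl \<alpha> z g)"
proof -
  have E: "norm_kernel \<alpha> z (z - v) * of_real (exp (- \<alpha> * (norm (z - v))\<^sup>2))
     = cnj (norm_kernel \<alpha> z v) * of_real (exp (- \<alpha> * (norm v)\<^sup>2))" for v
  proof -
    have "norm_kernel \<alpha> z (z - v) * of_real (exp (- \<alpha> * (norm (z - v))\<^sup>2))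
      = exp (of_real \<alpha> * (of_real ((norm z)\<^sup>2) - hprod v z) - of_real (\<alpha> / 2 * (norm z)\<^sup>2)
          - of_real \<alpha> * of_real ((norm (z - v))\<^sup>2))"
      unfolding norm_kernel_def hprod_diff_left hprod_self exp_of_real[symmetric] mult_exp_exp
      by (simp del: of_real_power)
    also have "\<dots> = exp (of_real \<alpha> * hprod z v - of_real (\<alpha> / 2 * (norm z)\<^sup>2)
          - of_real \<alpha> * of_real ((norm v)\<^sup>2))"
      unfolding norm_diff_hprod
      by (simp add: algebra_simps del: of_real_power)
    also have "\<dots> = cnj (norm_kernel \<alpha> z v) * of_real (exp (- \<alpha> * (norm v)\<^sup>2))"
      unfolding norm_kernel_def exp_cnj exp_of_real[symmetric] mult_exp_exp
      by (simp add: cnj_hprod del: of_real_power)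
    finally show ?thesis .
  qed
  let ?G = "\<lambda>v. weyl \<alpha> z f v * cnj (g v) * of_real (exp (- \<alpha> * (norm v)\<^sup>2))"
  have G: "?G (z - v) = f v * cnj (weyl \<alpha> z g v) * of_real (exp (- \<alpha> * (norm v)\<^sup>2))" for v
  proof -
    have "?G (z - v) = f v * cnj (g (z - v)) *
        (norm_kernel \<alpha> z (z - v) * of_real (exp (- \<alpha> * (norm (z - v))\<^sup>2)))"
      by (simp only: weyl_def mult_ac diff_diff_eq2 add_diff_cancel_left')
    then show ?thesis
      unfolding E by (simp only: weyl_def complex_cnj_mult mult_ac)
  qed
  have "integral\<^sup>L lborel ?G =
      (LINT v|lborel. f v * cnj (weyl \<alpha> z g v) * of_real (exp (- \<alpha> * (norm v)\<^sup>2)))"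
    by (subst lborel_integral_reflect[of ?G z, symmetric]) (simp only: G)
  then show ?thesis
    by (simp only: fock_inner_def)
qed

end

theory Submission
  imports Defs "HOL-Complex_Analysis.Complex_Analysis" "HOL-Real_Asymp.Real_Asymp"
begin

text \<open>
  Since \<open>S\<^sub>z 1 (u) = k\<^sub>z(u) (S k\<^sub>z)(z - u)\<close>, a computation with Gaussians gives
  \<open>|S\<^sub>z 1 (z - w)| = |(S k\<^sub>z)(w)| exp(-\<alpha>|w|\<^sup>2/2) exp(\<alpha>|z - w|\<^sup>2/2)\<close>, and by the reproducing formula
  \<open>|(S k\<^sub>z)(w)| exp(-\<alpha>|w|\<^sup>2/2)\<close> is, up to a constant, the pairing of \<open>S k\<^sub>z\<close> with \<open>k\<^sub>w\<close>.
  The hypothesis is a weighted \<open>L\<^sup>p\<close> bound for the entire function \<open>S\<^sub>z 1\<close>; as \<open>|f|\<^sup>p\<close> has a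
  sub-mean value property for every \<open>p > 0\<close>, it yields the pointwise growth
  \<open>|S\<^sub>z 1 (u)| \<le> C M\<^bsup>1/p\<^esup> exp(\<alpha>\<sigma>|u|\<^sup>2/(2p))\<close>. Because \<open>\<sigma> < p\<close> this is slower than \<open>exp(\<alpha>|u|\<^sup>2/2)\<close>, and
  the difference is the Gaussian off-diagonal decay \<open>exp(-c|z - w|\<^sup>2)\<close>, \<open>c = \<alpha>(p - \<sigma>)/(2p)\<close>
  (\<open>norm_kernel_image_estimate\<close>).

  For boundedness, \<open>S\<close> is extended by the integral operator \<open>T\<close> with kernel \<open>Q(w,z) = (S K\<^sub>z)(w)\<close>.
  As \<open>z \<mapsto> (S K\<^sub>z)(w)\<close> is conjugate holomorphic and of at most the growth of a function in
  \<open>F\<^sup>\<infinity>\<close>, the reproducing formula applied to its conjugate shows that \<open>T\<close> agrees with \<open>S\<close>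
  on the reproducing kernels (\<open>kernel_op_at_rep_kernel\<close>). For \<open>s \<ge> 1\<close>
  the estimate of \<open>T\<close> is Jensen's inequality for a Gaussian convolution. For \<open>s < 1\<close> convexity is replaced by the
  holomorphy of \<open>z \<mapsto> f(z) cnj(Q(w,z))\<close>, which allows an application of the inclusion \<open>F\<^sup>s \<subseteq> F\<^sup>1\<close>
  (with weight parameter \<open>2\<alpha>\<close>) for every fixed \<open>w\<close>. Both cases are contained in
  \<open>\<parallel>T f\<parallel>\<^sup>s \<le> C \<integral> (|f(z)| exp(-\<alpha>|z|\<^sup>2/2) e(z))\<^sup>s dV(z)\<close>, where \<open>e(z)\<close> is the size of the kernel in front of
  its Gaussian decay (\<open>kernel_op_power_bound\<close>).

  For compactness it is essential that \<open>e(z)\<close> stands under the integral: if the local integrals tend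
  to \<open>0\<close>, then \<open>e(z)\<close> can be taken smaller than any \<open>\<eta> > 0\<close> outside a ball. A sequence in the unit ball
  of \<open>F\<^sup>s\<close> is uniformly bounded with weight and locally Lipschitz, so a subsequence converges pointwise, and
  the limit lies in \<open>F\<^sup>s\<close>. The differences tend to \<open>0\<close> in \<open>L\<^sup>s\<close> on every ball by dominated
  convergence, and the complement of the ball contributes at most \<open>C \<eta>\<^sup>s\<close>
  (\<open>kernel_op_vanishing\<close>, \<open>kernel_op_compact\<close>).

  Constants such as \<open>\<integral> exp(-\<alpha>|z|\<^sup>2) dV\<close> are kept as the positive number \<open>gauss \<alpha>\<close>: the estimates
  allow a constant factor, and the integral operator divides by it.
\<close>

section \<open>Invariance of Lebesgue measure under linear isometries\<close>

lemma nn_integral_lborel_shift: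
  fixes g :: "'a::euclidean_space \<Rightarrow> ennreal"
  assumes [measurable]: "g \<in> borel_measurable borel"
  shows "(\<integral>\<^sup>+x. g (c + x) \<partial>lborel) = (\<integral>\<^sup>+x. g x \<partial>lborel)"
proof -
  have "(\<integral>\<^sup>+x. g x \<partial>lborel) = (\<integral>\<^sup>+x. g x \<partial>(distr lborel borel ((+) c)))"
    by (simp add: lborel_distr_plus)
  also have "\<dots> = (\<integral>\<^sup>+x. g (c + x) \<partial>lborel)"
    by (subst nn_integral_distr) auto
  finally show ?thesis ..
qed

lemma nn_integral_lborel_reflect:
  fixes g :: "'a::euclidean_space \<Rightarrow> ennreal"
  assumes [measurable]: "g \<in> borel_measurable borel"
  shows "(\<integral>\<^sup>+x. g (c - x) \<partial>lborel) = (\<integral>\<^sup>+x. g x \<partial>lborel)"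
proof -
  have "(lborel :: 'a measure) = distr lborel borel (\<lambda>x. c - x)"
    using lborel_affine[of "-1" c] by (simp add: density_1)
  then have "(\<integral>\<^sup>+x. g x \<partial>lborel) = (\<integral>\<^sup>+x. g x \<partial>(distr lborel borel (\<lambda>x. c - x)))"
    by simp
  also have "\<dots> = (\<integral>\<^sup>+x. g (c - x) \<partial>lborel)"
    by (subst nn_integral_distr) auto
  finally show ?thesis ..
qed

text \<open>The image measure is translation invariant because \<open>f\<close> is linear and onto, and it gives the unit ball its
  Lebesgue measure because \<open>f\<close> is isometric. The proof is that of the uniqueness of Haar measure: for the
  unit ball \<open>B\<close>, the double integral of \<open>1\<^sub>A(f x + y) 1\<^sub>B(y)\<close> is evaluated in both orders.\<close>

lemma lborel_distr_orthogonal: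
  fixes f :: "'a::euclidean_space \<Rightarrow> 'a"
  assumes f: "orthogonal_transformation f"
  shows "distr lborel borel f = lborel"
proof (rule measure_eqI)
  have lin: "linear f" using f by (rule orthogonal_transformation_linear)
  have fm [measurable]: "f \<in> borel_measurable borel"
    using lin by (intro borel_measurable_continuous_onI linear_continuous_on)
      (simp add: linear_conv_bounded_linear)
  fix A assume "A \<in> sets (distr lborel borel f)"
  then have [measurable]: "A \<in> sets borel" by simp
  define B where "B = ball (0::'a) 1"
  have [measurable]: "B \<in> sets borel" by (simp add: B_def)
  define b where "b = emeasure lborel B"
  have b: "0 < b" "b < \<infinity>"
    using emeasure_lborel_ball_finite[of "0::'a" 1] by (auto simp: b_def B_def emeasure_ball)
  let ?I = "indicator :: 'a set \<Rightarrow> 'a \<Rightarrow> ennreal"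
  define a where "a = (\<integral>\<^sup>+x. ?I A (f x) \<partial>lborel)"
  have a_shift: "(\<integral>\<^sup>+x. ?I A (f x + y) \<partial>lborel) = a" for y
  proof -
    obtain x0 where x0: "f x0 = y"
      using orthogonal_transformation_surj[OF f] by (metis surjD)
    have "(\<integral>\<^sup>+x. ?I A (f x + y) \<partial>lborel) = (\<integral>\<^sup>+x. ?I A (f (x0 + x)) \<partial>lborel)"
      by (simp add: linear_add[OF lin] x0 add.commute)
    also have "\<dots> = a"
      unfolding a_def by (rule nn_integral_lborel_shift[where g = "\<lambda>x. ?I A (f x)"]) simp
    finally show ?thesis .
  qed
  have b_shift: "(\<integral>\<^sup>+x. ?I B (y - f x) \<partial>lborel) = b" for y
  proof -
    obtain x0 where x0: "f x0 = y"
      using orthogonal_transformation_surj[OF f] by (metis surjD)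
    have "norm (y - f x) = norm (x0 - x)" for x
      using orthogonal_transformation_norm[OF f, of "x0 - x"]
      by (simp add: linear_diff[OF lin] x0)
    then have "(\<integral>\<^sup>+x. ?I B (y - f x) \<partial>lborel) = (\<integral>\<^sup>+x. ?I B (x0 - x) \<partial>lborel)"
      by (intro nn_integral_cong) (simp add: B_def indicator_def)
    also have "\<dots> = b"
      by (subst nn_integral_lborel_reflect) (auto simp: b_def)
    finally show ?thesis .
  qed
  have "a * b = (\<integral>\<^sup>+y. a * ?I B y \<partial>lborel)"
    by (simp add: nn_integral_cmult b_def)
  also have "\<dots> = (\<integral>\<^sup>+y. (\<integral>\<^sup>+x. ?I A (f x + y) * ?I B y \<partial>lborel) \<partial>lborel)"
    by (subst nn_integral_multc) (auto simp: a_shift)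
  also have "\<dots> = (\<integral>\<^sup>+x. (\<integral>\<^sup>+y. ?I A (f x + y) * ?I B y \<partial>lborel) \<partial>lborel)"
    by (rule lborel_pair.Fubini') measurable
  also have "\<dots> = (\<integral>\<^sup>+x. (\<integral>\<^sup>+y. ?I A y * ?I B (y - f x) \<partial>lborel) \<partial>lborel)"
  proof (rule nn_integral_cong)
    fix x :: 'a
    show "(\<integral>\<^sup>+y. ?I A (f x + y) * ?I B y \<partial>lborel) = (\<integral>\<^sup>+y. ?I A y * ?I B (y - f x) \<partial>lborel)"
      using nn_integral_lborel_shift[of "\<lambda>y. ?I A y * ?I B (y - f x)" "f x"] by simp
  qed
  also have "\<dots> = (\<integral>\<^sup>+y. (\<integral>\<^sup>+x. ?I A y * ?I B (y - f x) \<partial>lborel) \<partial>lborel)"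
    by (rule lborel_pair.Fubini') measurable
  also have "\<dots> = (\<integral>\<^sup>+y. ?I A y * b \<partial>lborel)"
    by (subst nn_integral_cmult) (auto simp: b_shift)
  also have "\<dots> = emeasure lborel A * b"
    by (simp add: nn_integral_multc)
  finally have "a = emeasure lborel A"
    using b by (auto simp: mult.commute[of _ b] ennreal_mult_cancel_left)
  moreover have "emeasure (distr lborel borel f) A = a"
    unfolding a_def
    by (subst nn_integral_distr[of f lborel borel, symmetric]) auto
  ultimately show "emeasure (distr lborel borel f) A = emeasure lborel A" by simp
qed simp

section \<open>Entire functions of several variables and Cauchy estimates\<close>

lemma entireE:
  assumes "entire f"
  obtains D where "(f has_derivative D) (at z)" "\<And>c v. D (c *s v) = c * D v"
  using assms unfolding entire_def by blast

lemma entire_continuous: "entire f \<Longrightarrow> continuous_on UNIV f"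
  by (metis entireE has_derivative_continuous continuous_at_imp_continuous_on)

lemma entire_measurable [measurable_dest]: "entire f \<Longrightarrow> f \<in> borel_measurable borel"
  by (intro borel_measurable_continuous_onI entire_continuous)

lemma entire_const: "entire (\<lambda>_. c)"
  unfolding entire_def by (auto intro!: exI[of _ "\<lambda>_. 0"])

lemma entire_add:
  assumes "entire f" "entire g" shows "entire (\<lambda>z. f z + g z)"
  unfolding entire_def
proof
  fix z
  obtain D where "(f has_derivative D) (at z)" "\<And>c v. D (c *s v) = c * D v"
    using entireE[OF assms(1), of z] by blast
  moreover obtain E where "(g has_derivative E) (at z)" "\<And>c v. E (c *s v) = c * E v"
    using entireE[OF assms(2), of z] by blast
  ultimately show "\<exists>D. ((\<lambda>z. f z + g z) has_derivative D) (at z) \<and> (\<forall>c v. D (c *s v) = c * D v)"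
    by (intro exI[of _ "\<lambda>v. D v + E v"]) (auto intro: has_derivative_add simp: algebra_simps)
qed

lemma entire_mult:
  assumes "entire f" "entire g" shows "entire (\<lambda>z. f z * g z)"
  unfolding entire_def
proof
  fix z
  obtain D where "(f has_derivative D) (at z)" "\<And>c v. D (c *s v) = c * D v"
    using entireE[OF assms(1), of z] by blast
  moreover obtain E where "(g has_derivative E) (at z)" "\<And>c v. E (c *s v) = c * E v"
    using entireE[OF assms(2), of z] by blast
  ultimately show "\<exists>D. ((\<lambda>z. f z * g z) has_derivative D) (at z) \<and> (\<forall>c v. D (c *s v) = c * D v)"
    by (intro exI[of _ "\<lambda>v. f z * E v + D v * g z"])
       (use has_derivative_mult[of f D z UNIV g E] in \<open>auto simp: algebra_simps\<close>)
qed

lemma entire_diff: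
  assumes "entire f" "entire g" shows "entire (\<lambda>z. f z - g z)"
  using entire_add[OF assms(1) entire_mult[OF entire_const[of "-1"] assms(2)]] by simp

lemma entire_exp:
  assumes "entire f" shows "entire (\<lambda>z. exp (f z))"
  unfolding entire_def
proof
  fix z
  obtain D where D: "(f has_derivative D) (at z)" "\<And>c v. D (c *s v) = c * D v"
    using entireE[OF assms, of z] by blast
  have "(exp has_derivative (*) (exp (f z))) (at (f z))"
    using DERIV_exp[of "f z"] by (simp add: has_field_derivative_def)
  from diff_chain_at[OF D(1) this]
  show "\<exists>D. ((\<lambda>z. exp (f z)) has_derivative D) (at z) \<and> (\<forall>c v. D (c *s v) = c * D v)"
    using D(2) by (intro exI[of _ "\<lambda>v. exp (f z) * D v"]) (simp add: o_def mult_ac)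
qed

lemma bounded_linear_hprod: "bounded_linear (\<lambda>w. hprod w z)"
proof -
  have "linear (\<lambda>w. hprod w z)"
    by (auto intro!: linearI simp: hprod_def sum.distrib algebra_simps scaleR_sum_right)
  then show ?thesis by (simp add: linear_conv_bounded_linear)
qed

lemma hprod_scale: "hprod (c *s w) z = c * hprod w z"
  by (simp add: hprod_def sum_distrib_left mult_ac)

lemma entire_hprod: "entire (\<lambda>w. hprod w z)"
  unfolding entire_def
  by (auto intro!: exI[of _ "\<lambda>w. hprod w z"] bounded_linear_imp_has_derivative
      bounded_linear_hprod simp: hprod_scale)

lemma entire_reflect:
  assumes "entire f" shows "entire (\<lambda>u. f (z - u))"
  unfolding entire_def
proof
  fix u
  obtain D where D: "(f has_derivative D) (at (z - u))" "\<And>c v. D (c *s v) = c * D v"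
    using entireE[OF assms, of "z - u"] by blast
  have "((\<lambda>u. z - u) has_derivative (\<lambda>v. - v)) (at u)"
    by (auto intro!: derivative_eq_intros)
  from diff_chain_at[OF this D(1)]
  show "\<exists>D. ((\<lambda>u. f (z - u)) has_derivative D) (at u) \<and> (\<forall>c v. D (c *s v) = c * D v)"
    using D(2)[of _ "- _"] by (intro exI[of _ "\<lambda>v. D (- v)"]) (auto simp: o_def)
qed

lemma entire_shift:
  assumes "entire f" shows "entire (\<lambda>u. f (z + u))"
  using entire_reflect[OF entire_reflect[OF assms, of z], of 0] by simp

lemma entire_norm_kernel: "entire (norm_kernel \<alpha> z)"
  unfolding norm_kernel_def
  by (intro entire_exp entire_diff entire_mult entire_const entire_hprod)

lemma entire_rep_kernel: "entire (rep_kernel \<alpha> z)"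
  unfolding rep_kernel_def
  by (intro entire_exp entire_mult entire_const entire_hprod)

lemma norm_scale_vec: "norm (c *s (v::complex^'n)) = norm c * norm v"
  by (simp add: norm_vec_def norm_mult L2_set_right_distrib)

lemma bounded_linear_scale: "bounded_linear (\<lambda>t. t *s (v::complex^'n))"
proof -
  have "linear (\<lambda>t. t *s (v::complex^'n))"
    by (auto intro!: linearI simp: vec_eq_iff algebra_simps)
  then show ?thesis by (simp add: linear_conv_bounded_linear)
qed

text \<open>Restriction to complex lines is the bridge to one-variable function theory: the Cauchy estimates
  and mean values below are obtained from slices.\<close>

lemma entire_line:
  fixes f :: "complex^'n \<Rightarrow> complex"
  assumes "(f has_derivative D) (at (x + t *s v))" "\<And>c v. D (c *s v) = c * D v"
  shows "((\<lambda>t. f (x + t *s v)) has_field_derivative D v) (at t)"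
proof -
  have "((\<lambda>t. x + t *s v) has_derivative (\<lambda>t. t *s v)) (at t)"
    using has_derivative_add[OF has_derivative_const[of x]
        bounded_linear_imp_has_derivative[OF bounded_linear_scale]] by simp
  from diff_chain_at[OF this assms(1)] show ?thesis
    by (simp add: o_def has_field_derivative_def assms(2) mult.commute[of _ "D v"])
qed

lemma entire_line_holomorphic:
  assumes "entire f" shows "(\<lambda>t. f (x + t *s v)) holomorphic_on A"
  unfolding holomorphic_on_def field_differentiable_def
proof
  fix t
  obtain D where "(f has_derivative D) (at (x + t *s v))" "\<And>c v. D (c *s v) = c * D v"
    using entireE[OF assms, of "x + t *s v"] by blast
  from entire_line[OF this]
  show "\<exists>d. ((\<lambda>t. f (x + t *s v)) has_field_derivative d) (at t within A)"
    using has_field_derivative_at_within by blast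
qed

text \<open>Taylor expansion with the remainders controlled by Cauchy's inequalities on circles of radius \<open>1\<close> around
  points of the unit disc, which lie in the disc of radius \<open>2\<close>.\<close>

lemma cauchy_second_order:
  fixes g :: "complex \<Rightarrow> complex"
  assumes g: "g holomorphic_on UNIV" and B: "\<And>t. norm t \<le> 2 \<Longrightarrow> norm (g t) \<le> B"
    and t: "norm t \<le> 1"
  shows "norm (deriv g 0) \<le> B" "norm (g t - g 0) \<le> B * norm t"
    "norm (g t - g 0 - deriv g 0 * t) \<le> 2 * B * (norm t)\<^sup>2"
proof -
  have cauchy: "norm ((deriv ^^ n) g u) \<le> fact n * B" if "norm u \<le> 1" for n u
  proof -
    have "norm ((deriv ^^ n) g u) \<le> fact n * B / 1 ^ n"
    proof (rule Cauchy_inequality)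
      show "norm (g x) \<le> B" if "norm (u - x) = 1" for x
        using that \<open>norm u \<le> 1\<close> norm_triangle_ineq4[of u "u - x"] by (intro B) simp
      show "g holomorphic_on ball u 1" using g by (rule holomorphic_on_subset) simp
      show "continuous_on (cball u 1) g"
        using holomorphic_on_imp_continuous_on[OF g] continuous_on_subset by blast
    qed simp
    then show ?thesis by simp
  qed
  have d: "((deriv ^^ i) g has_field_derivative (deriv ^^ Suc i) g x) (at x within cball 0 1)" for i x
    using holomorphic_derivI[OF holomorphic_higher_deriv[OF g open_UNIV] open_UNIV, of x i]
    by (simp add: has_field_derivative_at_within)
  show "norm (deriv g 0) \<le> B" using cauchy[of 0 1] by simp
  show "norm (g t - g 0) \<le> B * norm t"
  proof -
    have "norm ((deriv ^^ Suc 0) g x) \<le> B" if "x \<in> cball 0 1" for x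
      using cauchy[of x 1] that by simp
    from complex_Taylor[of "cball 0 1" 0 "\<lambda>i. (deriv ^^ i) g" B 0 t, OF _ d this]
    show ?thesis using t by simp
  qed
  have "norm ((deriv ^^ Suc 1) g x) \<le> 2 * B" if "x \<in> cball 0 1" for x
    using cauchy[of x 2] that by (simp add: numeral_2_eq_2)
  from complex_Taylor[of "cball 0 1" 1 "\<lambda>i. (deriv ^^ i) g" "2 * B" 0 t, OF _ d this]
  show "norm (g t - g 0 - deriv g 0 * t) \<le> 2 * B * (norm t)\<^sup>2"
    using t by (simp add: power2_eq_square algebra_simps)
qed

text \<open>The radii do not depend on the direction \<open>h\<close>, so restricting to the line through \<open>x\<close> in direction \<open>h\<close>
  gives bounds that are uniform in \<open>h\<close>. The third one permits differentiation under an integral sign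
  with only a bound on the values of the integrand.\<close>

lemma entire_cauchy_estimates:
  assumes f: "entire f" and B: "\<And>y. norm (y - x) \<le> 2 \<Longrightarrow> norm (f y) \<le> B"
    and D: "(f has_derivative D) (at x)" "\<And>c v. D (c *s v) = c * D v"
    and h: "norm h \<le> 1"
  shows "norm (D h) \<le> B * norm h" "norm (f (x + h) - f x) \<le> B * norm h"
    "norm (f (x + h) - f x - D h) \<le> 2 * B * (norm h)\<^sup>2"
proof -
  have "norm (D h) \<le> B * norm h \<and> norm (f (x + h) - f x) \<le> B * norm h
    \<and> norm (f (x + h) - f x - D h) \<le> 2 * B * (norm h)\<^sup>2"
  proof (cases "h = 0")
    case True
    then show ?thesis using D(2)[of 0 0] by simp
  next
    case False
    define v where "v = of_real (inverse (norm h)) *s h"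
    define t :: complex where "t = of_real (norm h)"
    have v: "norm v = 1" "t *s v = h" using False by (auto simp: v_def t_def norm_scale_vec norm_inverse vector_smult_assoc)
    define g where "g = (\<lambda>t. f (x + t *s v))"
    have "(g has_field_derivative D v) (at 0)"
      unfolding g_def using D by (intro entire_line) auto
    then have dg: "deriv g 0 = D v" by (rule DERIV_imp_deriv)
    have "g holomorphic_on UNIV" unfolding g_def using f by (rule entire_line_holomorphic)
    moreover have "norm (g t) \<le> B" if "norm t \<le> 2" for t
      unfolding g_def using that v by (intro B) (simp add: norm_scale_vec)
    moreover have "norm t \<le> 1" "norm t = norm h" using h by (auto simp: t_def)
    moreover have "D h = t * D v" by (metis D(2) v(2))
    moreover have "g t = f (x + h)" "g 0 = f x" by (simp_all add: g_def v)
    ultimately show ?thesis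
      using cauchy_second_order[of g B t] dg mult_left_mono[of "norm (D v)" B "norm h"]
      by (simp add: norm_mult mult.commute)
  qed
  then show "norm (D h) \<le> B * norm h" "norm (f (x + h) - f x) \<le> B * norm h"
    "norm (f (x + h) - f x - D h) \<le> 2 * B * (norm h)\<^sup>2" by auto
qed

section \<open>Parameter integrals and mean values\<close>

text \<open>A dominating function for the values suffices: by the Cauchy estimates it also dominates the derivatives
  \<open>D z\<close> and the second order remainders, so the derivative of the integral is the integral of \<open>D z\<close>.
  Measurability of \<open>z \<mapsto> D z h\<close> holds because it is a limit of difference quotients.\<close>

lemma entire_integral:
  fixes H :: "complex^'n \<Rightarrow> 'b \<Rightarrow> complex"
  assumes ent: "\<And>z. entire (\<lambda>w. H w z)"
    and meas: "\<And>w. H w \<in> borel_measurable M"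
    and dom: "\<And>R. \<exists>G. integrable M G \<and> (\<forall>w z. norm w \<le> R \<longrightarrow> norm (H w z) \<le> G z)"
  shows "entire (\<lambda>w. LINT z|M. H w z)"
  unfolding entire_def
proof
  fix w :: "complex^'n"
  obtain G where G: "integrable M G"
    and HG: "\<And>w' z. norm w' \<le> norm w + 2 \<Longrightarrow> norm (H w' z) \<le> G z"
    using dom[of "norm w + 2"] by blast
  have HG': "norm (H y z) \<le> G z" if "norm (y - w) \<le> 2" for y z
    using that norm_triangle_ineq2[of y w] by (intro HG) linarith
  have int_H: "integrable M (H y)" if "norm (y - w) \<le> 2" for y
    by (rule Bochner_Integration.integrable_bound[OF G meas])
       (use HG'[OF that] in \<open>auto intro: order_trans[OF _ abs_ge_self]\<close>)
  have "\<exists>D. ((\<lambda>w. H w z) has_derivative D) (at w) \<and> (\<forall>c v. D (c *s v) = c * D v)" for z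
    using ent[of z] unfolding entire_def by blast
  then obtain D where D: "\<And>z. ((\<lambda>w. H w z) has_derivative D z) (at w)"
    and D_scale: "\<And>z c v. D z (c *s v) = c * D z v"
    by metis
  note est = entire_cauchy_estimates[OF ent HG' D D_scale]
  have D_lin: "linear (D z)" for z
    using D[of z] by (simp add: has_derivative_linear)
  have D_meas: "(\<lambda>z. D z h) \<in> borel_measurable M" for h
  proof (rule borel_measurable_LIMSEQ_metric)
    let ?t = "\<lambda>n. 1 / of_nat (Suc n) :: complex"
    show "(\<lambda>z. (H (w + ?t n *s h) z - H w z) / ?t n) \<in> borel_measurable M" for n
      using meas by (intro borel_measurable_divide borel_measurable_diff) auto
    fix z
    have "((\<lambda>t. H (w + t *s h) z) has_field_derivative D z h) (at 0)"
      using D D_scale by (intro entire_line) auto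
    then have "((\<lambda>t. (H (w + t *s h) z - H w z) / t) \<longlongrightarrow> D z h) (at 0)"
      by (simp add: has_field_derivative_iff)
    moreover have "filterlim ?t (at 0) sequentially"
      unfolding filterlim_at using LIMSEQ_Suc[OF lim_1_over_n] by (auto simp del: of_nat_Suc)
    ultimately show "(\<lambda>n. (H (w + ?t n *s h) z - H w z) / ?t n) \<longlonglongrightarrow> D z h"
      by (rule filterlim_compose)
  qed
  have small: "integrable M (\<lambda>z. D z h)" if "norm h \<le> 1" for h
    by (rule Bochner_Integration.integrable_bound[of M "\<lambda>z. G z * norm h"])
       (use G D_meas est(1)[OF _ that] in \<open>auto intro: order_trans[OF _ abs_ge_self]\<close>)
  have int_D: "integrable M (\<lambda>z. D z h)" for h
  proof -
    define t where "t = inverse (norm h + 1)"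
    have t: "t > 0" unfolding t_def by (rule positive_imp_inverse_positive) (use norm_ge_zero[of h] in linarith)
    have "norm (t *\<^sub>R h) \<le> 1"
    proof -
      have "norm (t *\<^sub>R h) = norm h / (norm h + 1)"
        using t by (simp add: t_def inverse_eq_divide)
      also have "\<dots> \<le> 1" by (rule divide_le_eq_1[THEN iffD2]) (use norm_ge_zero[of h] in linarith)
      finally show ?thesis .
    qed
    from small[OF this] have "integrable M (\<lambda>z. t *\<^sub>R D z h)"
      using linear_scale[OF D_lin] by simp
    then have "integrable M (\<lambda>z. inverse t *\<^sub>R (t *\<^sub>R D z h))" by (rule integrable_scaleR_right)
    then show ?thesis using t by simp
  qed
  define L where "L h = (LINT z|M. D z h)" for h
  have L_lin: "linear L"
    unfolding L_def using int_D
    by (intro linearI) (simp_all add: linear_add[OF D_lin] linear_scale[OF D_lin])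
  have L_scale: "L (c *s v) = c * L v" for c v
    unfolding L_def by (simp add: D_scale)
  let ?F = "\<lambda>w. LINT z|M. H w z"
  have quad: "norm (?F (w + h) - ?F w - L h) \<le> 2 * (LINT z|M. G z) * (norm h)\<^sup>2" if h: "norm h \<le> 1" for h
  proof -
    have "?F (w + h) - ?F w - L h = (LINT z|M. H (w + h) z - H w z - D z h)"
      unfolding L_def using int_H[of "w + h"] int_H[of w] int_D h
      by simp
    also have "norm \<dots> \<le> (LINT z|M. norm (H (w + h) z - H w z - D z h))"
      by (rule integral_norm_bound)
    also have "\<dots> \<le> (LINT z|M. 2 * G z * (norm h)\<^sup>2)"
      by (rule integral_mono)
         (use G int_H[of "w + h"] int_H[of w] int_D h est(3) in auto)
    also have "\<dots> = 2 * (LINT z|M. G z) * (norm h)\<^sup>2" by simp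
    finally show ?thesis .
  qed
  have "(?F has_derivative L) (at w)"
    unfolding has_derivative_at
  proof
    show "bounded_linear L" using L_lin by (simp add: linear_conv_bounded_linear)
    show "(\<lambda>h. norm (?F (w + h) - ?F w - L h) / norm h) \<midarrow>0\<rightarrow> 0"
    proof (rule Lim_null_comparison)
      have "\<forall>\<^sub>F h in at 0. norm h < 1"
        by (auto simp: eventually_at dist_norm intro!: exI[of _ 1])
      then show "\<forall>\<^sub>F h in at 0. norm (norm (?F (w + h) - ?F w - L h) / norm h)
          \<le> 2 * (LINT z|M. G z) * norm h"
      proof eventually_elim
        case (elim h)
        then show ?case using quad[of h]
          by (cases "h = 0") (auto simp: divide_simps power2_eq_square mult_ac)
      qed
      show "((\<lambda>h. 2 * (LINT z|M. G z) * norm h) \<longlongrightarrow> 0) (at (0 :: complex^'n))"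
        by (auto intro!: tendsto_eq_intros)
    qed
  qed
  with L_scale show "\<exists>D. (?F has_derivative D) (at w) \<and> (\<forall>c v. D (c *s v) = c * D v)"
    by blast
qed

text \<open>Cauchy's integral formula at the centre, with the contour integral written as an integral over the angle.\<close>

lemma circle_mean_value:
  assumes g: "g holomorphic_on UNIV"
  shows "(LINT \<theta>|lborel. indicator {0..1} \<theta> *\<^sub>R g (exp (2 * of_real pi * \<i> * of_real \<theta>))) = g 0"
proof -
  have cont: "continuous_on A g" for A
    using holomorphic_on_imp_continuous_on[OF g] continuous_on_subset by blast
  let ?g = "\<lambda>\<theta>. g (exp (2 * of_real pi * \<i> * of_real \<theta>))"
  have "((\<lambda>u. g u / (u - 0)) has_contour_integral (2 * of_real pi * \<i> * g 0)) (circlepath 0 1)"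
    using g by (intro Cauchy_integral_circlepath_simple) (auto intro: holomorphic_on_subset)
  then have "((\<lambda>x. 2 * of_real pi * \<i> * ?g x) has_integral (2 * of_real pi * \<i> * g 0)) {0..1}"
    unfolding has_contour_integral
    by (rule has_integral_eq[rotated]) (simp add: vector_derivative_circlepath, simp add: circlepath mult_ac)
  from has_integral_mult_right[OF this, of "inverse (2 * of_real pi * \<i>)"]
  have "(?g has_integral g 0) {0..1}" by (simp add: field_simps)
  then have "integral {0..1} ?g = g 0" by (rule integral_unique)
  moreover have "set_integrable lborel {0..1} ?g"
    by (intro borel_integrable_atLeastAtMost' continuous_on_compose2[OF cont[of UNIV]] continuous_intros) auto
  then have "(LINT \<theta>:{0..1}|lborel. ?g \<theta>) = integral {0..1} ?g"
    by (rule set_borel_integral_eq_integral)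
  ultimately show ?thesis by (simp add: set_lebesgue_integral_def)
qed

lemma orthogonal_unimodular_scale:
  assumes "norm c = 1"
  shows "orthogonal_transformation (\<lambda>v :: complex^'n. c *s v)"
proof -
  have "linear (\<lambda>v :: complex^'n. c *s v)"
    by (auto intro!: linearI simp: vec_eq_iff algebra_simps)
  then show ?thesis using assms by (simp add: orthogonal_transformation norm_scale_vec)
qed

lemma continuous_on_scale:
  assumes "continuous_on A f" "continuous_on A g"
  shows "continuous_on A (\<lambda>x. f x *s (g x :: complex^'n))"
  unfolding vector_scalar_mult_def
  by (intro continuous_on_vec_lambda continuous_intros assms)

text \<open>The integral does not change under \<open>v \<mapsto> e\<^bsup>2\<pi>i\<theta>\<^esup> v\<close>; averaging over \<open>\<theta>\<close> and exchanging the integrals replaces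
  \<open>f(v)\<close> by its mean over a circle in the complex line through \<open>v\<close>, which is \<open>f(0)\<close>.
  Indicators of balls and Gaussians are the two weights of interest.\<close>

lemma mean_value_radial:
  fixes f :: "complex^'n \<Rightarrow> complex" and w :: "complex^'n \<Rightarrow> real"
  assumes f: "entire f" and w [measurable]: "w \<in> borel_measurable borel"
    and rad: "\<And>c v. norm c = 1 \<Longrightarrow> w (c *s v) = w v"
    and int: "integrable lborel (\<lambda>v. f v * of_real (w v))"
  shows "(LINT v|lborel. f v * of_real (w v)) = f 0 * of_real (LINT v|lborel. w v)"
proof -
  define F where "F = (\<lambda>v. f v * of_real (w v))"
  define e where "e = (\<lambda>\<theta>. exp (2 * of_real pi * \<i> * complex_of_real \<theta>))"
  have e: "norm (e \<theta>) = 1" for \<theta> by (simp add: e_def)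
  note entire_measurable[OF f, measurable]
  have F_meas [measurable]: "F \<in> borel_measurable borel" unfolding F_def by measurable
  have rot: "distr lborel borel (\<lambda>v. e \<theta> *s v) = lborel" for \<theta>
    using lborel_distr_orthogonal[OF orthogonal_unimodular_scale[OF e]] .
  have sc_meas [measurable]: "(\<lambda>v. e \<theta> *s v) \<in> borel_measurable borel" for \<theta>
    by (intro borel_measurable_continuous_onI continuous_on_scale continuous_intros)
  have int_rot: "integrable lborel (\<lambda>v. F (e \<theta> *s v))"
    and norm_rot: "(LINT v|lborel. norm (F (e \<theta> *s v))) = (LINT v|lborel. norm (F v))"
    and lint_rot: "(LINT v|lborel. F (e \<theta> *s v)) = (LINT v|lborel. F v)" for \<theta>
    using integrable_distr_eq[of "\<lambda>v. e \<theta> *s v" lborel borel F]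
      integral_distr[of "\<lambda>v. e \<theta> *s v" lborel borel F]
      integral_distr[of "\<lambda>v. e \<theta> *s v" lborel borel "\<lambda>v. norm (F v)"] int
    by (auto simp: rot F_def[symmetric])
  define G where "G = (\<lambda>(\<theta>::real, v). indicator {0..1} \<theta> *\<^sub>R F (e \<theta> *s v))"
  have "(\<lambda>x :: real \<times> (complex^'n). e (fst x) *s snd x) \<in> borel_measurable borel"
    unfolding e_def by (intro borel_measurable_continuous_onI continuous_on_scale continuous_intros)
  then have [measurable]: "(\<lambda>x :: real \<times> (complex^'n). e (fst x) *s snd x) \<in> borel_measurable (borel \<Otimes>\<^sub>M borel)"
    by (simp add: borel_prod)
  have G_meas: "G \<in> borel_measurable (lborel \<Otimes>\<^sub>M lborel)"
    unfolding G_def case_prod_beta by measurable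
  have G_int: "integrable (lborel \<Otimes>\<^sub>M lborel) G"
  proof (rule lborel_pair.Fubini_integrable[OF G_meas])
    have "integrable lborel (\<lambda>\<theta>. indicator {0..1::real} \<theta> *\<^sub>R (LINT v|lborel. norm (F v)))"
      by (intro integrable_scaleR_left) simp
    then show "integrable lborel (\<lambda>\<theta>. LINT v|lborel. norm (G (\<theta>, v)))"
      by (simp add: G_def norm_rot)
    show "AE \<theta> in lborel. integrable lborel (\<lambda>v. G (\<theta>, v))"
      using int_rot by (simp add: G_def)
  qed
  have "(LINT v|lborel. F v) = (LINT \<theta>|lborel. indicator {0..1::real} \<theta> *\<^sub>R (LINT v|lborel. F v))"
    by simp
  also have "\<dots> = (LINT \<theta>|lborel. (LINT v|lborel. G (\<theta>, v)))"
    by (simp add: G_def lint_rot)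
  also have "\<dots> = (LINT v|lborel. (LINT \<theta>|lborel. G (\<theta>, v)))"
    using lborel_pair.Fubini_integral[of "\<lambda>\<theta> v. G (\<theta>, v)"] G_int by simp
  also have "\<dots> = (LINT v|lborel. f 0 * of_real (w v))"
  proof (rule Bochner_Integration.integral_cong[OF refl])
    fix v :: "complex^'n"
    have "(\<lambda>t. f (t *s v)) holomorphic_on UNIV"
      using entire_line_holomorphic[OF f, of 0 v UNIV] by simp
    from circle_mean_value[OF this]
    have "(LINT \<theta>|lborel. indicator {0..1} \<theta> *\<^sub>R f (e \<theta> *s v)) = f 0"
      by (simp add: e_def)
    moreover have "G (\<theta>, v) = (indicator {0..1} \<theta> *\<^sub>R f (e \<theta> *s v)) * of_real (w v)" for \<theta>
      by (simp add: G_def F_def rad e)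
    ultimately show "(LINT \<theta>|lborel. G (\<theta>, v)) = f 0 * of_real (w v)"
      by (simp only: integral_mult_left_zero)
  qed
  also have "\<dots> = f 0 * of_real (LINT v|lborel. w v)"
    by (simp add: integral_complex_of_real)
  finally show ?thesis by (simp add: F_def)
qed

section \<open>The sub-mean value property of powers\<close>

text \<open>Convexity of the power function in the form that includes the boundary point \<open>x = 0\<close>.\<close>

lemma powr_above_tangent:
  fixes a x s :: real
  assumes "0 < a" "0 \<le> x" "1 \<le> s"
  shows "a powr s + s * a powr (s - 1) * (x - a) \<le> x powr s"
proof (cases "x = 0")
  case True
  have "a powr s = a powr (s - 1) * a" using assms by (simp add: powr_diff)
  then have "a powr s + s * a powr (s - 1) * (x - a) = (1 - s) * a powr s"
    using True by (simp add: algebra_simps)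
  also have "\<dots> \<le> 0" using assms by (intro mult_nonpos_nonneg) auto
  finally show ?thesis by (simp add: True)
next
  case False
  have "x powr s - a powr s \<ge> s * a powr (s - 1) * (x - a)"
    using assms False powr_convex[of s]
      has_field_derivative_at_within[OF has_real_derivative_powr[OF assms(1), of s]]
    by (intro convex_on_imp_above_tangent[where A = "{0<..}"]) (auto simp: interior_open)
  then show ?thesis by simp
qed

text \<open>Integrate the tangent inequality at the mean value \<open>a = (\<integral> k \<psi>) / (\<integral> k)\<close>: the linear term vanishes.\<close>

lemma jensen_powr:
  fixes k \<psi> :: "'a \<Rightarrow> real"
  assumes s: "1 \<le> s" and k: "\<And>x. 0 \<le> k x" "integrable M k"
    and \<psi>: "\<And>x. 0 \<le> \<psi> x" "integrable M (\<lambda>x. k x * \<psi> x)" "integrable M (\<lambda>x. k x * \<psi> x powr s)"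
  shows "(LINT x|M. k x * \<psi> x) powr s
    \<le> (LINT x|M. k x) powr (s - 1) * (LINT x|M. k x * \<psi> x powr s)"
proof -
  define K where "K = (LINT x|M. k x)"
  define A where "A = (LINT x|M. k x * \<psi> x)"
  define I where "I = (LINT x|M. k x * \<psi> x powr s)"
  have nn: "0 \<le> K" "0 \<le> A" "0 \<le> I"
    using k \<psi> by (auto simp: K_def A_def I_def)
  show ?thesis
  proof (cases "A = 0")
    case True
    then show ?thesis using nn s by (auto simp: K_def A_def I_def)
  next
    case False
    have "K \<noteq> 0"
    proof
      assume "K = 0"
      then have "AE x in M. k x = 0"
        using integral_nonneg_eq_0_iff_AE[OF k(2)] k(1) by (simp add: K_def)
      then have "AE x in M. k x * \<psi> x = 0" by eventually_elim simp
      then have "A = 0" unfolding A_def by (rule integral_eq_zero_AE)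
      with False show False ..
    qed
    with nn False have KA: "0 < K" "0 < A" by auto
    define a where "a = A / K"
    have a: "0 < a" using KA by (simp add: a_def)
    have "(LINT x|M. k x * (a powr s - s * a powr (s - 1) * a) + s * a powr (s - 1) * (k x * \<psi> x)) \<le> I"
      unfolding I_def
    proof (rule integral_mono)
      show "integrable M (\<lambda>x. k x * (a powr s - s * a powr (s - 1) * a) + s * a powr (s - 1) * (k x * \<psi> x))"
        using k(2) \<psi>(2) by (intro Bochner_Integration.integrable_add integrable_mult_left integrable_mult_right) auto
      fix x
      have "k x * (a powr s + s * a powr (s - 1) * (\<psi> x - a)) \<le> k x * \<psi> x powr s"
        using k(1)[of x] powr_above_tangent[OF a \<psi>(1) s] by (rule mult_left_mono[rotated])
      then show "k x * (a powr s - s * a powr (s - 1) * a) + s * a powr (s - 1) * (k x * \<psi> x) \<le> k x * \<psi> x powr s"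
        by (simp add: algebra_simps)
    qed (use \<psi> in auto)
    also have "(LINT x|M. k x * (a powr s - s * a powr (s - 1) * a) + s * a powr (s - 1) * (k x * \<psi> x))
      = K * (a powr s - s * a powr (s - 1) * a) + s * a powr (s - 1) * A"
      using k(2) \<psi>(2) by (simp add: K_def A_def)
    also have "\<dots> = K * a powr s" using KA by (simp add: a_def algebra_simps)
    finally have "K powr (s - 1) * (K * a powr s) \<le> K powr (s - 1) * I"
      by (rule mult_left_mono) simp
    moreover have "K powr (s - 1) * (K * a powr s) = A powr s"
      using KA by (simp add: a_def powr_divide powr_diff)
    ultimately show ?thesis by (simp add: A_def K_def I_def)
  qed
qed

lemma continuous_integrable_cball:
  fixes h :: "'a::euclidean_space \<Rightarrow> 'b::{banach, second_countable_topology}"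
  assumes "continuous_on UNIV h"
  shows "integrable lborel (\<lambda>v. indicator (cball x r) v *\<^sub>R h v)"
  using borel_integrable_compact[OF compact_cball continuous_on_subset[OF assms]] by simp

lemma sub_mean_norm:
  fixes f :: "complex^'n \<Rightarrow> complex"
  assumes f: "entire f"
  shows "measure lborel (cball (0 :: complex^'n) r) * norm (f x)
    \<le> (LINT v|lborel. indicator (cball x r) v * norm (f v))"
proof -
  have sh: "entire (\<lambda>v. f (x + v))" using f by (rule entire_shift)
  let ?w = "indicator (cball (0 :: complex^'n) r) :: _ \<Rightarrow> real"
  have int: "integrable lborel (\<lambda>v. f (x + v) * of_real (?w v))"
    using continuous_integrable_cball[OF entire_continuous[OF sh], of 0 r]
    by (simp add: scaleR_conv_of_real mult.commute)
  have "(LINT v|lborel. f (x + v) * of_real (?w v)) = f (x + 0) * of_real (LINT v|lborel. ?w v)"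
    by (rule mean_value_radial[OF sh _ _ int]) (auto simp: indicator_def norm_scale_vec)
  moreover have "(LINT v|lborel. ?w v) = measure lborel (cball (0 :: complex^'n) r)"
    by simp
  ultimately have "norm (f x) * measure lborel (cball (0 :: complex^'n) r)
      = norm (LINT v|lborel. f (x + v) * of_real (?w v))"
    by (simp add: norm_mult)
  also have "\<dots> \<le> (LINT v|lborel. norm (f (x + v) * of_real (?w v)))"
    by (rule integral_norm_bound)
  also have "\<dots> = (LINT v|lborel. indicator (cball x r) (x + v) * norm (f (x + v)))"
    by (intro Bochner_Integration.integral_cong) (auto simp: norm_mult indicator_def dist_norm)
  also have "\<dots> = (LINT v|distr lborel borel ((+) x). indicator (cball x r) v * norm (f v))"
    by (intro integral_distr[symmetric] borel_measurable_times borel_measurable_indicator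
        measurable_compose[OF entire_measurable[OF f] borel_measurable_norm]) auto
  also have "\<dots> = (LINT v|lborel. indicator (cball x r) v * norm (f v))"
    by (simp add: lborel_distr_plus)
  finally show ?thesis by (simp add: mult.commute)
qed

lemma continuous_indicator_integrable:
  fixes h :: "complex^'n \<Rightarrow> real"
  assumes "continuous_on UNIV h"
  shows "integrable lborel (\<lambda>v. indicator (cball x r) v * h v)"
  using continuous_integrable_cball[OF assms, of x r] by simp

text \<open>For exponents below \<open>1\<close> convexity points in the wrong direction. Instead, maximise
  \<open>|f(y)| (1 - |y - x|)\<^sup>N\<close> over the unit ball around \<open>x\<close>. Near the maximiser \<open>y\<close>, on the ball whose radius \<open>r\<close> is half
  the distance of \<open>y\<close> to the boundary, \<open>|f|\<close> is bounded by \<open>r\<^bsup>-N\<^esup>\<close> times the maximum \<open>A\<close>, so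
  \<open>|f| \<le> (A r\<^bsup>-N\<^esup>)\<^bsup>1-p\<^esup> |f|\<^sup>p\<close> may be inserted into the mean value inequality at \<open>y\<close>. With \<open>N = d/p\<close>,
  \<open>d\<close> the real dimension, all powers of \<open>r\<close> cancel and \<open>A\<^sup>p\<close> is bounded by the integral.\<close>

lemma sub_mean_powr_small:
  fixes f :: "complex^'n \<Rightarrow> complex"
  assumes f: "entire f" and p: "0 < p" "p < 1"
  shows "measure lborel (cball (0 :: complex^'n) 1) * norm (f x) powr p
    \<le> 2 powr (real DIM(complex^'n) / p) * (LINT v|lborel. indicator (cball x 1) v * norm (f v) powr p)"
proof -
  define d where "d = real DIM(complex^'n)"
  define V where "V = measure lborel (cball (0 :: complex^'n) 1)"
  \<comment> \<open>The exponent for which the powers of \<open>r\<close> below cancel.\<close>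
  define N where "N = d / p"
  define I where "I = (LINT v|lborel. indicator (cball x 1) v * norm (f v) powr p)"
  have d: "0 < d" by (simp add: d_def)
  have N: "0 < N" "N * p = d" using d p by (simp_all add: N_def)
  have cont: "continuous_on A f" for A
    using entire_continuous[OF f] continuous_on_subset by blast
  have contp: "continuous_on UNIV (\<lambda>v. norm (f v) powr p)"
    using p by (intro continuous_on_powr' continuous_intros cont) auto
  have "I \<ge> 0" unfolding I_def by (rule Bochner_Integration.integral_nonneg) simp
  define h where "h y = norm (f y) * (1 - norm (y - x)) powr N" for y
  have "\<exists>y\<in>cball x 1. \<forall>y'\<in>cball x 1. h y' \<le> h y"
    unfolding h_def using N
    by (intro continuous_attains_sup continuous_intros continuous_on_powr' cont)
       (auto simp: dist_norm norm_minus_commute)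
  then obtain y where y: "norm (y - x) \<le> 1" and max: "\<And>z. norm (z - x) \<le> 1 \<Longrightarrow> h z \<le> h y"
    by (metis dist_commute dist_norm mem_cball)
  define A where "A = h y"
  have fx: "norm (f x) \<le> A" using max[of x] by (simp add: h_def A_def)
  have "V * A powr p \<le> 2 powr N * I"
  proof (cases "A = 0")
    case True then show ?thesis using \<open>I \<ge> 0\<close> by simp
  next
    case False
    with fx have A: "0 < A" using norm_ge_zero[of "f x"] by linarith
    have y1: "norm (y - x) < 1"
      using False y by (cases "norm (y - x) = 1") (auto simp: A_def h_def)
    define r where "r = (1 - norm (y - x)) / 2"
    have r: "0 < r" using y1 by (simp add: r_def)
    have fz: "norm (f z) \<le> A * r powr (- N)" and zx: "norm (z - x) \<le> 1" if "z \<in> cball y r" for z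
    proof -
      have "norm (z - x) \<le> norm (z - y) + norm (y - x)"
        using norm_triangle_ineq[of "z - y" "y - x"] by simp
      also have "\<dots> \<le> 1 - r" using that by (simp add: r_def dist_norm norm_minus_commute field_simps)
      finally have z: "norm (z - x) \<le> 1 - r" .
      then show "norm (z - x) \<le> 1" using r by simp
      have "norm (f z) * r powr N \<le> h z"
        unfolding h_def using z r N by (intro mult_left_mono powr_mono2) auto
      also have "\<dots> \<le> A" unfolding A_def using z r by (intro max) simp
      finally show "norm (f z) \<le> A * r powr (- N)" using r by (simp add: powr_minus field_simps)
    qed
    have "V * r powr d * norm (f y) = measure lborel (cball (0 :: complex^'n) r) * norm (f y)"
    proof -
      have "r powr d = r ^ DIM(complex^'n)" unfolding d_def using r by (rule powr_realpow)
      then show ?thesis using r by (simp add: V_def content_cball)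
    qed
    also have "\<dots> \<le> (LINT v|lborel. indicator (cball y r) v * norm (f v))"
      by (rule sub_mean_norm[OF f])
    also have "\<dots> \<le> (LINT v|lborel. (A * r powr (- N)) powr (1 - p) * (indicator (cball x 1) v * norm (f v) powr p))"
    proof (rule integral_mono)
      show "integrable lborel (\<lambda>v. indicator (cball y r) v * norm (f v))"
        by (intro continuous_indicator_integrable continuous_intros cont)
      show "integrable lborel (\<lambda>v. (A * r powr (- N)) powr (1 - p) * (indicator (cball x 1) v * norm (f v) powr p))"
        by (intro integrable_mult_right continuous_indicator_integrable contp)
      fix v
      show "indicator (cball y r) v * norm (f v)
          \<le> (A * r powr (- N)) powr (1 - p) * (indicator (cball x 1) v * norm (f v) powr p)"
      proof (cases "v \<in> cball y r")
        case True
        have "norm (f v) = norm (f v) powr (1 - p) * norm (f v) powr p"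
          by (simp flip: powr_add)
        also have "\<dots> \<le> (A * r powr (- N)) powr (1 - p) * norm (f v) powr p"
          using fz[OF True] p by (intro mult_right_mono powr_mono2) auto
        finally show ?thesis using True zx[OF True] by (simp add: dist_norm norm_minus_commute)
      qed simp
    qed
    also have "\<dots> = (A * r powr (- N)) powr (1 - p) * I" by (simp add: I_def)
    finally have *: "V * r powr d * norm (f y) \<le> A powr (1 - p) * r powr (- N * (1 - p)) * I"
      using A r by (simp add: powr_mult powr_powr)
    have "2 * r = 1 - norm (y - x)" by (simp add: r_def)
    then have "A = norm (f y) * (2 * r) powr N" by (simp only: A_def h_def)
    then have fy: "norm (f y) = A * 2 powr (- N) * r powr (- N)"
      using r by (simp add: powr_mult powr_minus field_simps)
    have "V * A powr p = (V * r powr d * norm (f y)) * (A powr (p - 1) * 2 powr N * r powr (N * (1 - p)))"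
      unfolding fy using A r N by (simp add: powr_diff powr_minus field_simps flip: powr_add)
    also have "\<dots> \<le> (A powr (1 - p) * r powr (- N * (1 - p)) * I) * (A powr (p - 1) * 2 powr N * r powr (N * (1 - p)))"
      using * by (rule mult_right_mono) simp
    also have "\<dots> = (A powr (1 - p) * A powr (p - 1)) * (r powr (- N * (1 - p)) * r powr (N * (1 - p))) * 2 powr N * I"
      by (simp only: mult_ac)
    also have "\<dots> = 2 powr N * I"
      using A r by (simp flip: powr_add)
    finally show ?thesis .
  qed
  moreover have "V * norm (f x) powr p \<le> V * A powr p"
    using fx p by (intro mult_left_mono powr_mono2) (auto simp: V_def)
  ultimately have "V * norm (f x) powr p \<le> 2 powr N * I" by linarith
  then show ?thesis by (simp only: V_def I_def N_def d_def)
qed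

text \<open>For \<open>p \<ge> 1\<close> this is the mean value inequality for \<open>|f|\<close> followed by Jensen's inequality on the ball.\<close>

lemma sub_mean_powr:
  assumes p: "0 < p"
  obtains C where "0 < C" "\<And>(f :: complex^'n \<Rightarrow> complex) x. entire f \<Longrightarrow>
    norm (f x) powr p \<le> C * (LINT v|lborel. indicator (cball x 1) v * norm (f v) powr p)"
proof -
  define V where "V = measure lborel (cball (0 :: complex^'n) 1)"
  have V: "0 < V" by (simp add: V_def)
  show ?thesis
  proof (cases "p < 1")
    case True
    show ?thesis
      by (rule that[of "2 powr (real DIM(complex^'n) / p) / V"])
         (use V sub_mean_powr_small[OF _ p True] in \<open>auto simp: V_def field_simps\<close>)
  next
    case False
    have "norm (f x) powr p \<le> 1 / V * (LINT v|lborel. indicator (cball x 1) v * norm (f v) powr p)"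
      if f: "entire f" for f :: "complex^'n \<Rightarrow> complex" and x
    proof -
      let ?k = "indicator (cball x 1) :: _ \<Rightarrow> real"
      have cont: "continuous_on UNIV f" using f by (rule entire_continuous)
      have contp: "continuous_on UNIV (\<lambda>v. norm (f v) powr p)"
        using p by (intro continuous_on_powr' continuous_intros cont) auto
      have "V powr p * norm (f x) powr p = (V * norm (f x)) powr p"
        using V by (simp add: powr_mult)
      also have "\<dots> \<le> (LINT v|lborel. ?k v * norm (f v)) powr p"
        using sub_mean_norm[OF f, of 1 x] p V by (intro powr_mono2) (auto simp: V_def)
      also have "\<dots> \<le> (LINT v|lborel. ?k v) powr (p - 1) * (LINT v|lborel. ?k v * norm (f v) powr p)"
        using False continuous_indicator_integrable[of "\<lambda>_. 1" x 1]
        by (intro jensen_powr continuous_indicator_integrable contp continuous_intros cont) auto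
      also have "(LINT v|lborel. ?k v) = V"
        by (simp add: V_def content_cball)
      finally show ?thesis using V by (simp add: powr_diff field_simps)
    qed
    then show ?thesis using V by (intro that[of "1 / V"]) auto
  qed
qed

section \<open>Weighted point evaluations and the reproducing formula\<close>

definition wabs :: "real \<Rightarrow> (complex^'n \<Rightarrow> complex) \<Rightarrow> complex^'n \<Rightarrow> real" where
  "wabs \<alpha> f z = norm (f z) * exp (- (\<alpha> / 2) * (norm z)\<^sup>2)"

lemma wabs_nonneg [simp]: "0 \<le> wabs \<alpha> f z"
  by (simp add: wabs_def)

lemma norm_weighted: "norm (f z * of_real (exp (- (\<alpha> / 2) * (norm z)\<^sup>2))) = wabs \<alpha> f z"
  by (simp add: wabs_def norm_mult)

lemma norm_le_wabs: "wabs \<alpha> f z \<le> b \<Longrightarrow> norm (f z) \<le> b * exp (\<alpha> / 2 * (norm z)\<^sup>2)"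
  by (simp add: wabs_def exp_minus field_simps)

lemma norm_eq_wabs: "norm (f z) = wabs \<alpha> f z * exp (\<alpha> / 2 * (norm z)\<^sup>2)"
  by (simp add: wabs_def flip: exp_add)

lemma continuous_wabs:
  assumes "entire f" shows "continuous_on A (wabs \<alpha> f)"
proof -
  have "continuous_on A f" using entire_continuous[OF assms] continuous_on_subset by blast
  then show ?thesis unfolding wabs_def by (intro continuous_intros)
qed

lemma continuous_wabs_powr:
  assumes "entire f" "0 < p" shows "continuous_on A (\<lambda>z. wabs \<alpha> f z powr p)"
  using assms by (intro continuous_on_powr' continuous_wabs continuous_intros) auto

lemma wabs_measurable: "entire f \<Longrightarrow> wabs \<alpha> f \<in> borel_measurable borel"
  by (intro borel_measurable_continuous_onI continuous_wabs)

lemma Re_hprod: "Re (hprod v u) = ((norm v)\<^sup>2 + (norm u)\<^sup>2 - (norm (v - u))\<^sup>2) / 2"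
proof -
  have "Re (hprod u v) = Re (hprod v u)" using cnj_hprod[of v u] by (metis cnj.simps(1))
  moreover have "(norm (v - u))\<^sup>2 = (norm v)\<^sup>2 - Re (hprod v u) - Re (hprod u v) + (norm u)\<^sup>2"
    using arg_cong[OF norm_diff_hprod[of v u], of Re] by (simp del: of_real_power)
  ultimately show ?thesis by simp
qed

lemma norm_norm_kernel:
  "norm (norm_kernel \<alpha> z u) = exp (\<alpha> / 2 * (norm u)\<^sup>2 - \<alpha> / 2 * (norm (u - z))\<^sup>2)"
  by (simp add: norm_kernel_def Re_hprod norm_exp_eq_Re del: of_real_mult of_real_power of_real_divide)
     (simp add: field_simps)

lemma norm_rep_kernel:
  "norm (rep_kernel \<alpha> z u) = exp (\<alpha> / 2 * (norm u)\<^sup>2 + \<alpha> / 2 * (norm z)\<^sup>2 - \<alpha> / 2 * (norm (u - z))\<^sup>2)"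
  by (simp add: rep_kernel_def Re_hprod norm_exp_eq_Re) (simp add: field_simps)

lemma rep_kernel_eq: "rep_kernel \<alpha> z = (\<lambda>w. of_real (exp (\<alpha> / 2 * (norm z)\<^sup>2)) * norm_kernel \<alpha> z w)"
  by (simp add: rep_kernel_def norm_kernel_def flip: exp_of_real exp_add)

lemma cnj_rep_kernel: "cnj (rep_kernel \<alpha> w z) = rep_kernel \<alpha> z w"
  by (simp add: rep_kernel_def exp_cnj cnj_hprod)

text \<open>The weight is locally the modulus of an entire function: \<open>f(v) exp(-\<beta>\<langle>v,u\<rangle>)\<close> has modulus
  \<open>wabs \<beta> f v\<close> up to the factor \<open>exp(-\<beta>|u|\<^sup>2/2)\<close>, independent of \<open>v\<close>, and the factor
  \<open>exp(\<beta>|v - u|\<^sup>2/2)\<close>, which lies between \<open>1\<close> and \<open>exp(\<beta>/2)\<close> on the unit ball around \<open>u\<close>.\<close>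

lemma weighted_sub_mean:
  assumes p: "0 < p" and \<beta>: "0 \<le> \<beta>"
  obtains C where "0 < C" "\<And>(f :: complex^'n \<Rightarrow> complex) u. entire f \<Longrightarrow>
    wabs \<beta> f u powr p \<le> C * (LINT v|lborel. indicator (cball u 1) v * wabs \<beta> f v powr p)"
proof -
  obtain C where C: "0 < C" "\<And>(f :: complex^'n \<Rightarrow> complex) x. entire f \<Longrightarrow>
    norm (f x) powr p \<le> C * (LINT v|lborel. indicator (cball x 1) v * norm (f v) powr p)"
    using sub_mean_powr[OF p] by blast
  have "wabs \<beta> f u powr p \<le> (C * exp (\<beta> / 2) powr p) * (LINT v|lborel. indicator (cball u 1) v * wabs \<beta> f v powr p)"
    if f: "entire f" for f :: "complex^'n \<Rightarrow> complex" and u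
  proof -
    define g where "g v = f v * exp (of_real (- \<beta>) * hprod v u)" for v
    have g: "entire g" unfolding g_def
      by (intro entire_mult f entire_exp entire_const entire_hprod)
    let ?E = "exp (- (\<beta> / 2) * (norm u)\<^sup>2)"
    have ng: "norm (g v) = wabs \<beta> f v * ?E * exp (\<beta> / 2 * (norm (v - u))\<^sup>2)" for v
      unfolding g_def wabs_def
      by (simp add: norm_mult norm_exp_eq_Re Re_hprod mult.assoc flip: exp_add)
         (simp add: field_simps)
    have "(wabs \<beta> f u * ?E) powr p = norm (g u) powr p" by (simp add: ng)
    also have "\<dots> \<le> C * (LINT v|lborel. indicator (cball u 1) v * norm (g v) powr p)"
      by (rule C(2)[OF g])
    also have "\<dots> \<le> C * (LINT v|lborel. (?E * exp (\<beta> / 2)) powr p * (indicator (cball u 1) v * wabs \<beta> f v powr p))"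
    proof (intro mult_left_mono integral_mono)
      show "integrable lborel (\<lambda>v. indicator (cball u 1) v * norm (g v) powr p)"
        using p g by (intro continuous_indicator_integrable continuous_on_powr' continuous_intros entire_continuous) auto
      show "integrable lborel (\<lambda>v. (?E * exp (\<beta> / 2)) powr p * (indicator (cball u 1) v * wabs \<beta> f v powr p))"
        using p f by (intro integrable_mult_right continuous_indicator_integrable continuous_wabs_powr)
      fix v
      show "indicator (cball u 1) v * norm (g v) powr p
          \<le> (?E * exp (\<beta> / 2)) powr p * (indicator (cball u 1) v * wabs \<beta> f v powr p)"
      proof (cases "v \<in> cball u 1")
        case True
        then have "norm (v - u) \<le> 1" by (simp add: dist_norm norm_minus_commute)
        then have "(norm (v - u))\<^sup>2 \<le> 1" by (simp add: power_le_one)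
        then have "exp (\<beta> / 2 * (norm (v - u))\<^sup>2) \<le> exp (\<beta> / 2)"
          using \<beta> by (simp add: mult_left_le)
        then have "norm (g v) \<le> wabs \<beta> f v * ?E * exp (\<beta> / 2)"
          unfolding ng by (intro mult_left_mono) auto
        then have "norm (g v) powr p \<le> (wabs \<beta> f v * ?E * exp (\<beta> / 2)) powr p"
          using p by (intro powr_mono2) auto
        then show ?thesis using True by (simp add: powr_mult mult_ac)
      qed simp
    qed (use C in auto)
    also have "\<dots> = ?E powr p * (C * exp (\<beta> / 2) powr p * (LINT v|lborel. indicator (cball u 1) v * wabs \<beta> f v powr p))"
      by (simp only: integral_mult_right_zero) (simp add: powr_mult mult_ac)
    finally have "?E powr p * wabs \<beta> f u powr p \<le> ?E powr p * (C * exp (\<beta> / 2) powr p * (LINT v|lborel. indicator (cball u 1) v * wabs \<beta> f v powr p))"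
      by (simp add: powr_mult mult_ac)
    then show ?thesis by (rule mult_left_le_imp_le) simp
  qed
  then show ?thesis using C(1) by (intro that[of "C * exp (\<beta> / 2) powr p"]) auto
qed

lemma weighted_point_evaluation:
  assumes p: "0 < p" and \<beta>: "0 \<le> \<beta>"
  obtains C where "0 < C" "\<And>(f :: complex^'n \<Rightarrow> complex) u. entire f \<Longrightarrow>
    ennreal (wabs \<beta> f u powr p) \<le> ennreal C * (\<integral>\<^sup>+v. ennreal (wabs \<beta> f v powr p) \<partial>lborel)"
proof -
  obtain C where C: "0 < C" "\<And>(f :: complex^'n \<Rightarrow> complex) u. entire f \<Longrightarrow>
    wabs \<beta> f u powr p \<le> C * (LINT v|lborel. indicator (cball u 1) v * wabs \<beta> f v powr p)"
    using weighted_sub_mean[OF assms] by blast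
  have "ennreal (wabs \<beta> f u powr p) \<le> ennreal C * (\<integral>\<^sup>+v. ennreal (wabs \<beta> f v powr p) \<partial>lborel)"
    if f: "entire f" for f :: "complex^'n \<Rightarrow> complex" and u
  proof -
    have "ennreal (wabs \<beta> f u powr p) \<le> ennreal (C * (LINT v|lborel. indicator (cball u 1) v * wabs \<beta> f v powr p))"
      using C(2)[OF f] by (rule ennreal_leI)
    also have "\<dots> = ennreal C * (\<integral>\<^sup>+v. ennreal (indicator (cball u 1) v * wabs \<beta> f v powr p) \<partial>lborel)"
      using C(1) f p
      by (subst nn_integral_eq_integral)
         (auto intro!: continuous_indicator_integrable continuous_wabs_powr Bochner_Integration.integral_nonneg simp: ennreal_mult)
    also have "\<dots> \<le> ennreal C * (\<integral>\<^sup>+v. ennreal (wabs \<beta> f v powr p) \<partial>lborel)"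
      by (intro mult_left_mono nn_integral_mono ennreal_leI) (auto simp: indicator_def)
    finally show ?thesis .
  qed
  then show ?thesis using C(1) that by blast
qed

lemma wabs_integrable_bound:
  assumes p: "0 < p" and \<beta>: "0 \<le> \<beta>"
  obtains C where "0 < C" "\<And>(f :: complex^'n \<Rightarrow> complex) u. entire f \<Longrightarrow>
    integrable lborel (\<lambda>v. wabs \<beta> f v powr p) \<Longrightarrow>
    wabs \<beta> f u \<le> C * (LINT v|lborel. wabs \<beta> f v powr p) powr (1 / p)"
proof -
  obtain C where C: "0 < C" "\<And>(f :: complex^'n \<Rightarrow> complex) u. entire f \<Longrightarrow>
    ennreal (wabs \<beta> f u powr p) \<le> ennreal C * (\<integral>\<^sup>+v. ennreal (wabs \<beta> f v powr p) \<partial>lborel)"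
    using weighted_point_evaluation[OF assms] by blast
  have "wabs \<beta> f u \<le> C powr (1 / p) * (LINT v|lborel. wabs \<beta> f v powr p) powr (1 / p)"
    if f: "entire f" and int: "integrable lborel (\<lambda>v. wabs \<beta> f v powr p)"
    for f :: "complex^'n \<Rightarrow> complex" and u
  proof -
    have nn: "0 \<le> (LINT v|lborel. wabs \<beta> f v powr p)" by (rule Bochner_Integration.integral_nonneg) simp
    have "wabs \<beta> f u powr p \<le> C * (LINT v|lborel. wabs \<beta> f v powr p)"
      using C(1) C(2)[OF f, of u] nn by (simp add: nn_integral_eq_integral[OF int] flip: ennreal_mult)
    then have "(wabs \<beta> f u powr p) powr (1 / p) \<le> (C * (LINT v|lborel. wabs \<beta> f v powr p)) powr (1 / p)"
      using p by (intro powr_mono2) auto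
    then show ?thesis using p C(1) nn by (simp add: powr_powr powr_mult)
  qed
  then show ?thesis using C(1) by (intro that[of "C powr (1 / p)"]) auto
qed

text \<open>Comparison with a sum over the balls of radius \<open>k + 1\<close>, whose volumes grow only polynomially in \<open>k\<close>.\<close>

lemma integrable_gaussian:
  fixes c :: real assumes "0 < c"
  shows "integrable lborel (\<lambda>x :: 'a::euclidean_space. exp (- c * (norm x)\<^sup>2))"
proof (rule integrableI_bounded)
  define e where "e = (\<lambda>k :: nat. exp (- c * (real k)\<^sup>2))"
  define q where "q = (\<lambda>k :: nat. (real k + 1) ^ DIM('a) * unit_ball_vol (real DIM('a)))"
  define B where "B = (\<lambda>k :: nat. cball (0::'a) (real k + 1))"
  have B [measurable]: "B k \<in> sets lborel" for k by (simp add: B_def)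
  have e: "0 \<le> e k" and q: "0 \<le> q k" for k by (simp_all add: e_def q_def)
  have V: "emeasure lborel (B k) = ennreal (q k)" for k
    by (simp add: emeasure_cball q_def B_def mult.commute)
  define f where "f = (\<lambda>k x. ennreal (e k) * indicator (B k) x)"
  have [measurable]: "f k \<in> borel_measurable lborel" for k
    unfolding f_def by measurable
  have le: "ennreal (norm (exp (- c * (norm x)\<^sup>2))) \<le> (\<Sum>k. f k x)" for x :: 'a
  proof -
    define k where "k = nat \<lfloor>norm x\<rfloor>"
    have k: "real k \<le> norm x" "norm x \<le> real k + 1"
      unfolding k_def using norm_ge_zero[of x] by linarith+
    have "exp (- c * (norm x)\<^sup>2) \<le> e k"
      using k assms by (simp add: e_def)
    moreover have "x \<in> B k" using k by (simp add: B_def)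
    ultimately have "ennreal (norm (exp (- c * (norm x)\<^sup>2))) \<le> f k x"
      unfolding f_def by (simp add: ennreal_leI)
    also have "f k x = (\<Sum>i\<in>{k}. f i x)" by simp
    also have "\<dots> \<le> (\<Sum>i. f i x)" by (rule sum_le_suminf) auto
    finally show ?thesis .
  qed
  have "(\<integral>\<^sup>+x. ennreal (norm (exp (- c * (norm x)\<^sup>2))) \<partial>(lborel :: 'a measure))
    \<le> (\<integral>\<^sup>+x. (\<Sum>k. f k x) \<partial>lborel)"
    using le by (intro nn_integral_mono) auto
  also have "\<dots> = (\<Sum>k. (\<integral>\<^sup>+x. f k x \<partial>lborel))"
    by (rule nn_integral_suminf) measurable
  also have "\<dots> = (\<Sum>k. ennreal (e k * q k))"
    unfolding f_def by (subst nn_integral_cmult_indicator[OF B]) (simp_all add: V ennreal_mult e q)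
  also have "\<dots> < \<infinity>"
  proof -
    have "(\<lambda>k. exp (- c * (real k)\<^sup>2) * ((real k + 1) powr d)) \<in> O(\<lambda>k. 1 / real k ^ 2)" for d
      using assms by real_asymp
    from this[of "real DIM('a)"]
    have "(\<lambda>k. exp (- c * (real k)\<^sup>2) * ((real k + 1) powr real DIM('a))) \<in> O(\<lambda>k. 1 / real k ^ 2)" .
    moreover have "(real k + 1) powr real DIM('a) = (real k + 1) ^ DIM('a)" for k :: nat
      by (rule powr_realpow) (simp add: add_nonneg_pos)
    ultimately have "(\<lambda>k. e k * ((real k + 1) ^ DIM('a))) \<in> O(\<lambda>k. 1 / real k ^ 2)"
      by (simp add: e_def)
    moreover have "summable (\<lambda>k. norm (1 / real k ^ 2))"
      using inverse_power_summable[of 2, where 'a = real] by (simp add: inverse_eq_divide)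
    ultimately have "summable (\<lambda>k. e k * ((real k + 1) ^ DIM('a)))"
      by (rule summable_comparison_test_bigo[rotated])
    from summable_mult2[OF this, of "unit_ball_vol (real DIM('a))"]
    have "summable (\<lambda>k. e k * q k)"
      by (simp only: q_def mult.assoc)
    moreover have "0 \<le> e k * q k" for k using e q by simp
    ultimately have "(\<Sum>k. ennreal (e k * q k)) = ennreal (\<Sum>k. e k * q k)"
      by (intro suminf_ennreal2)
    then show ?thesis by (simp only: infinity_ennreal_def ennreal_less_top)
  qed
  finally show "(\<integral>\<^sup>+x. ennreal (norm (exp (- c * (norm x)\<^sup>2))) \<partial>(lborel :: 'a measure)) < \<infinity>" .
qed measurable

text \<open>The type argument carries the dimension of the space over which the Gaussian is integrated.\<close>

definition gauss :: "real \<Rightarrow> 'n::finite itself \<Rightarrow> real" where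
  "gauss \<alpha> _ = (LINT z|lborel. exp (- \<alpha> * (norm (z :: complex^'n))\<^sup>2))"

lemma gauss_pos: assumes "0 < \<alpha>" shows "0 < gauss \<alpha> TYPE('n::finite)"
proof -
  have "gauss \<alpha> TYPE('n) \<noteq> 0"
  proof
    assume "gauss \<alpha> TYPE('n) = 0"
    then have "AE z in lborel. exp (- \<alpha> * (norm (z :: complex^'n))\<^sup>2) = 0"
      using integral_nonneg_eq_0_iff_AE[OF integrable_gaussian[OF assms, where 'a = "complex^'n"]]
      by (simp add: gauss_def)
    then have "AE z in (lborel :: (complex^'n) measure). False" by simp
    then show False by (simp add: AE_iff_measurable[of UNIV])
  qed
  moreover have "0 \<le> gauss \<alpha> TYPE('n)"
    unfolding gauss_def by (rule Bochner_Integration.integral_nonneg) simp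
  ultimately show ?thesis by simp
qed

lemma fock_inftyE:
  assumes "f \<in> fock_infty \<alpha>"
  obtains B where "entire f" "\<And>z. wabs \<alpha> f z \<le> B"
  using assms unfolding fock_infty_def wabs_def bdd_above_def by auto

text \<open>The Weyl operator moves \<open>w\<close> to the origin: pairing \<open>f\<close> with \<open>k\<^sub>w = U\<^sub>w 1\<close> is pairing \<open>U\<^sub>w f\<close> with
  \<open>1\<close>, and the latter is a Gaussian mean value.\<close>

lemma fock_inner_norm_kernel:
  fixes f :: "complex^'n \<Rightarrow> complex"
  assumes \<alpha>: "0 < \<alpha>" and f: "f \<in> fock_infty \<alpha>"
  shows "fock_inner \<alpha> f (norm_kernel \<alpha> w)
    = of_real ((\<alpha> / pi) ^ CARD('n) * gauss \<alpha> TYPE('n) * exp (- (\<alpha> / 2) * (norm w)\<^sup>2)) * f w"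
proof -
  obtain B where B: "entire f" "\<And>z. wabs \<alpha> f z \<le> B"
    using fock_inftyE[OF f] by blast
  define g where "g = weyl \<alpha> w f"
  have g_eq: "g = (\<lambda>u. f (w - u) * norm_kernel \<alpha> w u)" by (simp add: g_def weyl_def fun_eq_iff)
  have g: "entire g" unfolding g_eq by (intro entire_mult entire_reflect B entire_norm_kernel)
  have bound: "norm (g u * of_real (exp (- \<alpha> * (norm u)\<^sup>2))) \<le> B * exp (- (\<alpha> / 2) * (norm u)\<^sup>2)" for u
  proof -
    have "norm (g u * of_real (exp (- \<alpha> * (norm u)\<^sup>2)))
      = norm (f (w - u)) * norm (norm_kernel \<alpha> w u) * exp (- \<alpha> * (norm u)\<^sup>2)"
      by (simp add: g_eq norm_mult)
    also have "\<dots> = wabs \<alpha> f (w - u) * exp (- (\<alpha> / 2) * (norm u)\<^sup>2)"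
      unfolding wabs_def norm_norm_kernel norm_minus_commute[of u w]
      by (simp add: mult.assoc field_simps flip: exp_add)
    also have "\<dots> \<le> B * exp (- (\<alpha> / 2) * (norm u)\<^sup>2)"
      using B(2) by (intro mult_right_mono) auto
    finally show ?thesis .
  qed
  have "integrable lborel (\<lambda>u. g u * of_real (exp (- \<alpha> * (norm u)\<^sup>2)))"
  proof (rule Bochner_Integration.integrable_bound)
    show "integrable lborel (\<lambda>u :: complex^'n. B * exp (- (\<alpha> / 2) * (norm u)\<^sup>2))"
      using \<alpha> by (intro integrable_mult_right integrable_gaussian) auto
    show "(\<lambda>u. g u * of_real (exp (- \<alpha> * (norm u)\<^sup>2))) \<in> borel_measurable lborel"
      using entire_measurable[OF g] by simp
  qed (use bound in \<open>auto intro: order_trans[OF _ abs_ge_self]\<close>)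
  from mean_value_radial[OF g _ _ this]
  have mv: "(LINT u|lborel. g u * of_real (exp (- \<alpha> * (norm u)\<^sup>2))) = g 0 * of_real (gauss \<alpha> TYPE('n))"
    by (simp add: norm_scale_vec gauss_def)
  have "fock_inner \<alpha> f (norm_kernel \<alpha> w) = fock_inner \<alpha> g (\<lambda>_. 1)"
    unfolding g_def by (simp add: weyl_self_adjoint weyl_one)
  also have "\<dots> = of_real ((\<alpha> / pi) ^ CARD('n)) * (g 0 * of_real (gauss \<alpha> TYPE('n)))"
    by (simp only: fock_inner_def complex_cnj_one mult_1_right mv)
  also have "g 0 = f w * of_real (exp (- (\<alpha> / 2) * (norm w)\<^sup>2))"
    by (simp add: g_eq norm_kernel_def hprod_def flip: exp_of_real)
  finally show ?thesis by (simp add: mult_ac)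
qed

lemma reproducing_formula:
  fixes f :: "complex^'n \<Rightarrow> complex"
  assumes \<alpha>: "0 < \<alpha>" and f: "f \<in> fock_infty \<alpha>"
  shows "(LINT z|lborel. f z * rep_kernel \<alpha> z w * of_real (exp (- \<alpha> * (norm z)\<^sup>2)))
    = of_real (gauss \<alpha> TYPE('n)) * f w"
proof -
  let ?c = "of_real ((\<alpha> / pi) ^ CARD('n)) :: complex"
  let ?e = "of_real (exp (\<alpha> / 2 * (norm w)\<^sup>2)) :: complex"
  have "?c \<noteq> 0" using \<alpha> by simp
  have "?c * (LINT z|lborel. f z * rep_kernel \<alpha> z w * of_real (exp (- \<alpha> * (norm z)\<^sup>2)))
    = ?c * (LINT z|lborel. ?e * (f z * cnj (norm_kernel \<alpha> w z) * of_real (exp (- \<alpha> * (norm z)\<^sup>2))))"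
    by (subst cnj_rep_kernel[symmetric]) (simp add: rep_kernel_eq mult_ac)
  also have "\<dots> = ?e * fock_inner \<alpha> f (norm_kernel \<alpha> w)"
    by (subst integral_mult_right_zero) (simp only: fock_inner_def mult_ac)
  also have "\<dots> = ?c * (of_real (gauss \<alpha> TYPE('n)) * f w) * (of_real (exp (\<alpha> / 2 * (norm w)\<^sup>2) * exp (- (\<alpha> / 2) * (norm w)\<^sup>2)))"
    unfolding fock_inner_norm_kernel[OF assms] by (simp add: mult_ac)
  also have "exp (\<alpha> / 2 * (norm w)\<^sup>2) * exp (- (\<alpha> / 2) * (norm w)\<^sup>2) = 1"
    by (simp flip: exp_add)
  finally show ?thesis using \<open>?c \<noteq> 0\<close> by simp
qed

section \<open>Integral operators with Gaussian off-diagonal decay\<close>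

lemma gaussian_translate:
  fixes w :: "complex^'n" assumes "0 < c"
  shows "integrable lborel (\<lambda>z. exp (- c * (norm (w - z))\<^sup>2))"
    and "(LINT z|lborel. exp (- c * (norm (w - z))\<^sup>2)) = gauss c TYPE('n)"
    and "(\<integral>\<^sup>+z. ennreal (exp (- c * (norm (w - z))\<^sup>2)) \<partial>lborel) = ennreal (gauss c TYPE('n))"
    and "(\<integral>\<^sup>+z. ennreal (exp (- c * (norm (z - w))\<^sup>2)) \<partial>lborel) = ennreal (gauss c TYPE('n))"
proof -
  let ?g = "\<lambda>z :: complex^'n. exp (- c * (norm z)\<^sup>2)"
  have g: "integrable lborel ?g" using assms by (rule integrable_gaussian)
  have "(\<integral>\<^sup>+z. ennreal (?g (w - z)) \<partial>lborel) = (\<integral>\<^sup>+z. ennreal (?g z) \<partial>lborel)"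
    by (rule nn_integral_lborel_reflect[of "\<lambda>z. ennreal (?g z)"]) measurable
  also have "\<dots> = ennreal (gauss c TYPE('n))"
    unfolding gauss_def using g by (intro nn_integral_eq_integral) auto
  finally show n: "(\<integral>\<^sup>+z. ennreal (exp (- c * (norm (w - z))\<^sup>2)) \<partial>lborel) = ennreal (gauss c TYPE('n))" .
  then show "(\<integral>\<^sup>+z. ennreal (exp (- c * (norm (z - w))\<^sup>2)) \<partial>lborel) = ennreal (gauss c TYPE('n))"
    by (simp add: norm_minus_commute)
  show i: "integrable lborel (\<lambda>z. exp (- c * (norm (w - z))\<^sup>2))"
    by (rule integrableI_bounded) (simp_all add: n[simplified])
  show "(LINT z|lborel. exp (- c * (norm (w - z))\<^sup>2)) = gauss c TYPE('n)"
    using n gauss_pos[OF assms, where 'n = 'n] nn_integral_eq_integral[OF i] by simp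
qed

lemma fock_iff: "f \<in> fock \<alpha> s \<longleftrightarrow> entire f \<and> integrable lborel (\<lambda>z. wabs \<alpha> f z powr s)"
  by (simp only: fock_def norm_weighted mem_Collect_eq)

lemma fock_norm_eq: "fock_norm \<alpha> s f = (LINT z|lborel. wabs \<alpha> f z powr s) powr (1 / s)"
  by (simp only: fock_norm_def norm_weighted)

lemma fock_bound:
  assumes "0 < \<alpha>" "0 < s"
  obtains C where "0 < C" "\<And>(f :: complex^'n \<Rightarrow> complex) z. f \<in> fock \<alpha> s \<Longrightarrow> wabs \<alpha> f z \<le> C * fock_norm \<alpha> s f"
proof -
  obtain C where C: "0 < C" "\<And>(f :: complex^'n \<Rightarrow> complex) u. entire f \<Longrightarrow>
    integrable lborel (\<lambda>v. wabs \<alpha> f v powr s) \<Longrightarrow>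
    wabs \<alpha> f u \<le> C * (LINT v|lborel. wabs \<alpha> f v powr s) powr (1 / s)"
    using wabs_integrable_bound[OF assms(2), of \<alpha>] assms(1) by auto
  show ?thesis by (rule that[of C]) (use C in \<open>auto simp: fock_iff fock_norm_eq\<close>)
qed

lemma fock_subset_infty:
  fixes f :: "complex^'n \<Rightarrow> complex"
  assumes "0 < \<alpha>" "0 < s" "f \<in> fock \<alpha> s"
  shows "f \<in> fock_infty \<alpha>"
proof -
  obtain C where "0 < C" and C: "\<And>(f :: complex^'n \<Rightarrow> complex) z. f \<in> fock \<alpha> s \<Longrightarrow>
      wabs \<alpha> f z \<le> C * fock_norm \<alpha> s f"
    using fock_bound[OF assms(1,2)] by blast
  have "bdd_above (range (\<lambda>z. wabs \<alpha> f z))" using C[OF assms(3)] by (rule bdd_aboveI2)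
  moreover have "entire f" using assms(3) by (simp add: fock_iff)
  ultimately show ?thesis by (simp add: fock_infty_def wabs_def)
qed

text \<open>Kernels of Gaussian off-diagonal decay, holomorphic in the first and conjugate holomorphic in the
  second variable. The size \<open>e z\<close> may depend on \<open>z\<close>; this dependence is what distinguishes compact operators
  from bounded ones below.\<close>

definition fock_kernel ::
    "real \<Rightarrow> real \<Rightarrow> (complex^'n \<Rightarrow> real) \<Rightarrow> (complex^'n \<Rightarrow> complex^'n \<Rightarrow> complex) \<Rightarrow> bool" where
  "fock_kernel \<alpha> c e Q \<longleftrightarrow>
    (\<forall>z. entire (\<lambda>w. Q w z)) \<and> (\<forall>w. entire (\<lambda>z. cnj (Q w z))) \<and>
    e \<in> borel_measurable borel \<and> (\<exists>E. \<forall>z. 0 \<le> e z \<and> e z \<le> E) \<and>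
    (\<forall>w z. norm (Q w z) \<le> e z * exp (\<alpha> / 2 * (norm w)\<^sup>2 + \<alpha> / 2 * (norm z)\<^sup>2 - c * (norm (w - z))\<^sup>2))"

text \<open>The division by the Gaussian mass normalises the operator so that the reproducing kernel gives the identity.\<close>

definition kernel_op :: "real \<Rightarrow> (complex^'n \<Rightarrow> complex^'n \<Rightarrow> complex) \<Rightarrow> 'n::finite operator" where
  "kernel_op \<alpha> Q f w =
    (LINT z|lborel. f z * Q w z * of_real (exp (- \<alpha> * (norm z)\<^sup>2))) / of_real (gauss \<alpha> TYPE('n))"

lemma kernel_measurable:
  assumes "fock_kernel \<alpha> c e Q" shows "(\<lambda>z. Q w z) \<in> borel_measurable borel"
proof -
  have "entire (\<lambda>z. cnj (Q w z))" using assms by (simp add: fock_kernel_def)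
  then have "(\<lambda>z. cnj (cnj (Q w z))) \<in> borel_measurable borel"
    by (intro measurable_compose[OF entire_measurable] borel_measurable_continuous_onI continuous_intros)
  then show ?thesis by simp
qed

lemma kernel_integrand_bound:
  assumes "fock_kernel \<alpha> c e Q"
  shows "norm (f z * Q w z * of_real (exp (- \<alpha> * (norm z)\<^sup>2)))
    \<le> exp (\<alpha> / 2 * (norm w)\<^sup>2) * (exp (- c * (norm (w - z))\<^sup>2) * (wabs \<alpha> f z * e z))"
proof -
  have "norm (f z * Q w z * of_real (exp (- \<alpha> * (norm z)\<^sup>2))) = norm (f z) * exp (- \<alpha> * (norm z)\<^sup>2) * norm (Q w z)"
    by (simp add: norm_mult)
  also have "\<dots> \<le> norm (f z) * exp (- \<alpha> * (norm z)\<^sup>2) *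
      (e z * exp (\<alpha> / 2 * (norm w)\<^sup>2 + \<alpha> / 2 * (norm z)\<^sup>2 - c * (norm (w - z))\<^sup>2))"
    using assms by (intro mult_left_mono) (auto simp: fock_kernel_def)
  also have "\<dots> = norm (f z) * e z * (exp (- \<alpha> * (norm z)\<^sup>2) *
      exp (\<alpha> / 2 * (norm w)\<^sup>2 + \<alpha> / 2 * (norm z)\<^sup>2 - c * (norm (w - z))\<^sup>2))"
    by (simp only: mult_ac)
  also have "exp (- \<alpha> * (norm z)\<^sup>2) * exp (\<alpha> / 2 * (norm w)\<^sup>2 + \<alpha> / 2 * (norm z)\<^sup>2 - c * (norm (w - z))\<^sup>2)
    = exp (\<alpha> / 2 * (norm w)\<^sup>2) * exp (- c * (norm (w - z))\<^sup>2) * exp (- (\<alpha> / 2) * (norm z)\<^sup>2)"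
    by (simp add: field_simps flip: exp_add)
  finally show ?thesis by (simp only: wabs_def mult_ac)
qed

lemma kernel_integrand_measurable:
  assumes "fock_kernel \<alpha> c e Q" "f \<in> borel_measurable borel"
  shows "(\<lambda>z. f z * Q w z * of_real (exp (- \<alpha> * (norm z)\<^sup>2))) \<in> borel_measurable borel"
  using kernel_measurable[OF assms(1), measurable] assms(2)[measurable] by measurable

lemma weight_integrable:
  fixes f :: "complex^'n \<Rightarrow> complex"
  assumes Q: "fock_kernel \<alpha> c e Q" and d: "0 < d" and f: "f \<in> fock_infty \<alpha>" and s: "0 < s"
  shows "integrable lborel (\<lambda>z. exp (- d * (norm (w - z))\<^sup>2) * (wabs \<alpha> f z * e z) powr s)"
proof -
  obtain B where B: "entire f" "\<And>z. wabs \<alpha> f z \<le> B"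
    using fock_inftyE[OF f] by blast
  have B0: "0 \<le> B" using B(2)[of 0] wabs_nonneg[of \<alpha> f 0] by linarith
  obtain E where E: "\<And>z. 0 \<le> e z" "\<And>z. e z \<le> E" and [measurable]: "e \<in> borel_measurable borel"
    using Q unfolding fock_kernel_def by blast
  note wabs_measurable[OF B(1), measurable]
  have "wabs \<alpha> f z * e z \<le> B * E" for z
    using B(2)[of z] E[of z] B0 by (intro mult_mono) auto
  then have le: "(wabs \<alpha> f z * e z) powr s \<le> (B * E) powr s" for z
    using E s by (intro powr_mono2) auto
  show ?thesis
  proof (rule Bochner_Integration.integrable_bound)
    show "integrable lborel (\<lambda>z. exp (- d * (norm (w - z))\<^sup>2) * (B * E) powr s)"
      using gaussian_translate(1)[OF d] by (rule integrable_mult_left)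
    show "(\<lambda>z. exp (- d * (norm (w - z))\<^sup>2) * (wabs \<alpha> f z * e z) powr s) \<in> borel_measurable lborel"
      by measurable
  qed (use le in \<open>auto simp: abs_mult\<close>)
qed

lemma weight_integrable_1:
  fixes f :: "complex^'n \<Rightarrow> complex"
  assumes Q: "fock_kernel \<alpha> c e Q" and c: "0 < c" and f: "f \<in> fock_infty \<alpha>"
  shows "integrable lborel (\<lambda>z. exp (- c * (norm (w - z))\<^sup>2) * (wabs \<alpha> f z * e z))"
proof -
  have "0 \<le> wabs \<alpha> f z * e z" for z using Q by (auto simp: fock_kernel_def)
  then show ?thesis using weight_integrable[OF Q c f, of 1 w] by simp
qed

lemma kernel_integrable:
  fixes f :: "complex^'n \<Rightarrow> complex"
  assumes Q: "fock_kernel \<alpha> c e Q" and c: "0 < c" and f: "f \<in> fock_infty \<alpha>"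
  shows "integrable lborel (\<lambda>z. f z * Q w z * of_real (exp (- \<alpha> * (norm z)\<^sup>2)))"
proof (rule Bochner_Integration.integrable_bound)
  show "integrable lborel (\<lambda>z. exp (\<alpha> / 2 * (norm w)\<^sup>2) * (exp (- c * (norm (w - z))\<^sup>2) * (wabs \<alpha> f z * e z)))"
    using weight_integrable_1[OF assms] by (rule integrable_mult_right)
  have "f \<in> borel_measurable borel" using fock_inftyE[OF f] entire_measurable by blast
  then show "(\<lambda>z. f z * Q w z * of_real (exp (- \<alpha> * (norm z)\<^sup>2))) \<in> borel_measurable lborel"
    using kernel_integrand_measurable[OF Q] by simp
  show "AE z in lborel. norm (f z * Q w z * of_real (exp (- \<alpha> * (norm z)\<^sup>2)))
      \<le> norm (exp (\<alpha> / 2 * (norm w)\<^sup>2) * (exp (- c * (norm (w - z))\<^sup>2) * (wabs \<alpha> f z * e z)))"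
    unfolding real_norm_def
    by (intro AE_I2 order_trans[OF kernel_integrand_bound[OF Q] abs_ge_self])
qed

text \<open>For \<open>|w| \<le> R\<close> the decay in \<open>w - z\<close> becomes decay in \<open>z\<close>, since \<open>|z|\<^sup>2 \<le> 2|w|\<^sup>2 + 2|w - z|\<^sup>2\<close>. The lemma is
  stated for measurable \<open>f\<close> because it also serves to prove that a pointwise limit of entire functions is entire.\<close>

lemma entire_kernel_op:
  fixes f :: "complex^'n \<Rightarrow> complex"
  assumes Q: "fock_kernel \<alpha> c e Q" and \<alpha>: "0 < \<alpha>" and c: "0 < c"
    and f: "f \<in> borel_measurable borel" and B: "\<And>z. wabs \<alpha> f z \<le> B"
  shows "entire (kernel_op \<alpha> Q f)"
proof -
  have B0: "0 \<le> B" using B[of 0] wabs_nonneg[of \<alpha> f 0] by linarith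
  obtain E where E: "\<And>z. 0 \<le> e z" "\<And>z. e z \<le> E"
    using Q unfolding fock_kernel_def by blast
  have "entire (\<lambda>w. LINT z|lborel. f z * Q w z * of_real (exp (- \<alpha> * (norm z)\<^sup>2)))"
  proof (rule entire_integral)
    show "entire (\<lambda>w. f z * Q w z * of_real (exp (- \<alpha> * (norm z)\<^sup>2)))" for z
      using Q by (intro entire_mult entire_const) (auto simp: fock_kernel_def)
    show "(\<lambda>z. f z * Q w z * of_real (exp (- \<alpha> * (norm z)\<^sup>2))) \<in> borel_measurable lborel" for w
      using kernel_integrand_measurable[OF Q f] by simp
    fix R :: real
    let ?G = "\<lambda>z :: complex^'n. exp (\<alpha> / 2 * R\<^sup>2) * (exp (c * R\<^sup>2) * (B * E)) * exp (- (c / 2) * (norm z)\<^sup>2)"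
    have "norm (f z * Q w z * of_real (exp (- \<alpha> * (norm z)\<^sup>2))) \<le> ?G z" if w: "norm w \<le> R" for w z
    proof -
      have wR: "(norm w)\<^sup>2 \<le> R\<^sup>2" using w by (intro power_mono) auto
      have "(norm z)\<^sup>2 \<le> (norm w + norm (w - z))\<^sup>2"
        using norm_triangle_sub[of z w] by (intro power_mono) (auto simp: norm_minus_commute add.commute)
      also have "\<dots> \<le> 2 * (norm w)\<^sup>2 + 2 * (norm (w - z))\<^sup>2"
        using sum_squares_bound[of "norm w" "norm (w - z)"] by (simp add: power2_sum)
      finally have "(norm z)\<^sup>2 / 2 - R\<^sup>2 \<le> (norm (w - z))\<^sup>2" using wR by simp
      then have "c * ((norm z)\<^sup>2 / 2 - R\<^sup>2) \<le> c * (norm (w - z))\<^sup>2"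
        using c by (intro mult_left_mono) auto
      then have 1: "exp (- c * (norm (w - z))\<^sup>2) \<le> exp (c * R\<^sup>2) * exp (- (c / 2) * (norm z)\<^sup>2)"
        by (simp add: algebra_simps flip: exp_add)
      have 2: "wabs \<alpha> f z * e z \<le> B * E"
        using B[of z] E[of z] B0 by (intro mult_mono) auto
      have 3: "exp (\<alpha> / 2 * (norm w)\<^sup>2) \<le> exp (\<alpha> / 2 * R\<^sup>2)" using wR \<alpha> by simp
      have "norm (f z * Q w z * of_real (exp (- \<alpha> * (norm z)\<^sup>2)))
        \<le> exp (\<alpha> / 2 * (norm w)\<^sup>2) * (exp (- c * (norm (w - z))\<^sup>2) * (wabs \<alpha> f z * e z))"
        by (rule kernel_integrand_bound[OF Q])
      also have "\<dots> \<le> exp (\<alpha> / 2 * R\<^sup>2) * ((exp (c * R\<^sup>2) * exp (- (c / 2) * (norm z)\<^sup>2)) * (B * E))"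
        by (rule mult_mono[OF 3 mult_mono[OF 1 2]]) (use E(1)[of z] in auto)
      finally show ?thesis by (simp only: mult_ac)
    qed
    moreover have "integrable lborel ?G"
      using c by (intro integrable_mult_right integrable_gaussian) auto
    ultimately show "\<exists>G. integrable lborel G \<and> (\<forall>w z. norm w \<le> R \<longrightarrow>
        norm (f z * Q w z * of_real (exp (- \<alpha> * (norm z)\<^sup>2))) \<le> G z)"
      by blast
  qed
  from entire_mult[OF this entire_const[of "inverse (of_real (gauss \<alpha> TYPE('n)))"]]
  show ?thesis by (simp only: kernel_op_def[abs_def] divide_inverse)
qed

lemma entire_kernel_op_fock:
  assumes "fock_kernel \<alpha> c e Q" "0 < \<alpha>" "0 < c" "f \<in> fock_infty \<alpha>"
  shows "entire (kernel_op \<alpha> Q f)"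
  using fock_inftyE[OF assms(4)] entire_kernel_op[OF assms(1-3)] entire_measurable by metis

lemma wabs_kernel_op_le:
  fixes f :: "complex^'n \<Rightarrow> complex"
  assumes "0 < \<alpha>"
  shows "wabs \<alpha> (kernel_op \<alpha> Q f) w \<le> exp (- (\<alpha> / 2) * (norm w)\<^sup>2) / gauss \<alpha> TYPE('n) *
    (LINT z|lborel. norm (f z * Q w z * of_real (exp (- \<alpha> * (norm z)\<^sup>2))))"
proof -
  have "norm (kernel_op \<alpha> Q f w) \<le> (LINT z|lborel. norm (f z * Q w z * of_real (exp (- \<alpha> * (norm z)\<^sup>2)))) / gauss \<alpha> TYPE('n)"
    unfolding kernel_op_def norm_divide using gauss_pos[OF assms, where 'n = 'n]
    by (auto intro!: divide_right_mono integral_norm_bound simp del: of_real_exp)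
  from mult_right_mono[OF this, of "exp (- (\<alpha> / 2) * (norm w)\<^sup>2)"]
  show ?thesis by (simp add: wabs_def mult.commute)
qed

text \<open>For \<open>s \<ge> 1\<close> this is Jensen's inequality with respect to the Gaussian. For \<open>s < 1\<close> and fixed \<open>w\<close> the function
  \<open>g(z) = f(z) cnj(Q(w,z))\<close> is entire, and its weighted modulus \<open>u\<close> for the parameter \<open>2\<alpha>\<close> is the modulus of the
  integrand. Its supremum is bounded by its \<open>L\<^sup>s\<close> size \<open>J\<^bsup>1/s\<^esup>\<close>, so \<open>u \<le> (sup u)\<^bsup>1-s\<^esup> u\<^sup>s\<close> bounds the
  \<open>L\<^sup>1\<close> norm of \<open>u\<close> by \<open>J\<^bsup>1/s\<^esup>\<close>. The constant precedes \<open>Q\<close> and \<open>e\<close> because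
  the proof of compactness varies \<open>e\<close> while keeping the constant.\<close>

lemma kernel_op_pointwise:
  assumes \<alpha>: "0 < \<alpha>" and c: "0 < c" and s: "0 < s"
  obtains C where "0 < C"
    "\<And>Q e (f :: complex^'n \<Rightarrow> complex) w. fock_kernel \<alpha> c e Q \<Longrightarrow> f \<in> fock \<alpha> s \<Longrightarrow>
      wabs \<alpha> (kernel_op \<alpha> Q f) w powr s
        \<le> C * (LINT z|lborel. exp (- (c * min 1 s) * (norm (w - z))\<^sup>2) * (wabs \<alpha> f z * e z) powr s)"
proof (cases "1 \<le> s")
  case True
  define \<gamma> where "\<gamma> = gauss \<alpha> TYPE('n)"
  define K where "K = gauss c TYPE('n)"
  have pos: "0 < \<gamma>" "0 < K" unfolding \<gamma>_def K_def using gauss_pos \<alpha> c by auto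
  have "wabs \<alpha> (kernel_op \<alpha> Q f) w powr s
      \<le> K powr (s - 1) / \<gamma> powr s * (LINT z|lborel. exp (- (c * min 1 s) * (norm (w - z))\<^sup>2) * (wabs \<alpha> f z * e z) powr s)"
    if Q: "fock_kernel \<alpha> c e Q" and f: "f \<in> fock \<alpha> s" for Q e and f :: "complex^'n \<Rightarrow> complex" and w
  proof -
    have fi: "f \<in> fock_infty \<alpha>" using \<alpha> s f by (rule fock_subset_infty)
    let ?k = "\<lambda>z. exp (- c * (norm (w - z))\<^sup>2)"
    let ?A = "LINT z|lborel. ?k z * (wabs \<alpha> f z * e z)"
    let ?X = "exp (\<alpha> / 2 * (norm w)\<^sup>2)"
    have A0: "0 \<le> ?A" using Q by (auto simp: fock_kernel_def intro!: Bochner_Integration.integral_nonneg)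
    have "(LINT z|lborel. norm (f z * Q w z * of_real (exp (- \<alpha> * (norm z)\<^sup>2)))) \<le> (LINT z|lborel. ?X * (?k z * (wabs \<alpha> f z * e z)))"
      using kernel_integrable[OF Q c fi] weight_integrable_1[OF Q c fi]
      by (intro integral_mono integrable_norm integrable_mult_right kernel_integrand_bound[OF Q])
    also have "\<dots> = ?X * ?A" by (rule integral_mult_right_zero)
    finally have "wabs \<alpha> (kernel_op \<alpha> Q f) w \<le> exp (- (\<alpha> / 2) * (norm w)\<^sup>2) / \<gamma> * (?X * ?A)"
      using pos by (intro order_trans[OF wabs_kernel_op_le[OF \<alpha>, of Q f w, folded \<gamma>_def]] mult_left_mono) auto
    also have "\<dots> = (exp (- (\<alpha> / 2) * (norm w)\<^sup>2) * ?X) * ?A / \<gamma>" by (simp only: times_divide_eq_left times_divide_eq_right mult_ac)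
    also have "exp (- (\<alpha> / 2) * (norm w)\<^sup>2) * ?X = 1" by (simp flip: exp_add)
    finally have "wabs \<alpha> (kernel_op \<alpha> Q f) w powr s \<le> (1 * ?A / \<gamma>) powr s"
      using s by (intro powr_mono2) auto
    also have "\<dots> = ?A powr s / \<gamma> powr s" using pos A0 by (simp add: powr_divide)
    also have "\<dots> \<le> (K powr (s - 1) * (LINT z|lborel. ?k z * (wabs \<alpha> f z * e z) powr s)) / \<gamma> powr s"
    proof (intro divide_right_mono)
      show "?A powr s \<le> K powr (s - 1) * (LINT z|lborel. ?k z * (wabs \<alpha> f z * e z) powr s)"
        unfolding K_def gaussian_translate(2)[OF c, of w, symmetric]
        using Q by (intro jensen_powr True gaussian_translate[OF c] weight_integrable_1[OF Q c fi]
            weight_integrable[OF Q c fi s]) (auto simp: fock_kernel_def)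
    qed simp
    finally show ?thesis using True by simp
  qed
  then show ?thesis using pos by (intro that[of "K powr (s - 1) / \<gamma> powr s"]) auto
next
  case False
  then have s1: "s < 1" by simp
  define \<gamma> where "\<gamma> = gauss \<alpha> TYPE('n)"
  have pos: "0 < \<gamma>" unfolding \<gamma>_def using gauss_pos \<alpha> by auto
  obtain C where C: "0 < C" "\<And>(f :: complex^'n \<Rightarrow> complex) u. entire f \<Longrightarrow>
    integrable lborel (\<lambda>v. wabs (2 * \<alpha>) f v powr s) \<Longrightarrow>
    wabs (2 * \<alpha>) f u \<le> C * (LINT v|lborel. wabs (2 * \<alpha>) f v powr s) powr (1 / s)"
    using wabs_integrable_bound[OF s, of "2 * \<alpha>"] \<alpha> by auto
  have "wabs \<alpha> (kernel_op \<alpha> Q f) w powr s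
      \<le> C powr ((1 - s) * s) / \<gamma> powr s * (LINT z|lborel. exp (- (c * min 1 s) * (norm (w - z))\<^sup>2) * (wabs \<alpha> f z * e z) powr s)"
    if Q: "fock_kernel \<alpha> c e Q" and f: "f \<in> fock \<alpha> s" for Q e and f :: "complex^'n \<Rightarrow> complex" and w
  proof -
    have fi: "f \<in> fock_infty \<alpha>" using \<alpha> s f by (rule fock_subset_infty)
    have ent: "entire f" using f by (simp add: fock_iff)
    define I where "I = (LINT z|lborel. exp (- (c * s) * (norm (w - z))\<^sup>2) * (wabs \<alpha> f z * e z) powr s)"
    have intI: "integrable lborel (\<lambda>z. exp (- (c * s) * (norm (w - z))\<^sup>2) * (wabs \<alpha> f z * e z) powr s)"
      using c s by (intro weight_integrable[OF Q _ fi s]) auto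
    define X where "X = exp (\<alpha> / 2 * (norm w)\<^sup>2)"
    define g where "g = (\<lambda>z. f z * cnj (Q w z))"
    have g: "entire g" using Q unfolding g_def by (intro entire_mult ent) (simp add: fock_kernel_def)
    have ug: "wabs (2 * \<alpha>) g z = norm (f z * Q w z * of_real (exp (- \<alpha> * (norm z)\<^sup>2)))" for z
      by (simp add: wabs_def g_def norm_mult)
    have le: "wabs (2 * \<alpha>) g z powr s \<le> X powr s * (exp (- (c * s) * (norm (w - z))\<^sup>2) * (wabs \<alpha> f z * e z) powr s)" for z
    proof -
      have "wabs (2 * \<alpha>) g z powr s \<le> (X * (exp (- c * (norm (w - z))\<^sup>2) * (wabs \<alpha> f z * e z))) powr s"
        unfolding ug X_def using s by (intro powr_mono2 kernel_integrand_bound[OF Q]) auto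
      also have "\<dots> = X powr s * (exp (- c * (norm (w - z))\<^sup>2) powr s * (wabs \<alpha> f z * e z) powr s)"
        by (simp add: powr_mult)
      also have "exp (- c * (norm (w - z))\<^sup>2) powr s = exp (- (c * s) * (norm (w - z))\<^sup>2)"
        by (simp add: exp_powr_real mult_ac)
      finally show ?thesis .
    qed
    have intg: "integrable lborel (\<lambda>z. wabs (2 * \<alpha>) g z powr s)"
    proof (rule Bochner_Integration.integrable_bound[OF integrable_mult_right[OF intI, of "X powr s"]])
      show "(\<lambda>z. wabs (2 * \<alpha>) g z powr s) \<in> borel_measurable lborel"
        using wabs_measurable[OF g, measurable] by measurable
      show "AE z in lborel. norm (wabs (2 * \<alpha>) g z powr s)
          \<le> norm (X powr s * (exp (- (c * s) * (norm (w - z))\<^sup>2) * (wabs \<alpha> f z * e z) powr s))"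
        using le by (intro AE_I2) (simp add: abs_mult)
    qed
    define J where "J = (LINT z|lborel. wabs (2 * \<alpha>) g z powr s)"
    have J0: "0 \<le> J" unfolding J_def by (rule Bochner_Integration.integral_nonneg) simp
    have JI: "J \<le> X powr s * I"
      unfolding J_def I_def using intg intI le
      by (subst integral_mult_right_zero[symmetric]) (intro integral_mono integrable_mult_right)
    define G where "G = C * J powr (1 / s)"
    have G: "wabs (2 * \<alpha>) g z \<le> G" for z
      unfolding G_def J_def by (rule C(2)[OF g intg])
    have G0: "0 \<le> G" using G[of 0] wabs_nonneg[of "2 * \<alpha>" g 0] by linarith
    define U where "U = (LINT z|lborel. wabs (2 * \<alpha>) g z)"
    have U0: "0 \<le> U" unfolding U_def by (rule Bochner_Integration.integral_nonneg) simp
    have "U \<le> (LINT z|lborel. G powr (1 - s) * wabs (2 * \<alpha>) g z powr s)"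
      unfolding U_def
    proof (intro integral_mono integrable_mult_right intg)
      show "integrable lborel (wabs (2 * \<alpha>) g)"
        unfolding ug[abs_def] by (intro integrable_norm kernel_integrable[OF Q c fi])
      fix z
      have "wabs (2 * \<alpha>) g z = wabs (2 * \<alpha>) g z powr (1 - s) * wabs (2 * \<alpha>) g z powr s"
        by (simp flip: powr_add)
      also have "\<dots> \<le> G powr (1 - s) * wabs (2 * \<alpha>) g z powr s"
        using s1 G by (intro mult_right_mono powr_mono2) auto
      finally show "wabs (2 * \<alpha>) g z \<le> G powr (1 - s) * wabs (2 * \<alpha>) g z powr s" .
    qed
    also have "\<dots> = G powr (1 - s) * J" unfolding J_def by (rule integral_mult_right_zero)
    finally have "U powr s \<le> (G powr (1 - s) * J) powr s"
      using s U0 by (intro powr_mono2) auto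
    also have "\<dots> = C powr ((1 - s) * s) * (J powr (1 - s) * J powr s)"
      using C(1) J0 G0 s by (simp add: G_def powr_mult powr_powr)
    also have "J powr (1 - s) * J powr s = J"
      using J0 by (simp flip: powr_add)
    finally have U: "U powr s \<le> C powr ((1 - s) * s) * (X powr s * I)"
      using JI by (meson mult_left_mono order_trans powr_ge_zero)
    have X0: "0 < X" by (simp add: X_def)
    have "wabs \<alpha> (kernel_op \<alpha> Q f) w \<le> exp (- (\<alpha> / 2) * (norm w)\<^sup>2) / \<gamma> * U"
      using wabs_kernel_op_le[OF \<alpha>, of Q f w] by (simp only: \<gamma>_def U_def ug)
    also have "exp (- (\<alpha> / 2) * (norm w)\<^sup>2) = 1 / X"
      by (simp add: X_def exp_minus inverse_eq_divide)
    finally have "wabs \<alpha> (kernel_op \<alpha> Q f) w powr s \<le> (1 / X / \<gamma> * U) powr s"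
      using s by (intro powr_mono2) auto
    also have "\<dots> = U powr s / (X powr s * \<gamma> powr s)"
      using U0 X0 pos by (simp add: powr_mult powr_divide)
    also have "\<dots> \<le> C powr ((1 - s) * s) * (X powr s * I) / (X powr s * \<gamma> powr s)"
      using U by (rule divide_right_mono) simp
    also have "\<dots> = C powr ((1 - s) * s) / \<gamma> powr s * I" using X0 by simp
    finally show ?thesis using s1 by (simp add: I_def)
  qed
  then show ?thesis using pos C(1) by (intro that[of "C powr ((1 - s) * s) / \<gamma> powr s"]) auto
qed

text \<open>Integration of the pointwise bound in \<open>w\<close>: by Tonelli's theorem the Gaussian is integrated first and only its
  mass remains.\<close>

lemma kernel_op_power_bound:
  assumes \<alpha>: "0 < \<alpha>" and c: "0 < c" and s: "0 < s"
  obtains C where "0 < C"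
    "\<And>Q e (f :: complex^'n \<Rightarrow> complex). fock_kernel \<alpha> c e Q \<Longrightarrow> f \<in> fock \<alpha> s \<Longrightarrow>
      kernel_op \<alpha> Q f \<in> fock \<alpha> s \<and>
      (LINT w|lborel. wabs \<alpha> (kernel_op \<alpha> Q f) w powr s) \<le> C * (LINT z|lborel. (wabs \<alpha> f z * e z) powr s)"
proof -
  obtain C where C: "0 < C"
    "\<And>Q e (f :: complex^'n \<Rightarrow> complex) w. fock_kernel \<alpha> c e Q \<Longrightarrow> f \<in> fock \<alpha> s \<Longrightarrow>
      wabs \<alpha> (kernel_op \<alpha> Q f) w powr s
        \<le> C * (LINT z|lborel. exp (- (c * min 1 s) * (norm (w - z))\<^sup>2) * (wabs \<alpha> f z * e z) powr s)"
    using kernel_op_pointwise[OF assms] by blast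
  define d where "d = c * min 1 s"
  have d: "0 < d" using c s by (simp add: d_def)
  define K where "K = gauss d TYPE('n)"
  have K: "0 < K" unfolding K_def using d by (rule gauss_pos)
  have "kernel_op \<alpha> Q f \<in> fock \<alpha> s \<and>
      (LINT w|lborel. wabs \<alpha> (kernel_op \<alpha> Q f) w powr s) \<le> (C * K) * (LINT z|lborel. (wabs \<alpha> f z * e z) powr s)"
    if Q: "fock_kernel \<alpha> c e Q" and f: "f \<in> fock \<alpha> s" for Q e and f :: "complex^'n \<Rightarrow> complex"
  proof -
    have fi: "f \<in> fock_infty \<alpha>" using \<alpha> s f by (rule fock_subset_infty)
    have ent: "entire f" and intf: "integrable lborel (\<lambda>z. wabs \<alpha> f z powr s)"
      using f by (auto simp: fock_iff)
    have entT: "entire (kernel_op \<alpha> Q f)" by (rule entire_kernel_op_fock[OF Q \<alpha> c fi])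
    obtain E where E: "\<And>z. 0 \<le> e z" "\<And>z. e z \<le> E" and [measurable]: "e \<in> borel_measurable borel"
      using Q unfolding fock_kernel_def by blast
    note wabs_measurable[OF ent, measurable] wabs_measurable[OF entT, measurable]
    let ?h = "\<lambda>z. (wabs \<alpha> f z * e z) powr s"
    have inth: "integrable lborel ?h"
    proof (rule Bochner_Integration.integrable_bound[OF integrable_mult_right[OF intf, of "E powr s"]])
      show "AE z in lborel. norm (?h z) \<le> norm (E powr s * wabs \<alpha> f z powr s)"
      proof (intro AE_I2)
        fix z
        have "?h z \<le> (wabs \<alpha> f z * E) powr s"
          using s E[of z] by (intro powr_mono2 mult_left_mono mult_nonneg_nonneg) auto
        then show "norm (?h z) \<le> norm (E powr s * wabs \<alpha> f z powr s)"
          by (simp add: powr_mult mult.commute)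
      qed
    qed measurable
    have h0: "0 \<le> (LINT z|lborel. ?h z)" by (rule Bochner_Integration.integral_nonneg) simp
    have "(\<integral>\<^sup>+w. ennreal (wabs \<alpha> (kernel_op \<alpha> Q f) w powr s) \<partial>lborel)
      \<le> (\<integral>\<^sup>+w. ennreal C * (\<integral>\<^sup>+z. ennreal (exp (- d * (norm (w - z))\<^sup>2)) * ennreal (?h z) \<partial>lborel) \<partial>lborel)"
    proof (rule nn_integral_mono)
      fix w :: "complex^'n"
      have "ennreal (wabs \<alpha> (kernel_op \<alpha> Q f) w powr s)
        \<le> ennreal (C * (LINT z|lborel. exp (- d * (norm (w - z))\<^sup>2) * ?h z))"
        unfolding d_def by (rule ennreal_leI[OF C(2)[OF Q f]])
      also have "\<dots> = ennreal C * ennreal (LINT z|lborel. exp (- d * (norm (w - z))\<^sup>2) * ?h z)"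
        using C(1) by (simp add: ennreal_mult')
      also have "ennreal (LINT z|lborel. exp (- d * (norm (w - z))\<^sup>2) * ?h z)
        = (\<integral>\<^sup>+z. ennreal (exp (- d * (norm (w - z))\<^sup>2) * ?h z) \<partial>lborel)"
        by (rule nn_integral_eq_integral[symmetric, OF weight_integrable[OF Q d fi s]]) simp
      finally show "ennreal (wabs \<alpha> (kernel_op \<alpha> Q f) w powr s)
        \<le> ennreal C * (\<integral>\<^sup>+z. ennreal (exp (- d * (norm (w - z))\<^sup>2)) * ennreal (?h z) \<partial>lborel)"
        by (simp add: ennreal_mult)
    qed
    also have "\<dots> = ennreal C * (\<integral>\<^sup>+w. (\<integral>\<^sup>+z. ennreal (exp (- d * (norm (w - z))\<^sup>2)) * ennreal (?h z) \<partial>lborel) \<partial>lborel)"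
      by (rule nn_integral_cmult) measurable
    also have "(\<integral>\<^sup>+w. (\<integral>\<^sup>+z. ennreal (exp (- d * (norm (w - z))\<^sup>2)) * ennreal (?h z) \<partial>lborel) \<partial>lborel)
      = (\<integral>\<^sup>+z. (\<integral>\<^sup>+w. ennreal (exp (- d * (norm (w - z))\<^sup>2)) * ennreal (?h z) \<partial>lborel) \<partial>lborel)"
      by (rule lborel_pair.Fubini') measurable
    also have "\<dots> = (\<integral>\<^sup>+z. ennreal K * ennreal (?h z) \<partial>lborel)"
      by (subst nn_integral_multc) (simp_all only: K_def gaussian_translate(4)[OF d], measurable)
    also have "\<dots> = ennreal K * (\<integral>\<^sup>+z. ennreal (?h z) \<partial>lborel)"
      by (rule nn_integral_cmult) measurable
    also have "(\<integral>\<^sup>+z. ennreal (?h z) \<partial>lborel) = ennreal (LINT z|lborel. ?h z)"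
      by (rule nn_integral_eq_integral[OF inth]) simp
    also have "ennreal C * (ennreal K * ennreal (LINT z|lborel. ?h z)) = ennreal (C * K * (LINT z|lborel. ?h z))"
      using C(1) K h0 by (simp add: ennreal_mult mult.assoc)
    finally have nn: "(\<integral>\<^sup>+w. ennreal (wabs \<alpha> (kernel_op \<alpha> Q f) w powr s) \<partial>lborel)
      \<le> ennreal (C * K * (LINT z|lborel. ?h z))" .
    have int: "integrable lborel (\<lambda>w. wabs \<alpha> (kernel_op \<alpha> Q f) w powr s)"
    proof (rule integrableI_bounded)
      show "(\<integral>\<^sup>+w. ennreal (norm (wabs \<alpha> (kernel_op \<alpha> Q f) w powr s)) \<partial>lborel) < \<infinity>"
        using nn by (simp add: le_less_trans[OF _ ennreal_less_top])
    qed measurable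
    moreover have "(LINT w|lborel. wabs \<alpha> (kernel_op \<alpha> Q f) w powr s) \<le> C * K * (LINT z|lborel. ?h z)"
    proof -
      have "ennreal (LINT w|lborel. wabs \<alpha> (kernel_op \<alpha> Q f) w powr s) \<le> ennreal (C * K * (LINT z|lborel. ?h z))"
        using nn by (subst nn_integral_eq_integral[symmetric, OF int]) auto
      then show ?thesis using C(1) K h0 by (subst (asm) ennreal_le_iff) auto
    qed
    ultimately show ?thesis using entT by (simp add: fock_iff)
  qed
  then show ?thesis using C(1) K by (intro that[of "C * K"]) auto
qed

section \<open>Operators given by their values on reproducing kernels\<close>

lemma norm_kernel_in_span: "norm_kernel \<alpha> z \<in> kernel_span \<alpha>"
  unfolding kernel_span_def by (auto intro!: exI[of _ "{z}"] exI[of _ "\<lambda>_. 1"])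

lemma norm_kernel_in_infty: "norm_kernel \<alpha> (z :: complex^'n) \<in> fock_infty \<alpha>" if "0 \<le> \<alpha>"
proof -
  have "wabs \<alpha> (norm_kernel \<alpha> z) u \<le> 1" for u
    using that by (simp add: wabs_def norm_norm_kernel flip: exp_add)
  then have "bdd_above (range (\<lambda>u. wabs \<alpha> (norm_kernel \<alpha> z) u))" by (rule bdd_aboveI2)
  then show ?thesis by (simp add: fock_infty_def wabs_def entire_norm_kernel)
qed

lemma wabs_add: "wabs \<alpha> (\<lambda>z. f z + g z) z \<le> wabs \<alpha> f z + wabs \<alpha> g z"
  unfolding wabs_def distrib_right[symmetric] by (intro mult_right_mono norm_triangle_ineq) simp

lemma wabs_scale: "wabs \<alpha> (\<lambda>z. c * f z) z = norm c * wabs \<alpha> f z"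
  by (simp add: wabs_def norm_mult)

lemma fock_inftyI: "entire f \<Longrightarrow> (\<And>z. wabs \<alpha> f z \<le> B) \<Longrightarrow> f \<in> fock_infty \<alpha>"
  unfolding fock_infty_def wabs_def by (auto intro!: bdd_aboveI2)

lemma fock_infty_add:
  assumes "f \<in> fock_infty \<alpha>" "g \<in> fock_infty \<alpha>" shows "(\<lambda>z. f z + g z) \<in> fock_infty \<alpha>"
proof -
  obtain A where A: "entire f" "\<And>z. wabs \<alpha> f z \<le> A" using fock_inftyE[OF assms(1)] by blast
  obtain B where B: "entire g" "\<And>z. wabs \<alpha> g z \<le> B" using fock_inftyE[OF assms(2)] by blast
  have "wabs \<alpha> (\<lambda>z. f z + g z) z \<le> A + B" for z
    using wabs_add[of \<alpha> f g z] A(2)[of z] B(2)[of z] by linarith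
  then show ?thesis using A B by (intro fock_inftyI entire_add)
qed

lemma fock_infty_scale:
  assumes "f \<in> fock_infty \<alpha>" shows "(\<lambda>z. c * f z) \<in> fock_infty \<alpha>"
proof -
  obtain A where A: "entire f" "\<And>z. wabs \<alpha> f z \<le> A" using fock_inftyE[OF assms(1)] by blast
  have "wabs \<alpha> (\<lambda>z. c * f z) z \<le> norm c * A" for z
    unfolding wabs_scale using A(2) by (intro mult_left_mono) auto
  then show ?thesis using A by (intro fock_inftyI entire_mult entire_const)
qed

lemma clinear_on_add: "clinear_on V T \<Longrightarrow> f \<in> V \<Longrightarrow> g \<in> V \<Longrightarrow> T (\<lambda>z. f z + g z) = (\<lambda>z. T f z + T g z)"
  by (simp add: clinear_on_def)

lemma clinear_on_scale: "clinear_on V T \<Longrightarrow> f \<in> V \<Longrightarrow> T (\<lambda>z. c * f z) = (\<lambda>z. c * T f z)"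
  by (simp add: clinear_on_def)

lemma clinear_on_kernel_sum:
  assumes T: "clinear_on V T" and V: "\<And>A c. finite A \<Longrightarrow> (\<lambda>w. \<Sum>z\<in>A. c z * norm_kernel \<alpha> z w) \<in> V"
    and A: "finite A"
  shows "T (\<lambda>w. \<Sum>z\<in>A. c z * norm_kernel \<alpha> z w) = (\<lambda>w. \<Sum>z\<in>A. c z * T (norm_kernel \<alpha> z) w)"
  using A
proof induction
  case empty
  have "(\<lambda>_. 0) \<in> V" using V[of "{}"] by simp
  from clinear_on_scale[OF T this, of 0] show ?case by simp
next
  case (insert z A)
  have k: "norm_kernel \<alpha> z \<in> V" using V[of "{z}" "\<lambda>_. 1"] by simp
  have ck: "(\<lambda>w. c z * norm_kernel \<alpha> z w) \<in> V" using V[of "{z}" c] by simp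
  have "T (\<lambda>w. c z * norm_kernel \<alpha> z w + (\<Sum>z\<in>A. c z * norm_kernel \<alpha> z w))
    = (\<lambda>w. T (\<lambda>w. c z * norm_kernel \<alpha> z w) w + T (\<lambda>w. \<Sum>z\<in>A. c z * norm_kernel \<alpha> z w) w)"
    by (rule clinear_on_add[OF T ck V[OF insert.hyps(1)]])
  moreover have "T (\<lambda>w. c z * norm_kernel \<alpha> z w) = (\<lambda>w. c z * T (norm_kernel \<alpha> z) w)"
    by (rule clinear_on_scale[OF T k])
  ultimately show ?case using insert by simp
qed

lemma kernel_sum_in_infty:
  assumes "0 \<le> \<alpha>" "finite A"
  shows "(\<lambda>w. \<Sum>z\<in>A. c z * norm_kernel \<alpha> z w) \<in> fock_infty \<alpha>"
  using assms(2)
proof induction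
  case empty
  show ?case by (rule fock_inftyI[of _ _ 0]) (auto simp: entire_const wabs_def)
next
  case (insert z A)
  then show ?case
    using fock_infty_add[OF fock_infty_scale[OF norm_kernel_in_infty[OF assms(1)]] insert.IH] by simp
qed

lemma kernel_op_clinear:
  fixes Q :: "complex^'n \<Rightarrow> complex^'n \<Rightarrow> complex"
  assumes Q: "fock_kernel \<alpha> c e Q" and c: "0 < c" and V: "V \<subseteq> fock_infty \<alpha>"
  shows "clinear_on V (kernel_op \<alpha> Q)"
  unfolding clinear_on_def
proof (intro conjI ballI allI ext)
  fix f g w assume "f \<in> V" "g \<in> V"
  then have i: "integrable lborel (\<lambda>z. f z * Q w z * of_real (exp (- \<alpha> * (norm z)\<^sup>2)))"
    "integrable lborel (\<lambda>z. g z * Q w z * of_real (exp (- \<alpha> * (norm z)\<^sup>2)))"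
    using V kernel_integrable[OF Q c] by blast+
  show "kernel_op \<alpha> Q (\<lambda>z. f z + g z) w = kernel_op \<alpha> Q f w + kernel_op \<alpha> Q g w"
    unfolding kernel_op_def distrib_right
    by (subst Bochner_Integration.integral_add[OF i]) (rule add_divide_distrib)
next
  fix a f w
  show "kernel_op \<alpha> Q (\<lambda>z. a * f z) w = a * kernel_op \<alpha> Q f w"
    unfolding kernel_op_def by (simp only: mult.assoc integral_mult_right_zero times_divide_eq_right)
qed

text \<open>This is the reproducing formula for the function \<open>z \<mapsto> cnj(Q(w,z))\<close>, which belongs to \<open>F\<^sup>\<infinity>\<close>.\<close>

lemma kernel_op_at_rep_kernel:
  assumes Q: "fock_kernel \<alpha> c e Q" and \<alpha>: "0 < \<alpha>" and c: "0 < c"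
  shows "kernel_op \<alpha> Q (rep_kernel \<alpha> a) w = Q w (a :: complex^'n)"
proof -
  obtain E where E: "\<And>z. 0 \<le> e z" "\<And>z. e z \<le> E"
    using Q unfolding fock_kernel_def by blast
  let ?F = "\<lambda>z. cnj (Q w z)"
  have F: "?F \<in> fock_infty \<alpha>"
  proof (rule fock_inftyI)
    show "entire ?F" using Q by (simp add: fock_kernel_def)
    fix z
    have "norm (Q w z) \<le> e z * exp (\<alpha> / 2 * (norm w)\<^sup>2 + \<alpha> / 2 * (norm z)\<^sup>2 - c * (norm (w - z))\<^sup>2)"
      using Q by (simp add: fock_kernel_def)
    also have "\<dots> \<le> E * exp (\<alpha> / 2 * (norm w)\<^sup>2 + \<alpha> / 2 * (norm z)\<^sup>2)"
      using E[of z] c by (intro mult_mono) auto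
    finally have "wabs \<alpha> ?F z \<le> E * exp (\<alpha> / 2 * (norm w)\<^sup>2 + \<alpha> / 2 * (norm z)\<^sup>2) * exp (- (\<alpha> / 2) * (norm z)\<^sup>2)"
      unfolding wabs_def complex_mod_cnj by (rule mult_right_mono) simp
    also have "\<dots> = E * exp (\<alpha> / 2 * (norm w)\<^sup>2)"
      by (simp add: mult.assoc flip: exp_add)
    finally show "wabs \<alpha> ?F z \<le> E * exp (\<alpha> / 2 * (norm w)\<^sup>2)" .
  qed
  have "(LINT z|lborel. rep_kernel \<alpha> a z * Q w z * of_real (exp (- \<alpha> * (norm z)\<^sup>2)))
    = (LINT z|lborel. cnj (?F z * rep_kernel \<alpha> z a * of_real (exp (- \<alpha> * (norm z)\<^sup>2))))"
    by (simp add: cnj_rep_kernel mult_ac)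
  also have "\<dots> = cnj (of_real (gauss \<alpha> TYPE('n)) * ?F a)"
    unfolding reproducing_formula[OF \<alpha> F, symmetric] by (rule Bochner_Integration.integral_cnj)
  finally show ?thesis using gauss_pos[OF \<alpha>, where 'n = 'n] by (simp add: kernel_op_def)
qed

lemma kernel_op_identity:
  fixes f :: "complex^'n \<Rightarrow> complex"
  assumes "0 < \<alpha>" "f \<in> fock_infty \<alpha>"
  shows "kernel_op \<alpha> (\<lambda>w z. rep_kernel \<alpha> z w) f = f"
  using reproducing_formula[OF assms] gauss_pos[OF assms(1), where 'n = 'n]
  by (intro ext) (simp add: kernel_op_def)

text \<open>The identity is itself an operator of this kind. Hence a pointwise limit of entire
  functions under a uniform weighted bound is again reproduced by the kernel, and therefore entire.\<close>

lemma fock_kernel_identity: "fock_kernel \<alpha> (\<alpha> / 2) (\<lambda>_. 1) (\<lambda>w z. rep_kernel \<alpha> z w)"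
  unfolding fock_kernel_def
  by (auto simp: entire_rep_kernel cnj_rep_kernel norm_rep_kernel intro!: exI[of _ 1])

lemma admissible_facts:
  assumes "admissible \<alpha> S"
  shows "entire (S (norm_kernel \<alpha> z))" "entire (\<lambda>w. S (rep_kernel \<alpha> z) w)" "entire (\<lambda>z. cnj (S (rep_kernel \<alpha> z) w))"
    "S (norm_kernel \<alpha> z) \<in> fock_infty \<alpha>"
    "S (rep_kernel \<alpha> z) = (\<lambda>w. of_real (exp (\<alpha> / 2 * (norm z)\<^sup>2)) * S (norm_kernel \<alpha> z) w)"
proof -
  show k: "S (norm_kernel \<alpha> z) \<in> fock_infty \<alpha>"
    using assms norm_kernel_in_span unfolding admissible_def by blast
  then show e: "entire (S (norm_kernel \<alpha> z))" by (simp add: fock_infty_def)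
  show r: "S (rep_kernel \<alpha> z) = (\<lambda>w. of_real (exp (\<alpha> / 2 * (norm z)\<^sup>2)) * S (norm_kernel \<alpha> z) w)"
    unfolding rep_kernel_eq
    using assms by (intro clinear_on_scale[OF _ norm_kernel_in_span]) (simp add: admissible_def)
  show "entire (\<lambda>w. S (rep_kernel \<alpha> z) w)" unfolding r by (intro entire_mult entire_const e)
  show "entire (\<lambda>z. cnj (S (rep_kernel \<alpha> z) w))" using assms by (simp add: admissible_def)
qed

lemma kernel_op_in_fock:
  fixes Q :: "complex^'n \<Rightarrow> complex^'n \<Rightarrow> complex"
  assumes "fock_kernel \<alpha> c e Q" "0 < \<alpha>" "0 < c" "0 < s" "f \<in> fock \<alpha> s"
  shows "kernel_op \<alpha> Q f \<in> fock \<alpha> s"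
proof -
  obtain C where "0 < C" and C: "\<And>Q e (f :: complex^'n \<Rightarrow> complex). fock_kernel \<alpha> c e Q \<Longrightarrow> f \<in> fock \<alpha> s \<Longrightarrow>
      kernel_op \<alpha> Q f \<in> fock \<alpha> s \<and>
      (LINT w|lborel. wabs \<alpha> (kernel_op \<alpha> Q f) w powr s) \<le> C * (LINT z|lborel. (wabs \<alpha> f z * e z) powr s)"
    using kernel_op_power_bound[OF assms(2-4)] by blast
  show ?thesis using C[OF assms(1,5)] by blast
qed

lemma extends_to_kernel_op:
  fixes S :: "'n::finite operator"
  assumes S: "admissible \<alpha> S" and Q: "fock_kernel \<alpha> c e (\<lambda>w z. S (rep_kernel \<alpha> z) w)"
    and \<alpha>: "0 < \<alpha>" and c: "0 < c" and s: "0 < s"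
  shows "extends_to \<alpha> s S (kernel_op \<alpha> (\<lambda>w z. S (rep_kernel \<alpha> z) w))"
  unfolding extends_to_def
proof (intro conjI ballI)
  let ?T = "kernel_op \<alpha> (\<lambda>w z. S (rep_kernel \<alpha> z) w)"
  show "?T ` fock \<alpha> s \<subseteq> fock \<alpha> s"
    using kernel_op_in_fock[OF Q \<alpha> c s] by blast
  show "clinear_on (fock \<alpha> s) ?T"
    by (rule kernel_op_clinear[OF Q c]) (rule subsetI, rule fock_subset_infty[OF \<alpha> s])
  have lin: "clinear_on (fock_infty \<alpha>) ?T" by (intro kernel_op_clinear[OF Q c]) simp
  have Tk: "?T (norm_kernel \<alpha> z) = S (norm_kernel \<alpha> z)" for z
  proof
    fix w
    have "?T (rep_kernel \<alpha> z) = (\<lambda>w. of_real (exp (\<alpha> / 2 * (norm z)\<^sup>2)) * ?T (norm_kernel \<alpha> z) w)"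
      unfolding rep_kernel_eq[of \<alpha> z]
      using \<alpha> by (intro clinear_on_scale[OF lin] norm_kernel_in_infty) simp
    then show "?T (norm_kernel \<alpha> z) w = S (norm_kernel \<alpha> z) w"
      using kernel_op_at_rep_kernel[OF Q \<alpha> c, of z w] admissible_facts(5)[OF S, of z] by simp
  qed
  fix f :: "complex^'n \<Rightarrow> complex" assume "f \<in> kernel_span \<alpha>"
  then obtain A a where A: "finite A" and f: "f = (\<lambda>w. \<Sum>z\<in>A. a z * norm_kernel \<alpha> z w)"
    by (auto simp: kernel_span_def)
  have "S f = (\<lambda>w. \<Sum>z\<in>A. a z * S (norm_kernel \<alpha> z) w)"
    unfolding f
    by (rule clinear_on_kernel_sum[where V = "kernel_span \<alpha>"])
       (use S A in \<open>auto simp: admissible_def kernel_span_def\<close>)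
  moreover have "?T f = (\<lambda>w. \<Sum>z\<in>A. a z * ?T (norm_kernel \<alpha> z) w)"
    unfolding f
    by (rule clinear_on_kernel_sum[OF lin kernel_sum_in_infty A]) (use \<alpha> in auto)
  ultimately show "?T f = S f" by (simp add: Tk)
qed

text \<open>Here \<open>\<beta> = \<alpha>\<sigma>/p\<close>, so that the integrand of the local integral is the \<open>p\<close>-th power of \<open>wabs \<beta> h\<close> for the entire
  function \<open>h = S\<^sub>z 1\<close>. Point evaluation of \<open>h\<close> at \<open>z - w\<close> gives the bound, and the two Gaussian rates differ
  by \<open>(\<alpha> - \<beta>)/2 = \<alpha>(p - \<sigma>)/(2p)\<close>.\<close>

lemma norm_kernel_image_estimate:
  fixes \<alpha> \<sigma> p :: real
  assumes \<alpha>: "0 < \<alpha>" and \<sigma>: "0 < \<sigma>" and p: "\<sigma> < p"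
  obtains C where "0 < C" "\<And>(S :: 'n::finite operator) z w. admissible \<alpha> S \<Longrightarrow> local_integral \<alpha> p \<sigma> S z < \<infinity> \<Longrightarrow>
    wabs \<alpha> (S (norm_kernel \<alpha> z)) w \<le> C * enn2real (local_integral \<alpha> p \<sigma> S z) powr (1 / p)
      * exp (- (\<alpha> * (p - \<sigma>) / (2 * p)) * (norm (w - z))\<^sup>2)"
proof -
  define \<beta> where "\<beta> = \<alpha> * \<sigma> / p"
  have p0: "0 < p" and \<beta>: "0 \<le> \<beta>" using assms by (auto simp: \<beta>_def)
  obtain C where C: "0 < C" "\<And>(f :: complex^'n \<Rightarrow> complex) u. entire f \<Longrightarrow>
    ennreal (wabs \<beta> f u powr p) \<le> ennreal C * (\<integral>\<^sup>+v. ennreal (wabs \<beta> f v powr p) \<partial>lborel)"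
    using weighted_point_evaluation[OF p0 \<beta>] by blast
  have "wabs \<alpha> (S (norm_kernel \<alpha> z)) w \<le> C powr (1 / p) * enn2real (local_integral \<alpha> p \<sigma> S z) powr (1 / p)
      * exp (- (\<alpha> * (p - \<sigma>) / (2 * p)) * (norm (w - z))\<^sup>2)"
    if S: "admissible \<alpha> S" and fin: "local_integral \<alpha> p \<sigma> S z < \<infinity>" for S :: "'n operator" and z w
  proof -
    define L where "L = enn2real (local_integral \<alpha> p \<sigma> S z)"
    have L: "local_integral \<alpha> p \<sigma> S z = ennreal L" "0 \<le> L"
      using fin by (auto simp: L_def less_top)
    define h where "h = (\<lambda>u. norm_kernel \<alpha> z u * S (norm_kernel \<alpha> z) (z - u))"
    have h: "entire h" unfolding h_def
      by (intro entire_mult entire_norm_kernel entire_reflect admissible_facts[OF S])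
    have hw: "norm (h u) powr p * exp (- (\<alpha> * \<sigma> / 2) * (norm u)\<^sup>2) = wabs \<beta> h u powr p" for u
      using p0 by (simp add: wabs_def powr_mult exp_powr_real \<beta>_def field_simps)
    have "local_integral \<alpha> p \<sigma> S z = (\<integral>\<^sup>+v. ennreal (wabs \<beta> h v powr p) \<partial>lborel)"
      unfolding local_integral_def conj_op_one hw[symmetric] by (simp add: h_def)
    then have "ennreal (wabs \<beta> h (z - w) powr p) \<le> ennreal (C * L)"
      using C(2)[OF h, of "z - w"] C(1) L by (simp add: ennreal_mult)
    then have "wabs \<beta> h (z - w) powr p \<le> C * L"
      using C(1) L(2) by (subst (asm) ennreal_le_iff) auto
    then have "(wabs \<beta> h (z - w) powr p) powr (1 / p) \<le> (C * L) powr (1 / p)"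
      using p0 by (intro powr_mono2) auto
    then have 1: "wabs \<beta> h (z - w) \<le> C powr (1 / p) * L powr (1 / p)"
      using p0 C(1) L(2) by (simp add: powr_powr powr_mult)
    let ?a = "norm (z - w)"
    have "wabs \<beta> h (z - w) * exp (- (\<alpha> * (p - \<sigma>) / (2 * p)) * (norm (w - z))\<^sup>2)
      = norm (S (norm_kernel \<alpha> z) w) * (exp (\<alpha> / 2 * ?a\<^sup>2 - \<alpha> / 2 * (norm w)\<^sup>2)
          * exp (- (\<beta> / 2) * ?a\<^sup>2) * exp (- (\<alpha> * (p - \<sigma>) / (2 * p)) * ?a\<^sup>2))"
      by (simp add: wabs_def h_def norm_mult norm_norm_kernel norm_minus_commute[of w z])
    also have "exp (\<alpha> / 2 * ?a\<^sup>2 - \<alpha> / 2 * (norm w)\<^sup>2) * exp (- (\<beta> / 2) * ?a\<^sup>2)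
        * exp (- (\<alpha> * (p - \<sigma>) / (2 * p)) * ?a\<^sup>2) = exp (- (\<alpha> / 2) * (norm w)\<^sup>2)"
      unfolding exp_add[symmetric] using p0 by (simp add: \<beta>_def field_simps)
    also have "norm (S (norm_kernel \<alpha> z) w) * exp (- (\<alpha> / 2) * (norm w)\<^sup>2) = wabs \<alpha> (S (norm_kernel \<alpha> z)) w"
      by (simp only: wabs_def)
    finally show ?thesis
      using mult_right_mono[OF 1, of "exp (- (\<alpha> * (p - \<sigma>) / (2 * p)) * (norm (w - z))\<^sup>2)"] by (simp add: L_def)
  qed
  then show ?thesis using C(1) by (intro that[of "C powr (1 / p)"]) auto
qed

lemma fock_kernel_of_operator:
  fixes S :: "'n::finite operator"
  assumes S: "admissible \<alpha> S" and e: "e \<in> borel_measurable borel" "\<And>z. 0 \<le> e z" "\<And>z. e z \<le> E"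
    and bound: "\<And>z w. wabs \<alpha> (S (norm_kernel \<alpha> z)) w \<le> e z * exp (- c * (norm (w - z))\<^sup>2)"
  shows "fock_kernel \<alpha> c e (\<lambda>w z. S (rep_kernel \<alpha> z) w)"
  unfolding fock_kernel_def
proof (intro conjI allI)
  show "\<exists>E. \<forall>z. 0 \<le> e z \<and> e z \<le> E" using e by blast
  fix w z
  have "norm (S (rep_kernel \<alpha> z) w) = exp (\<alpha> / 2 * (norm z)\<^sup>2) * (wabs \<alpha> (S (norm_kernel \<alpha> z)) w * exp (\<alpha> / 2 * (norm w)\<^sup>2))"
    unfolding admissible_facts(5)[OF S] norm_mult by (simp add: norm_eq_wabs[of _ w \<alpha>])
  also have "\<dots> \<le> exp (\<alpha> / 2 * (norm z)\<^sup>2) * (e z * exp (- c * (norm (w - z))\<^sup>2) * exp (\<alpha> / 2 * (norm w)\<^sup>2))"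
    by (intro mult_left_mono mult_right_mono bound) auto
  also have "\<dots> = e z * (exp (\<alpha> / 2 * (norm z)\<^sup>2) * exp (- c * (norm (w - z))\<^sup>2) * exp (\<alpha> / 2 * (norm w)\<^sup>2))"
    by (simp only: mult_ac)
  also have "exp (\<alpha> / 2 * (norm z)\<^sup>2) * exp (- c * (norm (w - z))\<^sup>2) * exp (\<alpha> / 2 * (norm w)\<^sup>2)
      = exp (\<alpha> / 2 * (norm w)\<^sup>2 + \<alpha> / 2 * (norm z)\<^sup>2 - c * (norm (w - z))\<^sup>2)"
    by (simp add: algebra_simps flip: exp_add)
  finally show "norm (S (rep_kernel \<alpha> z) w) \<le> e z * exp (\<alpha> / 2 * (norm w)\<^sup>2 + \<alpha> / 2 * (norm z)\<^sup>2 - c * (norm (w - z))\<^sup>2)" .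
qed (use admissible_facts[OF S] e(1) in auto)

section \<open>The metric of the Fock spaces\<close>

definition fock_int :: "real \<Rightarrow> real \<Rightarrow> (complex^'n \<Rightarrow> complex) \<Rightarrow> real" where
  "fock_int \<alpha> s f = (LINT z|lborel. wabs \<alpha> f z powr s)"

lemma fock_int_nonneg [simp]: "0 \<le> fock_int \<alpha> s f"
  unfolding fock_int_def by (rule Bochner_Integration.integral_nonneg) simp

lemma fock_norm_int: "fock_norm \<alpha> s f = fock_int \<alpha> s f powr (1 / s)"
  by (simp only: fock_norm_eq fock_int_def)

lemma fock_uniform_bound:
  assumes \<alpha>: "0 < \<alpha>" and s: "0 < s"
  obtains G where "\<And>(f :: complex^'n \<Rightarrow> complex) z. f \<in> fock \<alpha> s \<Longrightarrow> fock_int \<alpha> s f \<le> B \<Longrightarrow> wabs \<alpha> f z \<le> G"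
proof -
  obtain C where C0: "0 < C" and C: "\<And>(f :: complex^'n \<Rightarrow> complex) z. f \<in> fock \<alpha> s \<Longrightarrow> wabs \<alpha> f z \<le> C * fock_norm \<alpha> s f"
    using fock_bound[OF \<alpha> s] by blast
  have "wabs \<alpha> f z \<le> C * B powr (1 / s)"
    if f: "f \<in> fock \<alpha> s" and B: "fock_int \<alpha> s f \<le> B" for f :: "complex^'n \<Rightarrow> complex" and z
  proof -
    have "fock_norm \<alpha> s f \<le> B powr (1 / s)"
      unfolding fock_norm_int using B s by (intro powr_mono2) auto
    then show ?thesis
      using C[OF f, of z] C0 by (meson mult_left_mono less_imp_le order_trans)
  qed
  then show ?thesis by (rule that)
qed

lemma fock_dist_int:
  assumes "0 < s"
  shows "fock_dist \<alpha> s f g = (if s < 1 then fock_int \<alpha> s (\<lambda>z. f z - g z) else fock_int \<alpha> s (\<lambda>z. f z - g z) powr (1 / s))"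
  using assms by (simp add: fock_dist_def fock_norm_int powr_powr)

lemma fock_scale:
  assumes "f \<in> fock \<alpha> s"
  shows "(\<lambda>z. c * f z) \<in> fock \<alpha> s" "fock_int \<alpha> s (\<lambda>z. c * f z) = norm c powr s * fock_int \<alpha> s f"
  using assms by (simp_all add: fock_iff fock_int_def wabs_scale powr_mult entire_mult entire_const)

lemma powr_add_le:
  fixes a b s :: real
  assumes "0 \<le> a" "0 \<le> b" "0 < s"
  shows "(a + b) powr s \<le> 2 powr s * (a powr s + b powr s)"
proof -
  have "(a + b) powr s \<le> (2 * max a b) powr s"
    using assms by (intro powr_mono2) auto
  also have "\<dots> = 2 powr s * max a b powr s" using assms by (simp add: powr_mult)
  also have "\<dots> \<le> 2 powr s * (a powr s + b powr s)"
    by (intro mult_left_mono) (auto simp: max_def)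
  finally show ?thesis .
qed

lemma powr_subadditive:
  fixes a b s :: real
  assumes "0 \<le> a" "0 \<le> b" "0 < s" "s \<le> 1"
  shows "(a + b) powr s \<le> a powr s + b powr s"
proof (cases "a + b = 0")
  case True then show ?thesis using assms by (simp add: add_nonneg_eq_0_iff)
next
  case False
  then have ab: "0 < a + b" using assms by linarith
  have *: "x \<le> x powr s" if "0 \<le> x" "x \<le> 1" for x :: real
  proof (cases "x = 0")
    case False
    then show ?thesis using powr_mono'[of s 1 x] that assms by simp
  qed simp
  have "a / (a + b) \<le> (a / (a + b)) powr s" "b / (a + b) \<le> (b / (a + b)) powr s"
    using assms ab by (auto intro!: *)
  then have "a / (a + b) + b / (a + b) \<le> (a powr s + b powr s) / (a + b) powr s"
    using assms ab by (simp add: powr_divide add_divide_distrib)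
  moreover have "a / (a + b) + b / (a + b) = 1"
    using ab by (simp flip: add_divide_distrib)
  ultimately show ?thesis using ab by (simp add: pos_le_divide_eq)
qed

lemma fock_add:
  assumes s: "0 < s" and f: "f \<in> fock \<alpha> s" and g: "g \<in> fock \<alpha> s"
  shows "(\<lambda>z. f z + g z) \<in> fock \<alpha> s"
    and "fock_int \<alpha> s (\<lambda>z. f z + g z) \<le> 2 powr s * (fock_int \<alpha> s f + fock_int \<alpha> s g)"
proof -
  have ent: "entire (\<lambda>z. f z + g z)" and int: "integrable lborel (\<lambda>z. wabs \<alpha> f z powr s)" "integrable lborel (\<lambda>z. wabs \<alpha> g z powr s)"
    using f g by (auto simp: fock_iff intro: entire_add)
  have le: "wabs \<alpha> (\<lambda>z. f z + g z) z powr s \<le> 2 powr s * (wabs \<alpha> f z powr s + wabs \<alpha> g z powr s)" for z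
    using s by (intro order_trans[OF powr_mono2[OF _ _ wabs_add] powr_add_le]) auto
  have int_bound: "integrable lborel (\<lambda>z. 2 powr s * (wabs \<alpha> f z powr s + wabs \<alpha> g z powr s))"
    using int by (intro integrable_mult_right Bochner_Integration.integrable_add)
  have int_sum: "integrable lborel (\<lambda>z. wabs \<alpha> (\<lambda>z. f z + g z) z powr s)"
  proof (rule Bochner_Integration.integrable_bound[OF int_bound])
    show "(\<lambda>z. wabs \<alpha> (\<lambda>z. f z + g z) z powr s) \<in> borel_measurable lborel"
      using wabs_measurable[OF ent, measurable] by measurable
    show "AE z in lborel. norm (wabs \<alpha> (\<lambda>z. f z + g z) z powr s) \<le> norm (2 powr s * (wabs \<alpha> f z powr s + wabs \<alpha> g z powr s))"
      using le by (intro AE_I2) simp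
  qed
  then show "(\<lambda>z. f z + g z) \<in> fock \<alpha> s" using ent by (simp add: fock_iff)
  have "fock_int \<alpha> s (\<lambda>z. f z + g z) \<le> (LINT z|lborel. 2 powr s * (wabs \<alpha> f z powr s + wabs \<alpha> g z powr s))"
    unfolding fock_int_def by (rule integral_mono[OF int_sum int_bound le])
  also have "\<dots> = 2 powr s * (fock_int \<alpha> s f + fock_int \<alpha> s g)"
    by (simp only: fock_int_def integral_mult_right_zero Bochner_Integration.integral_add[OF int])
  finally show "fock_int \<alpha> s (\<lambda>z. f z + g z) \<le> 2 powr s * (fock_int \<alpha> s f + fock_int \<alpha> s g)" .
qed

lemma fock_diff:
  assumes s: "0 < s" and f: "f \<in> fock \<alpha> s" and g: "g \<in> fock \<alpha> s"
  shows "(\<lambda>z. f z - g z) \<in> fock \<alpha> s"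
    and "fock_int \<alpha> s (\<lambda>z. f z - g z) \<le> 2 powr s * (fock_int \<alpha> s f + fock_int \<alpha> s g)"
  using fock_add[OF s f fock_scale(1)[OF g, of "- 1"]] fock_scale(2)[OF g, of "- 1"] by simp_all

lemma fock_int_zero:
  fixes f :: "complex^'n \<Rightarrow> complex"
  assumes "0 < \<alpha>" "0 < s" "f \<in> fock \<alpha> s" "fock_int \<alpha> s f = 0"
  shows "f = (\<lambda>_. 0)"
proof
  fix z
  obtain C where "0 < C" and C: "\<And>(f :: complex^'n \<Rightarrow> complex) z. f \<in> fock \<alpha> s \<Longrightarrow> wabs \<alpha> f z \<le> C * fock_norm \<alpha> s f"
    using fock_bound[OF assms(1,2)] by blast
  have "wabs \<alpha> f z = 0"
    using C[OF assms(3), of z] wabs_nonneg[of \<alpha> f z] by (simp add: fock_norm_int assms(4))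
  then show "f z = 0" by (simp add: wabs_def)
qed

lemma powr_convex_combination:
  fixes l m s x y :: real
  assumes "0 \<le> l" "0 \<le> m" "l + m = 1" "0 \<le> x" "0 \<le> y" "1 \<le> s"
  shows "(l * x + m * y) powr s \<le> l * x powr s + m * y powr s"
proof -
  define a where "a = l * x + m * y"
  have "0 \<le> a" using assms by (simp add: a_def)
  show ?thesis
  proof (cases "a = 0")
    case True
    then show ?thesis using assms by (simp add: a_def[symmetric])
  next
    case False
    with \<open>0 \<le> a\<close> have a: "0 < a" by simp
    have m1: "m = 1 - l" using assms by simp
    have "l * (a powr s + s * a powr (s - 1) * (x - a)) + m * (a powr s + s * a powr (s - 1) * (y - a))
      \<le> l * x powr s + m * y powr s"
      using assms a by (intro add_mono mult_left_mono powr_above_tangent)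
    moreover have "l * (a powr s + s * a powr (s - 1) * (x - a)) + m * (a powr s + s * a powr (s - 1) * (y - a))
      = (l + m) * a powr s + s * a powr (s - 1) * (l * x + m * y - (l + m) * a)"
      by (simp add: algebra_simps)
    moreover have "\<dots> = a powr s" using assms(3) by (simp add: a_def)
    ultimately show ?thesis by (simp add: a_def)
  qed
qed

text \<open>Minkowski's inequality, from convexity of the \<open>s\<close>-th power applied to the normalised functions
  \<open>f/a\<close> and \<open>g/b\<close>, where \<open>a\<close> and \<open>b\<close> are the norms of \<open>f\<close> and \<open>g\<close>.\<close>

lemma fock_norm_triangle:
  fixes f g :: "complex^'n \<Rightarrow> complex"
  assumes \<alpha>: "0 < \<alpha>" and s: "1 \<le> s" and f: "f \<in> fock \<alpha> s" and g: "g \<in> fock \<alpha> s"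
  shows "fock_norm \<alpha> s (\<lambda>z. f z + g z) \<le> fock_norm \<alpha> s f + fock_norm \<alpha> s g"
proof (cases "fock_int \<alpha> s f = 0 \<or> fock_int \<alpha> s g = 0")
  case True
  then show ?thesis
  proof
    assume "fock_int \<alpha> s f = 0"
    with fock_int_zero[OF \<alpha> _ f] s show ?thesis by (simp add: fock_norm_int)
  next
    assume "fock_int \<alpha> s g = 0"
    with fock_int_zero[OF \<alpha> _ g] s show ?thesis by (simp add: fock_norm_int)
  qed
next
  case False
  have s0: "0 < s" using s by simp
  define a where "a = fock_norm \<alpha> s f"
  define b where "b = fock_norm \<alpha> s g"
  have F: "0 < fock_int \<alpha> s f" "0 < fock_int \<alpha> s g"
    using False fock_int_nonneg[of \<alpha> s f] fock_int_nonneg[of \<alpha> s g] by linarith+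
  then have ab: "0 < a" "0 < b" by (simp_all add: a_def b_def fock_norm_int)
  have as: "a powr s = fock_int \<alpha> s f" "b powr s = fock_int \<alpha> s g"
    using s0 F by (simp_all add: a_def b_def fock_norm_int powr_powr)
  have int: "integrable lborel (\<lambda>z. wabs \<alpha> f z powr s)" "integrable lborel (\<lambda>z. wabs \<alpha> g z powr s)"
    "integrable lborel (\<lambda>z. wabs \<alpha> (\<lambda>z. f z + g z) z powr s)"
    using f g fock_add(1)[OF s0 f g] by (auto simp: fock_iff)
  let ?l = "a / (a + b)" and ?m = "b / (a + b)"
  let ?R = "\<lambda>z. (a + b) powr s * (?l / a powr s * wabs \<alpha> f z powr s + ?m / b powr s * wabs \<alpha> g z powr s)"
  have "wabs \<alpha> (\<lambda>z. f z + g z) z powr s \<le> ?R z" for z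
  proof -
    have "wabs \<alpha> (\<lambda>z. f z + g z) z powr s \<le> (wabs \<alpha> f z + wabs \<alpha> g z) powr s"
      using s0 by (intro powr_mono2 wabs_add) auto
    also have "wabs \<alpha> f z + wabs \<alpha> g z = (a + b) * (?l * (wabs \<alpha> f z / a) + ?m * (wabs \<alpha> g z / b))"
    proof -
      have "?l * (wabs \<alpha> f z / a) = wabs \<alpha> f z / (a + b)" "?m * (wabs \<alpha> g z / b) = wabs \<alpha> g z / (a + b)"
        using ab by simp_all
      then show ?thesis using ab by (simp flip: add_divide_distrib)
    qed
    also have "\<dots> powr s = (a + b) powr s * (?l * (wabs \<alpha> f z / a) + ?m * (wabs \<alpha> g z / b)) powr s"
      by (rule powr_mult)
    also have "\<dots> \<le> (a + b) powr s * (?l * (wabs \<alpha> f z / a) powr s + ?m * (wabs \<alpha> g z / b) powr s)"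
      using ab s by (intro mult_left_mono powr_convex_combination) (auto simp flip: add_divide_distrib)
    finally show ?thesis using ab by (simp add: powr_divide)
  qed
  then have "fock_int \<alpha> s (\<lambda>z. f z + g z) \<le> (LINT z|lborel. ?R z)"
    unfolding fock_int_def using int
    by (intro integral_mono integrable_mult_right Bochner_Integration.integrable_add) auto
  also have "\<dots> = (a + b) powr s * (?l / a powr s * fock_int \<alpha> s f + ?m / b powr s * fock_int \<alpha> s g)"
    using int by (simp add: fock_int_def)
  also have "\<dots> = (a + b) powr s"
    using ab F by (simp add: as flip: add_divide_distrib)
  finally have "fock_int \<alpha> s (\<lambda>z. f z + g z) powr (1 / s) \<le> ((a + b) powr s) powr (1 / s)"
    using s0 by (intro powr_mono2) auto
  also have "\<dots> = a + b" using s0 ab by (simp add: powr_powr)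
  finally show ?thesis by (simp add: a_def b_def fock_norm_int)
qed

lemma fock_metric_space:
  assumes \<alpha>: "0 < \<alpha>" and s: "0 < s"
  shows "Metric_space (fock \<alpha> s :: (complex^'n \<Rightarrow> complex) set) (fock_dist \<alpha> s)"
proof
  fix f g h :: "complex^'n \<Rightarrow> complex"
  show "0 \<le> fock_dist \<alpha> s f g" using s by (simp add: fock_dist_int)
  show "fock_dist \<alpha> s f g = fock_dist \<alpha> s g f"
  proof -
    have "wabs \<alpha> (\<lambda>z. f z - g z) z = wabs \<alpha> (\<lambda>z. g z - f z) z" for z
      by (simp add: wabs_def norm_minus_commute)
    then show ?thesis using s by (simp add: fock_dist_int fock_int_def)
  qed
  assume f: "f \<in> fock \<alpha> s" and g: "g \<in> fock \<alpha> s"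
  show "fock_dist \<alpha> s f g = 0 \<longleftrightarrow> f = g"
  proof
    assume "fock_dist \<alpha> s f g = 0"
    then have "fock_int \<alpha> s (\<lambda>z. f z - g z) = 0" using s by (simp add: fock_dist_int split: if_splits)
    from fock_int_zero[OF \<alpha> s fock_diff(1)[OF s f g] this] have "f z - g z = 0" for z by metis
    then show "f = g" by auto
  qed (use s in \<open>simp add: fock_dist_int fock_int_def wabs_def\<close>)
  assume h: "h \<in> fock \<alpha> s"
  have d: "(\<lambda>z. f z - g z) \<in> fock \<alpha> s" "(\<lambda>z. g z - h z) \<in> fock \<alpha> s"
    using fock_diff(1)[OF s f g] fock_diff(1)[OF s g h] by auto
  have eq: "(\<lambda>z. (f z - g z) + (g z - h z)) = (\<lambda>z. f z - h z)" by simp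
  show "fock_dist \<alpha> s f h \<le> fock_dist \<alpha> s f g + fock_dist \<alpha> s g h"
  proof (cases "s < 1")
    case False
    then show ?thesis
      using fock_norm_triangle[OF \<alpha> _ d] unfolding eq by (simp add: fock_dist_def)
  next
    case True
    have int: "integrable lborel (\<lambda>z. wabs \<alpha> (\<lambda>z. f z - g z) z powr s)"
      "integrable lborel (\<lambda>z. wabs \<alpha> (\<lambda>z. g z - h z) z powr s)"
      "integrable lborel (\<lambda>z. wabs \<alpha> (\<lambda>z. f z - h z) z powr s)"
      using d fock_add(1)[OF s d] unfolding eq by (auto simp: fock_iff)
    have "wabs \<alpha> (\<lambda>z. f z - h z) z powr s \<le> wabs \<alpha> (\<lambda>z. f z - g z) z powr s + wabs \<alpha> (\<lambda>z. g z - h z) z powr s" for z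
      using s True wabs_add[of \<alpha> "\<lambda>z. f z - g z" "\<lambda>z. g z - h z" z] unfolding eq
      by (intro order_trans[OF powr_mono2 powr_subadditive]) auto
    then have "fock_int \<alpha> s (\<lambda>z. f z - h z) \<le> (LINT z|lborel. wabs \<alpha> (\<lambda>z. f z - g z) z powr s + wabs \<alpha> (\<lambda>z. g z - h z) z powr s)"
      unfolding fock_int_def using int by (intro integral_mono Bochner_Integration.integrable_add)
    also have "\<dots> = fock_int \<alpha> s (\<lambda>z. f z - g z) + fock_int \<alpha> s (\<lambda>z. g z - h z)"
      unfolding fock_int_def using int by (intro Bochner_Integration.integral_add)
    finally show ?thesis using True s by (simp add: fock_dist_int)
  qed
qed

section \<open>Pointwise limits and compactness\<close>

text \<open>The limit is entire because it equals its own reproducing integral, by dominated convergence; the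
  bound for its norm is Fatou's lemma.\<close>

lemma fock_pointwise_limit:
  fixes f :: "nat \<Rightarrow> complex^'n \<Rightarrow> complex"
  assumes \<alpha>: "0 < \<alpha>" and s: "0 < s" and f: "\<And>n. f n \<in> fock \<alpha> s" and B: "\<And>n. fock_int \<alpha> s (f n) \<le> B"
    and lim: "\<And>z. (\<lambda>n. f n z) \<longlonglongrightarrow> g z"
  shows "g \<in> fock \<alpha> s" "fock_int \<alpha> s g \<le> B"
proof -
  have ent: "entire (f n)" for n using f by (simp add: fock_iff)
  have fi: "f n \<in> fock_infty \<alpha>" for n using fock_subset_infty[OF \<alpha> s f] .
  have B0: "0 \<le> B" using B[of 0] fock_int_nonneg[of \<alpha> s "f 0"] by linarith
  obtain G where G': "\<And>(f :: complex^'n \<Rightarrow> complex) z. f \<in> fock \<alpha> s \<Longrightarrow> fock_int \<alpha> s f \<le> B \<Longrightarrow> wabs \<alpha> f z \<le> G"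
    using fock_uniform_bound[OF \<alpha> s, of B] by blast
  have G: "wabs \<alpha> (f n) z \<le> G" for n z by (rule G'[OF f B])
  have limw: "(\<lambda>n. wabs \<alpha> (f n) z) \<longlonglongrightarrow> wabs \<alpha> g z" for z
    unfolding wabs_def by (intro tendsto_intros lim)
  have Gg: "wabs \<alpha> g z \<le> G" for z
    using limw[of z] G by (intro LIMSEQ_le_const2) auto
  have gm: "g \<in> borel_measurable borel"
    by (rule borel_measurable_LIMSEQ_metric[OF entire_measurable[OF ent] lim])
  let ?Q = "\<lambda>w z :: complex^'n. rep_kernel \<alpha> z w"
  have a2: "0 < \<alpha> / 2" using \<alpha> by simp
  have "kernel_op \<alpha> ?Q g w = g w" for w
  proof -
    let ?H = "\<lambda>h z. h z * rep_kernel \<alpha> z w * of_real (exp (- \<alpha> * (norm z)\<^sup>2))"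
    have "(\<lambda>n. LINT z|lborel. ?H (f n) z) \<longlonglongrightarrow> (LINT z|lborel. ?H g z)"
    proof (rule integral_dominated_convergence)
      show "?H g \<in> borel_measurable lborel" "?H (f n) \<in> borel_measurable lborel" for n
        using kernel_integrand_measurable[OF fock_kernel_identity gm] kernel_integrand_measurable[OF fock_kernel_identity entire_measurable[OF ent]]
        by simp_all
      show "integrable lborel (\<lambda>z. exp (\<alpha> / 2 * (norm w)\<^sup>2) * (exp (- (\<alpha> / 2) * (norm (w - z))\<^sup>2) * G))"
        using gaussian_translate(1)[OF a2] by (intro integrable_mult_right integrable_mult_left)
      show "AE z in lborel. (\<lambda>n. ?H (f n) z) \<longlonglongrightarrow> ?H g z"
        by (intro AE_I2 tendsto_intros lim)
      show "AE z in lborel. norm (?H (f n) z) \<le> exp (\<alpha> / 2 * (norm w)\<^sup>2) * (exp (- (\<alpha> / 2) * (norm (w - z))\<^sup>2) * G)" for n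
      proof (intro AE_I2)
        fix z
        show "norm (?H (f n) z) \<le> exp (\<alpha> / 2 * (norm w)\<^sup>2) * (exp (- (\<alpha> / 2) * (norm (w - z))\<^sup>2) * G)"
          using kernel_integrand_bound[OF fock_kernel_identity, where f = "f n" and z = z and w = w and \<alpha> = \<alpha>] G[of n z]
          by (elim order_trans) (intro mult_left_mono, auto)
      qed
    qed
    then have "(\<lambda>n. kernel_op \<alpha> ?Q (f n) w) \<longlonglongrightarrow> kernel_op \<alpha> ?Q g w"
      unfolding kernel_op_def using gauss_pos[OF \<alpha>, where 'n = 'n] by (intro tendsto_divide tendsto_const) auto
    then have "(\<lambda>n. f n w) \<longlonglongrightarrow> kernel_op \<alpha> ?Q g w"
      by (simp add: kernel_op_identity[OF \<alpha> fi])
    then show ?thesis using lim[of w] by (rule LIMSEQ_unique)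
  qed
  then have "kernel_op \<alpha> ?Q g = g" by (rule ext)
  with entire_kernel_op[OF fock_kernel_identity \<alpha> a2 gm Gg] have entg: "entire g" by simp
  note wabs_measurable[OF entg, measurable] wabs_measurable[OF ent, measurable]
  have limp: "(\<lambda>n. ennreal (wabs \<alpha> (f n) z powr s)) \<longlonglongrightarrow> ennreal (wabs \<alpha> g z powr s)" for z
    using s by (intro tendsto_ennrealI tendsto_powr' limw tendsto_const) auto
  have "(\<integral>\<^sup>+z. ennreal (wabs \<alpha> g z powr s) \<partial>lborel) = (\<integral>\<^sup>+z. liminf (\<lambda>n. ennreal (wabs \<alpha> (f n) z powr s)) \<partial>lborel)"
    by (intro nn_integral_cong lim_imp_Liminf[symmetric] limp) simp
  also have "\<dots> \<le> liminf (\<lambda>n. \<integral>\<^sup>+z. ennreal (wabs \<alpha> (f n) z powr s) \<partial>lborel)"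
    by (rule nn_integral_liminf) measurable
  also have "\<dots> \<le> ennreal B"
  proof (intro Liminf_le always_eventually allI)
    fix n
    have "(\<integral>\<^sup>+z. ennreal (wabs \<alpha> (f n) z powr s) \<partial>lborel) = ennreal (fock_int \<alpha> s (f n))"
      unfolding fock_int_def using f[of n] by (intro nn_integral_eq_integral) (auto simp: fock_iff)
    also have "\<dots> \<le> ennreal B" using B by (rule ennreal_leI)
    finally show "(\<integral>\<^sup>+z. ennreal (wabs \<alpha> (f n) z powr s) \<partial>lborel) \<le> ennreal B" .
  qed simp
  finally have nn: "(\<integral>\<^sup>+z. ennreal (wabs \<alpha> g z powr s) \<partial>lborel) \<le> ennreal B" .
  have int: "integrable lborel (\<lambda>z. wabs \<alpha> g z powr s)"
  proof (rule integrableI_bounded)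
    show "(\<integral>\<^sup>+z. ennreal (norm (wabs \<alpha> g z powr s)) \<partial>lborel) < \<infinity>"
      using nn by (simp add: le_less_trans[OF _ ennreal_less_top])
  qed measurable
  then show "g \<in> fock \<alpha> s" using entg by (simp add: fock_iff)
  have "ennreal (fock_int \<alpha> s g) \<le> ennreal B"
    unfolding fock_int_def using nn by (subst nn_integral_eq_integral[symmetric, OF int]) auto
  then show "fock_int \<alpha> s g \<le> B" using B0 by (subst (asm) ennreal_le_iff)
qed

text \<open>A diagonal sequence converges on a countable dense set. The weighted bound and the Cauchy estimates
  make the functions Lipschitz near each point with a common constant, which carries
  convergence over to all points.\<close>

lemma fock_pointwise_subsequence:
  fixes f :: "nat \<Rightarrow> complex^'n \<Rightarrow> complex"
  assumes \<alpha>: "0 < \<alpha>" and s: "0 < s" and f: "\<And>n. f n \<in> fock \<alpha> s" and B: "\<And>n. fock_int \<alpha> s (f n) \<le> B"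
  obtains r g where "strict_mono (r :: nat \<Rightarrow> nat)" "\<And>z. (\<lambda>n. f (r n) z) \<longlonglongrightarrow> g z"
proof -
  have ent: "entire (f n)" for n using f by (simp add: fock_iff)
  obtain G where G': "\<And>(f :: complex^'n \<Rightarrow> complex) z. f \<in> fock \<alpha> s \<Longrightarrow> fock_int \<alpha> s f \<le> B \<Longrightarrow> wabs \<alpha> f z \<le> G"
    using fock_uniform_bound[OF \<alpha> s, of B] by blast
  have G: "wabs \<alpha> (f n) z \<le> G" for n z by (rule G'[OF f B])
  have G0: "0 \<le> G" using G[of 0 0] wabs_nonneg[of \<alpha> "f 0" 0] by linarith
  obtain D :: "(complex^'n) set" where D: "countable D" "\<And>X. open X \<Longrightarrow> X \<noteq> {} \<Longrightarrow> \<exists>d\<in>D. d \<in> X"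
    by (rule countable_dense_setE) blast
  let ?u = "\<lambda>n z. f n z * of_real (exp (- (\<alpha> / 2) * (norm z)\<^sup>2))"
  have "norm (?u n z) \<le> G" for n z using G[of n z] by (simp only: norm_weighted)
  then obtain r where r: "strict_mono (r :: nat \<Rightarrow> nat)" and conv: "\<And>z. z \<in> D \<Longrightarrow> \<exists>l. (\<lambda>n. ?u (r n) z) \<longlonglongrightarrow> l"
    using function_convergent_subsequence[OF D(1), of ?u G] by blast
  have convD: "Cauchy (\<lambda>n. f (r n) d)" if d: "d \<in> D" for d
  proof -
    obtain l where "(\<lambda>n. ?u (r n) d) \<longlonglongrightarrow> l" using conv[OF d] by blast
    then have "(\<lambda>n. ?u (r n) d * of_real (exp (\<alpha> / 2 * (norm d)\<^sup>2))) \<longlonglongrightarrow> l * of_real (exp (\<alpha> / 2 * (norm d)\<^sup>2))"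
      by (intro tendsto_intros)
    moreover have "?u (r n) d * of_real (exp (\<alpha> / 2 * (norm d)\<^sup>2)) = f (r n) d" for n
      by (simp add: mult.assoc flip: of_real_mult exp_add)
    ultimately show ?thesis by (simp only: convergent_eq_Cauchy[symmetric]) blast
  qed
  have "Cauchy (\<lambda>n. f (r n) x)" for x
  proof (rule metric_CauchyI)
    fix \<epsilon> :: real assume \<epsilon>: "0 < \<epsilon>"
    define L where "L = G * exp (\<alpha> / 2 * (norm x + 2)\<^sup>2)"
    have L0: "0 \<le> L" using G0 by (simp add: L_def)
    have bound: "norm (f n y) \<le> L" if "norm (y - x) \<le> 2" for n y
    proof -
      have "norm y \<le> norm x + 2" using that norm_triangle_sub[of y x] by linarith
      then have "(norm y)\<^sup>2 \<le> (norm x + 2)\<^sup>2" by (intro power_mono) auto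
      then have "exp (\<alpha> / 2 * (norm y)\<^sup>2) \<le> exp (\<alpha> / 2 * (norm x + 2)\<^sup>2)" using \<alpha> by simp
      moreover have "norm (f n y) \<le> G * exp (\<alpha> / 2 * (norm y)\<^sup>2)" using G by (rule norm_le_wabs)
      ultimately show ?thesis using G0 unfolding L_def by (meson mult_left_mono order_trans)
    qed
    define \<delta> where "\<delta> = min 1 (\<epsilon> / (3 * (L + 1)))"
    have \<delta>: "0 < \<delta>" using \<epsilon> L0 by (simp add: \<delta>_def)
    obtain d where d: "d \<in> D" "d \<in> ball x \<delta>" using D(2)[of "ball x \<delta>"] \<delta> by auto
    have nd: "norm (d - x) \<le> \<delta>" using d(2) by (simp add: dist_norm norm_minus_commute)
    have near: "dist (f n d) (f n x) < \<epsilon> / 3" for n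
    proof -
      obtain E where E: "(f n has_derivative E) (at x)" "\<And>c v. E (c *s v) = c * E v"
        using entireE[OF ent[of n], of x] by blast
      have "norm (f n (x + (d - x)) - f n x) \<le> L * norm (d - x)"
        by (rule entire_cauchy_estimates(2)[OF ent bound E]) (use nd in \<open>auto simp: \<delta>_def\<close>)
      also have "\<dots> \<le> L * (\<epsilon> / (3 * (L + 1)))" using nd L0 by (intro mult_left_mono) (auto simp: \<delta>_def)
      also have "\<dots> = \<epsilon> / 3 * (L / (L + 1))" using L0 by simp
      also have "\<dots> < \<epsilon> / 3 * 1" using L0 \<epsilon> by (intro mult_strict_left_mono) auto
      finally show ?thesis by (simp add: dist_norm)
    qed
    obtain N where N: "\<And>m n. m \<ge> N \<Longrightarrow> n \<ge> N \<Longrightarrow> dist (f (r m) d) (f (r n) d) < \<epsilon> / 3"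
      using metric_CauchyD[OF convD[OF d(1)], of "\<epsilon> / 3"] \<epsilon> by auto
    show "\<exists>N. \<forall>m\<ge>N. \<forall>n\<ge>N. dist (f (r m) x) (f (r n) x) < \<epsilon>"
    proof (intro exI[of _ N] allI impI)
      fix m n assume "m \<ge> N" "n \<ge> N"
      then show "dist (f (r m) x) (f (r n) x) < \<epsilon>"
        using N[of m n] near[of "r m"] near[of "r n"]
          dist_triangle2[of "f (r m) x" "f (r n) x" "f (r m) d"] dist_triangle[of "f (r m) d" "f (r n) x" "f (r n) d"]
        by (simp add: dist_commute)
    qed
  qed
  then have "\<exists>l. (\<lambda>n. f (r n) z) \<longlonglongrightarrow> l" for z by (simp add: convergent_eq_Cauchy)
  then show ?thesis using that[OF r] by metis
qed

text \<open>Split the bound for the norm of \<open>T (h n)\<close> at radius \<open>R\<close>: inside, dominated convergence applies; outside, the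
  kernel is of size \<open>\<eta>\<close>, which is chosen so that the contribution is at most \<open>\<epsilon>/4\<close>.\<close>

lemma kernel_op_vanishing:
  fixes h :: "nat \<Rightarrow> complex^'n \<Rightarrow> complex"
  assumes \<alpha>: "0 < \<alpha>" and c: "0 < c" and s: "0 < s"
    and van: "\<And>\<eta>. 0 < \<eta> \<Longrightarrow> \<exists>R M. 0 \<le> M \<and> fock_kernel \<alpha> c (\<lambda>z. if norm z \<le> R then M else \<eta>) Q"
    and h: "\<And>n. h n \<in> fock \<alpha> s" and B: "\<And>n. fock_int \<alpha> s (h n) \<le> B" and lim: "\<And>z. (\<lambda>n. h n z) \<longlonglongrightarrow> 0"
  shows "(\<lambda>n. fock_int \<alpha> s (kernel_op \<alpha> Q (h n))) \<longlonglongrightarrow> 0"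
proof (rule LIMSEQ_I)
  fix \<epsilon> :: real assume \<epsilon>: "0 < \<epsilon>"
  have B0: "0 \<le> B" using B[of 0] fock_int_nonneg[of \<alpha> s "h 0"] by linarith
  have ent: "entire (h n)" and inth: "integrable lborel (\<lambda>z. wabs \<alpha> (h n) z powr s)" for n
    using h[of n] by (auto simp: fock_iff)
  obtain C where C0: "0 < C" and C: "\<And>Q e (f :: complex^'n \<Rightarrow> complex). fock_kernel \<alpha> c e Q \<Longrightarrow> f \<in> fock \<alpha> s \<Longrightarrow>
      kernel_op \<alpha> Q f \<in> fock \<alpha> s \<and>
      (LINT w|lborel. wabs \<alpha> (kernel_op \<alpha> Q f) w powr s) \<le> C * (LINT z|lborel. (wabs \<alpha> f z * e z) powr s)"
    using kernel_op_power_bound[OF \<alpha> c s] by blast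
  obtain G where G': "\<And>(f :: complex^'n \<Rightarrow> complex) z. f \<in> fock \<alpha> s \<Longrightarrow> fock_int \<alpha> s f \<le> B \<Longrightarrow> wabs \<alpha> f z \<le> G"
    using fock_uniform_bound[OF \<alpha> s, of B] by blast
  have G: "wabs \<alpha> (h n) z \<le> G" for n z by (rule G'[OF h B])
  \<comment> \<open>Chosen so that \<open>C \<eta>\<^sup>s B \<le> \<epsilon>/4\<close>; the summand \<open>1\<close> keeps the denominator positive if \<open>B = 0\<close>.\<close>
  define \<eta> where "\<eta> = (\<epsilon> / (4 * C * (B + 1))) powr (1 / s)"
  have \<eta>: "0 < \<eta>" "\<eta> powr s = \<epsilon> / (4 * C * (B + 1))"
    using \<epsilon> C0 B0 s by (auto simp: \<eta>_def powr_powr)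
  obtain R M where M: "0 \<le> M" and Q: "fock_kernel \<alpha> c (\<lambda>z. if norm z \<le> R then M else \<eta>) Q"
    using van[OF \<eta>(1)] by blast
  define J where "J = (\<lambda>n. LINT z|lborel. indicator (cball 0 R) z * wabs \<alpha> (h n) z powr s)"
  have intJ: "integrable lborel (\<lambda>z. indicator (cball 0 R) z * wabs \<alpha> (h n) z powr s)" for n
    by (intro continuous_indicator_integrable continuous_wabs_powr ent s)
  have "J \<longlonglongrightarrow> (LINT z|lborel. indicator (cball (0 :: complex^'n) R) z * (0::real))"
    unfolding J_def
  proof (rule integral_dominated_convergence)
    show "(\<lambda>z. indicator (cball 0 R) z * wabs \<alpha> (h n) z powr s) \<in> borel_measurable lborel" for n
      using intJ by (rule borel_measurable_integrable)
    show "integrable lborel (\<lambda>z :: complex^'n. indicator (cball 0 R) z * G powr s)"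
      by (intro continuous_indicator_integrable continuous_intros)
    have "(\<lambda>n. wabs \<alpha> (h n) z) \<longlonglongrightarrow> 0" for z
      unfolding wabs_def using tendsto_mult_left_zero[OF tendsto_norm_zero[OF lim]] by simp
    then have "(\<lambda>n. wabs \<alpha> (h n) z powr s) \<longlonglongrightarrow> 0 powr s" for z
      using s by (intro tendsto_powr' tendsto_const) auto
    then show "AE z in lborel. (\<lambda>n. indicator (cball 0 R) z * wabs \<alpha> (h n) z powr s) \<longlonglongrightarrow> indicator (cball 0 R) z * 0"
      by (intro AE_I2 tendsto_mult tendsto_const) simp
    show "AE z in lborel. norm (indicator (cball 0 R) z * wabs \<alpha> (h n) z powr s) \<le> indicator (cball 0 R) z * G powr s" for n
      using G s by (intro AE_I2) (auto simp: indicator_def intro: powr_mono2)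
  qed simp
  then have J: "J \<longlonglongrightarrow> 0" by simp
  have bound: "fock_int \<alpha> s (kernel_op \<alpha> Q (h n)) \<le> C * M powr s * J n + \<epsilon> / 4" for n
  proof -
    have "fock_int \<alpha> s (kernel_op \<alpha> Q (h n)) \<le> C * (LINT z|lborel. (wabs \<alpha> (h n) z * (if norm z \<le> R then M else \<eta>)) powr s)"
      unfolding fock_int_def using C[OF Q h] by blast
    also have "\<dots> \<le> C * (LINT z|lborel. M powr s * (indicator (cball 0 R) z * wabs \<alpha> (h n) z powr s) + \<eta> powr s * wabs \<alpha> (h n) z powr s)"
    proof (intro mult_left_mono integral_mono_AE')
      show "integrable lborel (\<lambda>z. M powr s * (indicator (cball 0 R) z * wabs \<alpha> (h n) z powr s) + \<eta> powr s * wabs \<alpha> (h n) z powr s)"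
        using intJ inth by (intro Bochner_Integration.integrable_add integrable_mult_right)
      show "AE z in lborel. (wabs \<alpha> (h n) z * (if norm z \<le> R then M else \<eta>)) powr s
          \<le> M powr s * (indicator (cball 0 R) z * wabs \<alpha> (h n) z powr s) + \<eta> powr s * wabs \<alpha> (h n) z powr s"
        by (intro AE_I2) (simp add: powr_mult mult_ac)
    qed (use C0 in auto)
    also have "\<dots> = C * (M powr s * J n + \<eta> powr s * fock_int \<alpha> s (h n))"
      using intJ[of n] inth[of n] by (simp add: J_def fock_int_def)
    also have "\<dots> \<le> C * (M powr s * J n + \<eta> powr s * B)"
      using C0 B[of n] by (intro mult_left_mono add_left_mono) auto
    also have "\<dots> = C * M powr s * J n + (C * \<eta> powr s) * B"
      by (simp only: distrib_left mult.assoc)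
    also have "C * \<eta> powr s * B = \<epsilon> / 4 * (B / (B + 1))"
      unfolding \<eta>(2) using C0 by simp
    also have "C * M powr s * J n + \<epsilon> / 4 * (B / (B + 1)) \<le> C * M powr s * J n + \<epsilon> / 4 * 1"
      using \<epsilon> B0 by (intro add_left_mono mult_left_mono) auto
    finally show ?thesis by simp
  qed
  have "(\<lambda>n. C * M powr s * J n) \<longlonglongrightarrow> 0" using tendsto_mult_right_zero[OF J] by simp
  then have "\<forall>\<^sub>F n in sequentially. C * M powr s * J n < \<epsilon> / 2"
    using \<epsilon> by (intro order_tendstoD) auto
  then obtain N where N: "\<And>n. n \<ge> N \<Longrightarrow> C * M powr s * J n < \<epsilon> / 2"
    by (auto simp: eventually_sequentially)
  show "\<exists>N. \<forall>n\<ge>N. norm (fock_int \<alpha> s (kernel_op \<alpha> Q (h n)) - 0) < \<epsilon>"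
  proof (intro exI[of _ N] allI impI)
    fix n assume "N \<le> n"
    then show "norm (fock_int \<alpha> s (kernel_op \<alpha> Q (h n)) - 0) < \<epsilon>"
      using N[of n] bound[of n] \<epsilon> by simp
  qed
qed

text \<open>By the Bolzano-Weierstrass criterion for compactness of a closure, an infinite subset of the image
  must have an accumulation point. It contains an injective sequence \<open>T (f n)\<close> with \<open>f n\<close> in the unit ball, and \<open>T g\<close> is such a
  point for a pointwise limit \<open>g\<close> of a subsequence of the \<open>f n\<close>.\<close>

lemma kernel_op_compact:
  fixes Q :: "complex^'n \<Rightarrow> complex^'n \<Rightarrow> complex"
  assumes \<alpha>: "0 < \<alpha>" and c: "0 < c" and s: "0 < s"
    and van: "\<And>\<eta>. 0 < \<eta> \<Longrightarrow> \<exists>R M. 0 \<le> M \<and> fock_kernel \<alpha> c (\<lambda>z. if norm z \<le> R then M else \<eta>) Q"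
  shows "compactin (fock_topology \<alpha> s)
      (fock_topology \<alpha> s closure_of (kernel_op \<alpha> Q ` {f \<in> fock \<alpha> s. fock_norm \<alpha> s f \<le> 1}))"
proof -
  interpret Metric_space "fock \<alpha> s :: (complex^'n \<Rightarrow> complex) set" "fock_dist \<alpha> s"
    using \<alpha> s by (rule fock_metric_space)
  obtain e where Q: "fock_kernel \<alpha> c e Q" using van[of 1] by auto
  note in_fock = kernel_op_in_fock[OF Q \<alpha> c s]
  show ?thesis
    unfolding fock_topology_def compact_closure_of_eq_Bolzano_Weierstrass
  proof (intro allI impI, elim conjE)
    fix X assume inf: "infinite X" and X: "X \<subseteq> kernel_op \<alpha> Q ` {f \<in> fock \<alpha> s. fock_norm \<alpha> s f \<le> 1}"
    obtain y :: "nat \<Rightarrow> complex^'n \<Rightarrow> complex" where y: "inj y" "range y \<subseteq> X"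
      using infinite_countable_subset[OF inf] by blast
    have "\<exists>f. f \<in> fock \<alpha> s \<and> fock_norm \<alpha> s f \<le> 1 \<and> y n = kernel_op \<alpha> Q f" for n
      using y(2) X by blast
    then obtain f where f: "\<And>n. f n \<in> fock \<alpha> s" "\<And>n. fock_norm \<alpha> s (f n) \<le> 1" "\<And>n. y n = kernel_op \<alpha> Q (f n)"
      by metis
    have f1: "fock_int \<alpha> s (f n) \<le> 1" for n
    proof -
      have "(fock_int \<alpha> s (f n) powr (1 / s)) powr s \<le> 1 powr s"
        using f(2)[of n] s unfolding fock_norm_int by (intro powr_mono2) auto
      then show ?thesis using s by (simp add: powr_powr)
    qed
    obtain r g where r: "strict_mono (r :: nat \<Rightarrow> nat)" and lim: "\<And>z. (\<lambda>n. f (r n) z) \<longlonglongrightarrow> g z"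
      using fock_pointwise_subsequence[where f = f, OF \<alpha> s f(1) f1] by metis
    have g: "g \<in> fock \<alpha> s" "fock_int \<alpha> s g \<le> 1"
      using fock_pointwise_limit[where f = "\<lambda>n. f (r n)", OF \<alpha> s f(1) f1 lim] by auto
    define h where "h = (\<lambda>n z. f (r n) z - g z)"
    have h: "h n \<in> fock \<alpha> s" for n
      unfolding h_def by (rule fock_diff(1)[OF s f(1) g(1)])
    have hB: "fock_int \<alpha> s (h n) \<le> 2 powr s * (1 + 1)" for n
      unfolding h_def
      by (rule order_trans[OF fock_diff(2)[OF s f(1) g(1)]]) (intro mult_left_mono add_mono f1 g(2), simp)
    have hlim: "(\<lambda>n. h n z) \<longlonglongrightarrow> 0" for z
      unfolding h_def using tendsto_diff[OF lim tendsto_const, of z "g z"] by simp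
    have zero: "(\<lambda>n. fock_int \<alpha> s (kernel_op \<alpha> Q (h n))) \<longlonglongrightarrow> 0"
      by (rule kernel_op_vanishing[where h = h, OF \<alpha> c s van h hB hlim])
    have lin: "clinear_on (fock \<alpha> s) (kernel_op \<alpha> Q)"
      by (rule kernel_op_clinear[OF Q c]) (rule subsetI, rule fock_subset_infty[OF \<alpha> s])
    have Th: "kernel_op \<alpha> Q (h n) = (\<lambda>z. y (r n) z - kernel_op \<alpha> Q g z)" for n
      using clinear_on_add[OF lin f(1) fock_scale(1)[OF g(1), of "- 1"], of "r n"] clinear_on_scale[OF lin g(1), of "- 1"]
      by (simp add: h_def f(3))
    let ?g = "kernel_op \<alpha> Q g"
    have dist0: "(\<lambda>n. fock_dist \<alpha> s (y (r n)) ?g) \<longlonglongrightarrow> 0"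
    proof (cases "s < 1")
      case True
      then show ?thesis using zero s by (simp add: fock_dist_int Th)
    next
      case False
      have "(\<lambda>n. fock_int \<alpha> s (kernel_op \<alpha> Q (h n)) powr (1 / s)) \<longlonglongrightarrow> 0 powr (1 / s)"
        using zero s by (intro tendsto_powr' tendsto_const) auto
      then show ?thesis using False s by (simp add: fock_dist_int Th)
    qed
    have "?g \<in> mtopology derived_set_of X"
      unfolding metric_derived_set_of
    proof (intro CollectI conjI allI impI)
      show "?g \<in> fock \<alpha> s" by (rule in_fock[OF g(1)])
      fix \<rho> :: real assume "0 < \<rho>"
      with dist0 have "\<forall>\<^sub>F n in sequentially. fock_dist \<alpha> s (y (r n)) ?g < \<rho>"
        by (intro order_tendstoD)
      then obtain N where N: "\<And>n. n \<ge> N \<Longrightarrow> fock_dist \<alpha> s (y (r n)) ?g < \<rho>"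
        by (auto simp: eventually_sequentially)
      \<comment> \<open>One of two consecutive terms differs from the limit, because the sequence is injective.\<close>
      have "y (r N) \<noteq> y (r (Suc N))"
        using y(1) r by (simp add: inj_eq strict_mono_eq)
      then obtain n where n: "n \<ge> N" "y (r n) \<noteq> ?g" by (metis le_refl le_SucI)
      have "y (r n) \<in> mball ?g \<rho>"
        using N[OF n(1)] in_fock[OF g(1)] in_fock[OF f(1), of "r n"] f(3)[of "r n"]
        by (simp add: commute)
      then show "\<exists>x\<in>X. x \<noteq> ?g \<and> x \<in> mball ?g \<rho>" using y(2) n(2) by blast
    qed
    then show "mtopology derived_set_of X \<noteq> {}" by blast
  qed
qed

section \<open>Boundedness and compactness from the local integrals\<close>

lemma kernel_op_bounded:
  fixes Q :: "complex^'n \<Rightarrow> complex^'n \<Rightarrow> complex"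
  assumes Q: "fock_kernel \<alpha> c (\<lambda>_. M) Q" and \<alpha>: "0 < \<alpha>" and c: "0 < c" and s: "0 < s"
  shows "\<exists>B. \<forall>f\<in>fock \<alpha> s. fock_norm \<alpha> s (kernel_op \<alpha> Q f) \<le> B * fock_norm \<alpha> s f"
proof -
  have M: "0 \<le> M" using Q by (auto simp: fock_kernel_def)
  obtain C where C0: "0 < C" and C: "\<And>Q e (f :: complex^'n \<Rightarrow> complex). fock_kernel \<alpha> c e Q \<Longrightarrow> f \<in> fock \<alpha> s \<Longrightarrow>
      kernel_op \<alpha> Q f \<in> fock \<alpha> s \<and>
      (LINT w|lborel. wabs \<alpha> (kernel_op \<alpha> Q f) w powr s) \<le> C * (LINT z|lborel. (wabs \<alpha> f z * e z) powr s)"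
    using kernel_op_power_bound[OF \<alpha> c s] by blast
  have "fock_norm \<alpha> s (kernel_op \<alpha> Q f) \<le> (C powr (1 / s) * M) * fock_norm \<alpha> s f" if f: "f \<in> fock \<alpha> s" for f
  proof -
    have "fock_int \<alpha> s (kernel_op \<alpha> Q f) \<le> C * (LINT z|lborel. wabs \<alpha> f z powr s * M powr s)"
      using C[OF Q f] M by (simp add: fock_int_def powr_mult)
    also have "\<dots> = C * (M powr s * fock_int \<alpha> s f)" by (simp add: fock_int_def)
    finally have "fock_int \<alpha> s (kernel_op \<alpha> Q f) powr (1 / s) \<le> (C * (M powr s * fock_int \<alpha> s f)) powr (1 / s)"
      using s by (intro powr_mono2) auto
    also have "\<dots> = C powr (1 / s) * M * fock_int \<alpha> s f powr (1 / s)"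
      using s C0 M by (simp add: powr_mult powr_powr)
    finally show ?thesis by (simp add: fock_norm_int)
  qed
  then show ?thesis by blast
qed

theorem theorem4p1:
  fixes \<alpha> \<sigma> p :: real
  assumes "0 < \<alpha>" and "0 < \<sigma>" and "\<sigma> < p"
  shows "\<exists>C::real. \<forall>S :: 'n::finite operator.
    admissible \<alpha> S \<longrightarrow> (SUP z. local_integral \<alpha> p \<sigma> S z) < \<infinity> \<longrightarrow>
      (\<forall>z w. norm (fock_inner \<alpha> (S (norm_kernel \<alpha> z)) (norm_kernel \<alpha> w))
         \<le> C * enn2real (SUP z. local_integral \<alpha> p \<sigma> S z) powr (1 / p)
             * exp (- (\<alpha> * (p - \<sigma>) / (2 * p)) * (norm (z - w))\<^sup>2)) \<and>
      (\<forall>s>0. bounded_on_fock \<alpha> s S) \<and>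
      ((local_integral \<alpha> p \<sigma> S \<longlongrightarrow> 0) at_infinity \<longrightarrow> (\<forall>s>0. compact_on_fock \<alpha> s S))"
proof -
  note \<alpha> = assms(1)
  have p: "0 < p" using assms by simp
  define c where "c = \<alpha> * (p - \<sigma>) / (2 * p)"
  have c: "0 < c" using assms p by (simp add: c_def)
  define \<kappa> where "\<kappa> = (\<alpha> / pi) ^ CARD('n) * gauss \<alpha> TYPE('n)"
  have \<kappa>: "0 < \<kappa>" using \<alpha> gauss_pos[OF \<alpha>, where 'n = 'n] by (simp add: \<kappa>_def)
  obtain C where C0: "0 < C" and C: "\<And>(S :: 'n::finite operator) z w. admissible \<alpha> S \<Longrightarrow> local_integral \<alpha> p \<sigma> S z < \<infinity> \<Longrightarrow>
    wabs \<alpha> (S (norm_kernel \<alpha> z)) w \<le> C * enn2real (local_integral \<alpha> p \<sigma> S z) powr (1 / p)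
      * exp (- (\<alpha> * (p - \<sigma>) / (2 * p)) * (norm (w - z))\<^sup>2)"
    using norm_kernel_image_estimate[OF assms] by blast
  show ?thesis
  proof (intro exI[of _ "\<kappa> * C"] allI impI conjI)
    fix S :: "'n operator"
    assume S: "admissible \<alpha> S" and fin: "(SUP z. local_integral \<alpha> p \<sigma> S z) < \<infinity>"
    let ?L = "local_integral \<alpha> p \<sigma> S"
    define m where "m = enn2real (SUP z. ?L z)"
    have Lz: "?L z \<le> (SUP z. ?L z)" for z by (rule SUP_upper) simp
    have finz: "?L z < \<infinity>" for z using Lz fin by (rule le_less_trans)
    have mz: "enn2real (?L z) \<le> m" for z
      unfolding m_def using Lz fin by (intro enn2real_mono) auto
    define M where "M = C * m powr (1 / p)"
    have M: "0 \<le> M" using C0 by (simp add: M_def)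
    have est_le: "wabs \<alpha> (S (norm_kernel \<alpha> z)) w \<le> C * a powr (1 / p) * exp (- c * (norm (w - z))\<^sup>2)"
      if "enn2real (?L z) \<le> a" for z w a
    proof -
      have "enn2real (?L z) powr (1 / p) \<le> a powr (1 / p)"
        using that p by (intro powr_mono2) auto
      then show ?thesis
        using C[OF S finz, of z w] C0 unfolding c_def
        by (elim order_trans) (intro mult_right_mono mult_left_mono, auto)
    qed
    have estM: "wabs \<alpha> (S (norm_kernel \<alpha> z)) w \<le> M * exp (- c * (norm (w - z))\<^sup>2)" for z w
      unfolding M_def by (rule est_le[OF mz])
    have kM: "fock_kernel \<alpha> c (\<lambda>_. M) (\<lambda>w z. S (rep_kernel \<alpha> z) w)"
      by (rule fock_kernel_of_operator[OF S _ _ _ estM]) (use M in auto)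
    {
      fix z w
      have "norm (fock_inner \<alpha> (S (norm_kernel \<alpha> z)) (norm_kernel \<alpha> w)) = \<kappa> * wabs \<alpha> (S (norm_kernel \<alpha> z)) w"
        unfolding fock_inner_norm_kernel[OF \<alpha> admissible_facts(4)[OF S]] norm_mult norm_of_real
        using \<kappa> \<alpha> gauss_pos[OF \<alpha>, where 'n = 'n] by (simp add: \<kappa>_def wabs_def abs_mult)
      also have "\<dots> \<le> \<kappa> * (M * exp (- c * (norm (w - z))\<^sup>2))"
        using \<kappa> by (intro mult_left_mono estM) auto
      finally show "norm (fock_inner \<alpha> (S (norm_kernel \<alpha> z)) (norm_kernel \<alpha> w))
         \<le> \<kappa> * C * enn2real (SUP z. ?L z) powr (1 / p) * exp (- (\<alpha> * (p - \<sigma>) / (2 * p)) * (norm (z - w))\<^sup>2)"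
        by (simp add: M_def m_def c_def norm_minus_commute mult.assoc)
    }
    {
      fix s :: real assume s: "0 < s"
      show "bounded_on_fock \<alpha> s S"
        unfolding bounded_on_fock_def
        using extends_to_kernel_op[OF S kM \<alpha> c s] kernel_op_bounded[OF kM \<alpha> c s] by blast
    }
    {
      assume lim: "(?L \<longlongrightarrow> 0) at_infinity"
      fix s :: real assume s: "0 < s"
      have "\<exists>R M. 0 \<le> M \<and> fock_kernel \<alpha> c (\<lambda>z. if norm z \<le> R then M else \<eta>) (\<lambda>w z. S (rep_kernel \<alpha> z) w)"
        if \<eta>: "0 < \<eta>" for \<eta>
      proof -
        \<comment> \<open>The bound on the local integral for which the kernel estimate gives exactly \<open>\<eta>\<close>.\<close>
        define a where "a = (\<eta> / C) powr p"
        have a: "0 < a" "C * a powr (1 / p) = \<eta>" using \<eta> C0 p by (auto simp: a_def powr_powr)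
        have "\<forall>\<^sub>F z in at_infinity. ?L z < ennreal a"
          using a(1) by (intro order_tendstoD(2)[OF lim]) simp
        then obtain R where R: "\<And>z. R \<le> norm z \<Longrightarrow> ?L z < ennreal a"
          by (auto simp: eventually_at_infinity)
        have "wabs \<alpha> (S (norm_kernel \<alpha> z)) w \<le> (if norm z \<le> R then M else \<eta>) * exp (- c * (norm (w - z))\<^sup>2)" for z w
        proof (cases "norm z \<le> R")
          case False
          then have "?L z \<le> ennreal a" using R[of z] by simp
          then have "enn2real (?L z) \<le> a" using a(1) by (simp add: enn2real_leI)
          from est_le[OF this, of w] show ?thesis using False by (simp add: a(2))
        qed (use estM in simp)
        then have "fock_kernel \<alpha> c (\<lambda>z. if norm z \<le> R then M else \<eta>) (\<lambda>w z. S (rep_kernel \<alpha> z) w)"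
          by (intro fock_kernel_of_operator[OF S, where E = "max M \<eta>"]) (use M \<eta> in auto)
        then show ?thesis using M by blast
      qed
      from kernel_op_compact[OF \<alpha> c s this]
      show "compact_on_fock \<alpha> s S"
        unfolding compact_on_fock_def using extends_to_kernel_op[OF S kM \<alpha> c s] by blast
    }
  qed
qed

end
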